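(* Let $k$ be a field of arbitrary characteristic, let $G$ be a finite group acting linearly on a finite-dimensional $k$-vector space $V$, and let $\lambda: kG\otimes V\to kG$ and $\kappa: V\otimes V\to kG$ be $k$-linear maps with $\kappa$ alternating. View $\lambda$ and $\kappa$ as 2-cochains on the resolution $X_\bullet$ of $A=S(V)\# G$ (as described in the context). The algebra $\mathcal{H}_{\lambda,\kappa}$ exhibits the PBW property if and only if - $d^*(\lambda)=0$, - $[\lambda,\lambda]=2d^*(\kappa)$, and - $[\lambda,\kappa]=0$ as Hochschild cochains on $X_\bullet$.
   Context: Notation: $\otimes=\otimes_k$; ${}^gv$ is the action of $g$ on $v$; $\lambda(g,v)=\lambda(g\otimes v)$, $\kappa(v,w)=\kappa(v\otimes w)$. $A=S(V)\# G$ is the vector space $S(V)\otimes kG$ with product $(r\otimes g)(s\otimes h)=r({}^gs)\otimes gh$, graded with $V$ in degree 1, $G$ in degree 0; $A^e=A\otimes A^{op}$. **The algebra.** $\mathcal{H}_{\lambda,\kappa}$ is the associative unital $k$-algebra generated by a basis of $V$ and $kG$, subject to the relations in $kG$ and $vw-wv=\kappa(v,w)$, $gv-{}^gv\,g=\lambda(g,v)$ for all $v,w\in V$, $g\in G$, filtered by $\deg v=1$, $\deg g=0$. It exhibits the PBW property when $\mathrm{gr}(\mathcal{H}_{\lambda,\kappa})\cong S(V)\# G$ as graded algebras; equivalently, when $\{v_1^{i_1}\cdots v_m^{i_m}g: i_j\in\mathbb{Z}_{\ge0},\ g\in G\}$ is a $k$-basis, for $v_1,\dots,v_m$ any basis of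 $V$. **Bar resolution.** $A^{\otimes(\bullet+2)}$, with $\delta_n(a_0\otimes\cdots\otimes a_{n+1})=\sum_{i=0}^n(-1)^ia_0\otimes\cdots\otimes a_ia_{i+1}\otimes\cdots\otimes a_{n+1}$. A 2-cochain on it is an $A^e$-map $A^{\otimes 4}\to A$, identified with a $k$-linear map $\mu:A\otimes A\to A$. **Resolution $X_\bullet$.** $X_{i,j}=A\otimes(kG)^{\otimes i}\otimes\bigwedge^j(V)\otimes A$, with $A^e$ acting on the outer factors, $X_n=\bigoplus_{i+j=n}X_{i,j}$, $d_n=\sum_{i+j=n}(d^h_{i,j}+d^v_{i,j})$, where $d^h_{i,j}(1\otimes g_1\otimes\cdots\otimes g_i\otimes x\otimes 1)=g_1\otimes\cdots\otimes g_i\otimes x\otimes 1+\sum_{l=1}^{i-1}(-1)^l\otimes g_1\otimes\cdots\otimes g_lg_{l+1}\otimes\cdots\otimes g_i\otimes x\otimes 1+(-1)^i\otimes g_1\otimes\cdots\otimes g_{i-1}\otimes{}^{g_i}x\otimes g_i$ (and $d^h_{0,j}=0$), and $d^v_{i,j}(1\otimes g_1\otimes\cdots\otimes g_i\otimes v_1\wedge\cdots\wedge v_j\otimes 1)=(-1)^{i+1}\sum_{l=1}^j(-1)^l\big({}^{g_1\cdots g_i}v_l\otimes g_1\otimes\cdots\otimes g_i\otimes v_1\wedge\cdots\widehat{v_l}\cdots\wedge v_j\otimes 1-1\otimes g_1\otimes\cdots\otimes g_i\otimes v_1\wedge\cdots\widehat{v_l}\cdots\wedge v_j\otimes v_l\big)$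 (and $d^v_{i,0}=0$). With the multiplication map $X_0=A\otimes A\to A$, $X_\bullet$ is a free $A^e$-resolution of $A$. An $n$-cochain on $X_\bullet$ is an $A^e$-map $f:X_n\to A$, and $d^*(f)=f\circ d_{n+1}$. Elements of $\bigwedge^j(V)$ have degree $j$ and elements of $(kG)^{\otimes i}$ have degree 0. **Parameters as cochains.** $\lambda$ is viewed as the 2-cochain on $X_\bullet$ with $1\otimes g\otimes v\otimes 1\mapsto\lambda(g,v)$ on $X_{1,1}$ and zero on $X_{2,0}$ and $X_{0,2}$; $\kappa$ as the 2-cochain with $1\otimes v\wedge w\otimes 1\mapsto\kappa(v,w)$ on $X_{0,2}$ and zero on $X_{2,0}$ and $X_{1,1}$. **Chain maps.** Fix $A^e$-linear chain maps $\phi_\bullet:X_\bullet\to A^{\otimes(\bullet+2)}$ and $\psi_\bullet:A^{\otimes(\bullet+2)}\to X_\bullet$ of degree 0 lifting the identity of $A$, with $\psi_n\phi_n=\mathrm{id}$ for $n=0,1,2$, $\phi_0=\psi_0=\mathrm{id}$, and (for all $g,h,\ell\in G$, $v,w,v_i\in V$): $\phi_1(1\otimes g\otimes1)=1\otimes g\otimes 1$, $\phi_1(1\otimes v\otimes 1)=1\otimes v\otimes 1$; $\psi_1(1\otimes g\otimes 1)=1\otimes g\otimes 1$, $\psi_1(1\otimes v\otimes 1)=1\otimes v\otimes 1$, $\psi_1(1\otimes vg\otimes 1)=1\otimes v\otimes g+v\otimes g\otimes 1$; $\phi_2(1\otimes g\otimes h\otimes 1)=1\otimes g\otimes h\otimes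 1$, $\phi_2(1\otimes g\otimes v\otimes 1)=1\otimes g\otimes v\otimes 1-1\otimes{}^gv\otimes g\otimes 1$, $\phi_2(1\otimes v\wedge w\otimes 1)=1\otimes v\otimes w\otimes 1-1\otimes w\otimes v\otimes 1$; $\psi_2(1\otimes g\otimes h\otimes 1)=1\otimes g\otimes h\otimes 1\in X_{2,0}$, $\psi_2(1\otimes g\otimes v\otimes 1-1\otimes{}^gv\otimes g\otimes 1)=1\otimes g\otimes v\otimes 1\in X_{1,1}$, $\psi_2(1\otimes v\otimes g\otimes 1)=0$, $\psi_2(1\otimes v\otimes w\otimes 1-1\otimes w\otimes v\otimes 1)=1\otimes v\wedge w\otimes 1\in X_{0,2}$ (in fact, for a fixed basis $v_1,\dots,v_m$ of $V$, $\psi_2(1\otimes v_i\otimes v_j\otimes 1)$ equals $1\otimes v_i\wedge v_j\otimes 1$ if $i<j$ and $0$ if $j<i$); $\phi_3(1\otimes g\otimes h\otimes\ell\otimes 1)=1\otimes g\otimes h\otimes\ell\otimes 1$, $\phi_3(1\otimes g\otimes h\otimes v\otimes 1)=1\otimes g\otimes h\otimes v\otimes 1-1\otimes g\otimes{}^hv\otimes h\otimes 1+1\otimes{}^{gh}v\otimes g\otimes h\otimes 1$, $\phi_3(1\otimes g\otimes v\wedge w\otimes 1)=1\otimes g\otimes v\otimes w\otimes 1-1\otimes g\otimes w\otimes v\otimes 1+1\otimes{}^gv\otimes{}^gw\otimes g\otimes 1-1\otimes{}^gw\otimes{}^gv\otimes g\otimes 1-1\otimes{}^gv\otimes g\otimes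 w\otimes 1+1\otimes{}^gw\otimes g\otimes v\otimes 1$, $\phi_3(1\otimes v_1\wedge v_2\wedge v_3\otimes 1)=\sum_{\sigma\in\mathrm{Sym}_3}\mathrm{sgn}(\sigma)\otimes v_{\sigma(1)}\otimes v_{\sigma(2)}\otimes v_{\sigma(3)}\otimes 1$. Such chain maps exist. **Gerstenhaber bracket.** For $k$-linear $\mu,\nu:A\otimes A\to A$, $[\mu,\nu](a_1\otimes a_2\otimes a_3)=\mu(\nu(a_1\otimes a_2)\otimes a_3)-\mu(a_1\otimes\nu(a_2\otimes a_3))+\nu(\mu(a_1\otimes a_2)\otimes a_3)-\nu(a_1\otimes\mu(a_2\otimes a_3))$, viewed as a 3-cochain on the bar resolution. For 2-cochains $\alpha,\beta$ on $X_\bullet$, the bracket is the one induced through the chain maps: $[\alpha,\beta]=\phi_3^*[\psi_2^*\alpha,\psi_2^*\beta]$, where $\psi_2^*\alpha=\alpha\circ\psi_2$ and $\phi_3^*f=f\circ\phi_3$.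
   Formalization: In characteristic 2, where the three conditions do not imply PBW, the condition λ∘λ = d*(κ) (the second one with its factor 2 cancelled) is added; the values of ψ_1 at 1⊗vg⊗1 and ψ_2 at 1⊗v⊗g⊗1 are prescribed only for g≠1, since at g=1 they are contradictory. *)

theory Defs
  imports
    Complex_Main
    "HOL-Library.Poly_Mapping"
    "HOL-Combinatorics.Permutations"
    "HOL-Algebra.QuotRing"
begin

section \<open>Vector spaces with a distinguished basis\<close>

text \<open>
  A \<open>k\<close>-vector space with basis indexed by \<open>'x\<close> is the type of finitely supported functions
  \<open>'x \<Rightarrow>\<^sub>0 'k\<close>; tensor products of such spaces are indexed by tuples (or lists) of basis indices.
\<close>

abbreviation bvec :: "'x \<Rightarrow> ('x \<Rightarrow>\<^sub>0 'k::field)" where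
  "bvec p \<equiv> Poly_Mapping.single p 1"

definition pscale :: "'k::field \<Rightarrow> ('x \<Rightarrow>\<^sub>0 'k) \<Rightarrow> ('x \<Rightarrow>\<^sub>0 'k)" where
  "pscale c f = Poly_Mapping.map ((*) c) f"

text \<open>The linear map with prescribed values on the basis.\<close>

definition lext :: "('x \<Rightarrow> ('y \<Rightarrow>\<^sub>0 'k)) \<Rightarrow> ('x \<Rightarrow>\<^sub>0 'k::field) \<Rightarrow> ('y \<Rightarrow>\<^sub>0 'k)" where
  "lext f x = (\<Sum>p\<in>Poly_Mapping.keys x. pscale (Poly_Mapping.lookup x p) (f p))"

text \<open>The subspace with basis \<open>S\<close>.\<close>

definition pspan :: "'x set \<Rightarrow> ('x \<Rightarrow>\<^sub>0 'k::field) set" where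
  "pspan S = {f. Poly_Mapping.keys f \<subseteq> S}"

section \<open>The skew group algebra and its two resolutions\<close>

text \<open>
  With \<open>vs = [v\<^sub>0, \<dots>]\<close> an ordered basis of \<open>V\<close>, a pair \<open>(\<alpha>, g)\<close> stands for the basis element
  \<open>v\<^sup>\<alpha> \<otimes> g\<close> of \<open>S(V) \<otimes> kG\<close>. A tuple \<open>(p, gs, js, q)\<close> stands for the basis element
  \<open>p \<otimes> g\<^sub>1 \<otimes> \<dots> \<otimes> g\<^sub>i \<otimes> v\<^bsub>j1\<^esub> \<and> \<dots> \<and> v\<^bsub>jr\<^esub> \<otimes> q\<close> of \<open>A \<otimes> (kG)\<^sup>i \<otimes> \<And>\<^sup>r V \<otimes> A\<close>, where \<open>js\<close> is
  strictly increasing, and a list of length \<open>n\<close> for a basis element of the \<open>n\<close>-fold tensor power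
  of \<open>A\<close>. All these types are larger than the spaces they host (exponents and indices must stay
  below \<open>dim V\<close>); the carriers are \<open>skew_space\<close>, \<open>res_space\<close> and \<open>bar_space\<close> below.
\<close>

type_synonym 'g mon = "(nat \<Rightarrow>\<^sub>0 nat) \<times> 'g"
type_synonym ('g, 'k) skew_alg = "'g mon \<Rightarrow>\<^sub>0 'k"
type_synonym ('g, 'k) bar = "'g mon list \<Rightarrow>\<^sub>0 'k"
type_synonym ('g, 'k) res = "('g mon \<times> 'g list \<times> nat list \<times> 'g mon) \<Rightarrow>\<^sub>0 'k"

definition mon_deg :: "'g mon \<Rightarrow> nat" where
  "mon_deg p = (\<Sum>i\<in>Poly_Mapping.keys (fst p). Poly_Mapping.lookup (fst p) i)"

text \<open>
  The finite group \<open>G\<close> is the type \<open>'g\<close>. The class \<open>group_add\<close> does not assume commutativity; the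
  product of \<open>g\<close> and \<open>h\<close> is written \<open>g + h\<close> and the neutral element \<open>0\<close>. Neither faithfulness of
  the action nor \<open>V \<noteq> 0\<close> is assumed.
\<close>

locale skew_setup = finite_dimensional_vector_space scale "set vs"
  for scale :: "'k::field \<Rightarrow> 'v::ab_group_add \<Rightarrow> 'v" and vs :: "'v list" +
  fixes act :: "'g::{group_add, finite} \<Rightarrow> 'v \<Rightarrow> 'v"
  assumes distinct_vs: "distinct vs"
    and linear_act: "Vector_Spaces.linear scale scale (act g)"
    and act_one: "act 0 v = v"
    and act_mult: "act (g + h) v = act g (act h v)"
begin

definition coord :: "'v \<Rightarrow> nat \<Rightarrow> 'k" where
  "coord v i = representation (set vs) v (vs ! i)"

subsection \<open>The algebra \<open>A = S(V) # G\<close>\<close>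

definition mons :: "'g mon set" where
  "mons = {p. Poly_Mapping.keys (fst p) \<subseteq> {..<length vs}}"

definition skew_space :: "('g, 'k) skew_alg set" where
  "skew_space = pspan mons"

definition skew_homog :: "nat \<Rightarrow> ('g, 'k) skew_alg set" where
  "skew_homog n = pspan {p \<in> mons. mon_deg p = n}"

definition sym_vec :: "'v \<Rightarrow> ((nat \<Rightarrow>\<^sub>0 nat) \<Rightarrow>\<^sub>0 'k)" where
  "sym_vec v = (\<Sum>i<length vs. Poly_Mapping.single (Poly_Mapping.single i 1) (coord v i))"

text \<open>
  The action on \<open>S(V)\<close> by algebra automorphisms. Here and below, products of elements of
  \<open>(nat \<Rightarrow>\<^sub>0 nat) \<Rightarrow>\<^sub>0 'k\<close> are the library's convolution products, i.e. products of polynomials.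
\<close>

definition sym_act :: "'g \<Rightarrow> ((nat \<Rightarrow>\<^sub>0 nat) \<Rightarrow>\<^sub>0 'k) \<Rightarrow> ((nat \<Rightarrow>\<^sub>0 nat) \<Rightarrow>\<^sub>0 'k)" where
  "sym_act g = lext (\<lambda>\<beta>. \<Prod>i<length vs. sym_vec (act g (vs ! i)) ^ Poly_Mapping.lookup \<beta> i)"

definition tensor_grp :: "((nat \<Rightarrow>\<^sub>0 nat) \<Rightarrow>\<^sub>0 'k) \<Rightarrow> 'g \<Rightarrow> ('g, 'k) skew_alg" where
  "tensor_grp r g = lext (\<lambda>\<alpha>. bvec (\<alpha>, g)) r"

text \<open>\<open>(r \<otimes> g)(s \<otimes> h) = r (\<^sup>gs) \<otimes> gh\<close>; the convolution product of this type is a different one.\<close>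

definition skew_mult :: "('g, 'k) skew_alg \<Rightarrow> ('g, 'k) skew_alg \<Rightarrow> ('g, 'k) skew_alg"
    (infixl \<open>\<star>\<close> 70) where
  "a \<star> b = lext (\<lambda>(\<alpha>, g). lext (\<lambda>(\<beta>, h). tensor_grp (bvec \<alpha> * sym_act g (bvec \<beta>)) (g + h)) b) a"

definition one_skew :: "('g, 'k) skew_alg" where
  "one_skew = bvec (0, 0)"

definition of_vec :: "'v \<Rightarrow> ('g, 'k) skew_alg" where
  "of_vec v = tensor_grp (sym_vec v) 0"

definition of_grp :: "'g \<Rightarrow> ('g, 'k) skew_alg" where
  "of_grp g = bvec (0, g)"

definition of_grpalg :: "('g \<Rightarrow>\<^sub>0 'k) \<Rightarrow> ('g, 'k) skew_alg" where
  "of_grpalg = lext of_grp"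

subsection \<open>The bar resolution\<close>

text \<open>\<open>tens [a\<^sub>1, \<dots>, a\<^sub>n] = a\<^sub>1 \<otimes> \<dots> \<otimes> a\<^sub>n\<close>\<close>

primrec tens :: "('g, 'k) skew_alg list \<Rightarrow> ('g, 'k) bar" where
  "tens [] = bvec []"
| "tens (a # as) = lext (\<lambda>p. lext (\<lambda>ps. bvec (p # ps)) (tens as)) a"

text \<open>\<open>bar_space n\<close> is the \<open>(n + 2)\<close>-fold tensor power of \<open>A\<close>.\<close>

definition bar_space :: "nat \<Rightarrow> ('g, 'k) bar set" where
  "bar_space n = pspan {ps. length ps = n + 2 \<and> set ps \<subseteq> mons}"

definition bar_homog :: "nat \<Rightarrow> nat \<Rightarrow> ('g, 'k) bar set" where
  "bar_homog n d = pspan {ps. length ps = n + 2 \<and> set ps \<subseteq> mons \<and> sum_list (map mon_deg ps) = d}"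

definition bar_act :: "('g, 'k) skew_alg \<Rightarrow> ('g, 'k) bar \<Rightarrow> ('g, 'k) skew_alg \<Rightarrow> ('g, 'k) bar" where
  "bar_act a x b =
    lext (\<lambda>ps. tens ((a \<star> bvec (hd ps)) # map bvec (butlast (tl ps)) @ [bvec (last ps) \<star> b])) x"

definition bar_diff :: "('g, 'k) bar \<Rightarrow> ('g, 'k) bar" where
  "bar_diff = lext (\<lambda>ps. \<Sum>i<length ps - 1. pscale ((-1) ^ i)
     (tens (map bvec (take i ps) @ [bvec (ps ! i) \<star> bvec (ps ! Suc i)] @
            map bvec (drop (i + 2) ps))))"

subsection \<open>The resolution \<open>X\<close>\<close>

definition wedge_idx :: "nat \<Rightarrow> nat list set" where
  "wedge_idx j = {js. length js = j \<and> sorted_wrt (<) js \<and> set js \<subseteq> {..<length vs}}"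

text \<open>
  \<open>u\<^sub>1 \<and> \<dots> \<and> u\<^sub>j\<close> in the standard basis of \<open>\<And>\<^sup>j V\<close>: the coefficients are the \<open>j \<times> j\<close> minors of the
  coordinate matrix.
\<close>

definition wedge :: "'v list \<Rightarrow> (nat list \<Rightarrow>\<^sub>0 'k)" where
  "wedge us = (\<Sum>js\<in>wedge_idx (length us). Poly_Mapping.single js
     (\<Sum>\<pi> | \<pi> permutes {..<length us}.
        of_int (sign \<pi>) * (\<Prod>a<length us. coord (us ! a) (js ! \<pi> a))))"

text \<open>\<open>a \<otimes> g\<^sub>1 \<otimes> \<dots> \<otimes> g\<^sub>i \<otimes> w \<otimes> b\<close> for \<open>w\<close> in the exterior algebra\<close>

definition res_tens ::
    "('g, 'k) skew_alg \<Rightarrow> 'g list \<Rightarrow> (nat list \<Rightarrow>\<^sub>0 'k) \<Rightarrow> ('g, 'k) skew_alg \<Rightarrow> ('g, 'k) res" where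
  "res_tens a gs w b = lext (\<lambda>p. lext (\<lambda>js. lext (\<lambda>q. bvec (p, gs, js, q)) b) w) a"

text \<open>\<open>1 \<otimes> g\<^sub>1 \<otimes> \<dots> \<otimes> g\<^sub>i \<otimes> u\<^sub>1 \<and> \<dots> \<and> u\<^sub>j \<otimes> 1\<close>\<close>

definition res_gen :: "'g list \<Rightarrow> 'v list \<Rightarrow> ('g, 'k) res" where
  "res_gen gs us = res_tens one_skew gs (wedge us) one_skew"

definition res_basis :: "nat \<Rightarrow> ('g mon \<times> 'g list \<times> nat list \<times> 'g mon) set" where
  "res_basis n = {(p, gs, js, q). p \<in> mons \<and> q \<in> mons \<and> js \<in> wedge_idx (length js) \<and>
     length gs + length js = n}"

definition res_space :: "nat \<Rightarrow> ('g, 'k) res set" where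
  "res_space n = pspan (res_basis n)"

definition res_homog :: "nat \<Rightarrow> nat \<Rightarrow> ('g, 'k) res set" where
  "res_homog n d =
    pspan {(p, gs, js, q). (p, gs, js, q) \<in> res_basis n \<and> mon_deg p + length js + mon_deg q = d}"

definition res_act :: "('g, 'k) skew_alg \<Rightarrow> ('g, 'k) res \<Rightarrow> ('g, 'k) skew_alg \<Rightarrow> ('g, 'k) res" where
  "res_act a x b =
    lext (\<lambda>(p, gs, js, q). res_tens (a \<star> bvec p) gs (bvec js) (bvec q \<star> b)) x"

text \<open>Values of the two differentials on \<open>res_gen gs us\<close>; list positions start at 0.\<close>

definition res_dh :: "'g list \<Rightarrow> 'v list \<Rightarrow> ('g, 'k) res" where
  "res_dh gs us = (if gs = [] then 0 else
     res_tens (of_grp (hd gs)) (tl gs) (wedge us) one_skew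
     + (\<Sum>l = 1..<length gs. pscale ((-1) ^ l)
          (res_gen (take (l - 1) gs @ [gs ! (l - 1) + gs ! l] @ drop (l + 1) gs) us))
     + pscale ((-1) ^ length gs)
          (res_tens one_skew (butlast gs) (wedge (map (act (last gs)) us)) (of_grp (last gs))))"

definition res_dv :: "'g list \<Rightarrow> 'v list \<Rightarrow> ('g, 'k) res" where
  "res_dv gs us = pscale ((-1) ^ (length gs + 1)) (\<Sum>l = 1..length us. pscale ((-1) ^ l)
     (res_tens (of_vec (act (sum_list gs) (us ! (l - 1)))) gs
         (wedge (take (l - 1) us @ drop l us)) one_skew
      - res_tens one_skew gs
         (wedge (take (l - 1) us @ drop l us)) (of_vec (us ! (l - 1)))))"

definition res_diff :: "('g, 'k) res \<Rightarrow> ('g, 'k) res" where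
  "res_diff = lext (\<lambda>(p, gs, js, q).
     res_act (bvec p) (res_dh gs (map ((!) vs) js) + res_dv gs (map ((!) vs) js)) (bvec q))"

subsection \<open>Cochains on \<open>X\<close>\<close>

text \<open>
  A cochain is determined by its values on the basis elements \<open>1 \<otimes> g\<^sub>1 \<otimes> \<dots> \<otimes> v\<^bsub>j1\<^esub> \<and> \<dots> \<otimes> 1\<close>,
  here \<open>f [g\<^sub>1, \<dots>] [v\<^bsub>j1\<^esub>, \<dots>]\<close>, and is extended \<open>A\<^sup>e\<close>-linearly.
\<close>

definition cochain :: "('g list \<Rightarrow> 'v list \<Rightarrow> ('g, 'k) skew_alg) \<Rightarrow> ('g, 'k) res \<Rightarrow> ('g, 'k) skew_alg"
  where "cochain f = lext (\<lambda>(p, gs, js, q). bvec p \<star> f gs (map ((!) vs) js) \<star> bvec q)"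

definition lam_cochain ::
    "(('g \<Rightarrow>\<^sub>0 'k) \<Rightarrow> 'v \<Rightarrow> ('g \<Rightarrow>\<^sub>0 'k)) \<Rightarrow> ('g, 'k) res \<Rightarrow> ('g, 'k) skew_alg" where
  "lam_cochain lam = cochain (\<lambda>gs us.
     case (gs, us) of ([g], [v]) \<Rightarrow> of_grpalg (lam (bvec g) v) | _ \<Rightarrow> 0)"

definition kap_cochain ::
    "('v \<Rightarrow> 'v \<Rightarrow> ('g \<Rightarrow>\<^sub>0 'k)) \<Rightarrow> ('g, 'k) res \<Rightarrow> ('g, 'k) skew_alg" where
  "kap_cochain kap = cochain (\<lambda>gs us.
     case (gs, us) of ([], [v, w]) \<Rightarrow> of_grpalg (kap v w) | _ \<Rightarrow> 0)"

definition dstar ::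
    "(('g, 'k) res \<Rightarrow> ('g, 'k) skew_alg) \<Rightarrow> ('g, 'k) res \<Rightarrow> ('g, 'k) skew_alg" where
  "dstar f = f \<circ> res_diff"

subsection \<open>Chain maps between the resolutions\<close>

definition degree_zero_chain_maps ::
    "(nat \<Rightarrow> ('g, 'k) res \<Rightarrow> ('g, 'k) bar) \<Rightarrow> (nat \<Rightarrow> ('g, 'k) bar \<Rightarrow> ('g, 'k) res) \<Rightarrow> bool" where
  "degree_zero_chain_maps \<phi> \<psi> \<longleftrightarrow>
    (\<forall>n. \<forall>x\<in>res_space n. \<phi> n x \<in> bar_space n) \<and>
    (\<forall>n. \<forall>x\<in>res_space n. \<forall>y\<in>res_space n. \<phi> n (x + y) = \<phi> n x + \<phi> n y) \<and>
    (\<forall>n. \<forall>x\<in>res_space n. \<forall>a\<in>skew_space. \<forall>b\<in>skew_space.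
        \<phi> n (res_act a x b) = bar_act a (\<phi> n x) b) \<and>
    (\<forall>n. \<forall>x\<in>res_space (Suc n). \<phi> n (res_diff x) = bar_diff (\<phi> (Suc n) x)) \<and>
    (\<forall>n d. \<forall>x\<in>res_homog n d. \<phi> n x \<in> bar_homog n d) \<and>
    (\<forall>n. \<forall>x\<in>bar_space n. \<psi> n x \<in> res_space n) \<and>
    (\<forall>n. \<forall>x\<in>bar_space n. \<forall>y\<in>bar_space n. \<psi> n (x + y) = \<psi> n x + \<psi> n y) \<and>
    (\<forall>n. \<forall>x\<in>bar_space n. \<forall>a\<in>skew_space. \<forall>b\<in>skew_space.
        \<psi> n (bar_act a x b) = res_act a (\<psi> n x) b) \<and>
    (\<forall>n. \<forall>x\<in>bar_space (Suc n). \<psi> n (bar_diff x) = res_diff (\<psi> (Suc n) x)) \<and>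
    (\<forall>n d. \<forall>x\<in>bar_homog n d. \<psi> n x \<in> res_homog n d)"

text \<open>
  The prescribed values. \<open>\<phi>\<^sub>0\<close> and \<open>\<psi>\<^sub>0\<close> are the identity of \<open>A \<otimes> A\<close>, whence both maps lift the
  identity of \<open>A\<close>. The values of \<open>\<psi>\<^sub>1\<close> at \<open>1 \<otimes> vg \<otimes> 1\<close> and of \<open>\<psi>\<^sub>2\<close> at \<open>1 \<otimes> v \<otimes> g \<otimes> 1\<close> are
  prescribed for \<open>g \<noteq> 1\<close> only: for \<open>g = 1\<close> we have \<open>vg = v\<close>, and as \<open>1 \<otimes> 1\<^sub>G \<otimes> 1\<close> is a nonzero
  element of \<open>X\<^bsub>1,0\<^esub>\<close> (the complex is not normalised) the two prescriptions for \<open>\<psi>\<^sub>1\<close> would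
  contradict each other, and the one for \<open>\<psi>\<^sub>2\<close> would contradict the chain map property.
\<close>

definition prescribed_values ::
    "(nat \<Rightarrow> ('g, 'k) res \<Rightarrow> ('g, 'k) bar) \<Rightarrow> (nat \<Rightarrow> ('g, 'k) bar \<Rightarrow> ('g, 'k) res) \<Rightarrow> bool" where
  "prescribed_values \<phi> \<psi> \<longleftrightarrow>
    (\<forall>a\<in>skew_space. \<forall>b\<in>skew_space. \<phi> 0 (res_tens a [] (wedge []) b) = tens [a, b]) \<and>
    (\<forall>a\<in>skew_space. \<forall>b\<in>skew_space. \<psi> 0 (tens [a, b]) = res_tens a [] (wedge []) b) \<and>
    (\<forall>n\<le>2. \<forall>x\<in>res_space n. \<psi> n (\<phi> n x) = x) \<and>
    (\<forall>g. \<phi> 1 (res_gen [g] []) = tens [one_skew, of_grp g, one_skew]) \<and>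
    (\<forall>v. \<phi> 1 (res_gen [] [v]) = tens [one_skew, of_vec v, one_skew]) \<and>
    (\<forall>g. \<psi> 1 (tens [one_skew, of_grp g, one_skew]) = res_gen [g] []) \<and>
    (\<forall>v. \<psi> 1 (tens [one_skew, of_vec v, one_skew]) = res_gen [] [v]) \<and>
    (\<forall>v g. g \<noteq> 0 \<longrightarrow> \<psi> 1 (tens [one_skew, of_vec v \<star> of_grp g, one_skew]) =
        res_tens one_skew [] (wedge [v]) (of_grp g) +
        res_tens (of_vec v) [g] (wedge []) one_skew) \<and>
    (\<forall>g h. \<phi> 2 (res_gen [g, h] []) = tens [one_skew, of_grp g, of_grp h, one_skew]) \<and>
    (\<forall>g v. \<phi> 2 (res_gen [g] [v]) =
        tens [one_skew, of_grp g, of_vec v, one_skew] -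
        tens [one_skew, of_vec (act g v), of_grp g, one_skew]) \<and>
    (\<forall>v w. \<phi> 2 (res_gen [] [v, w]) =
        tens [one_skew, of_vec v, of_vec w, one_skew] -
        tens [one_skew, of_vec w, of_vec v, one_skew]) \<and>
    (\<forall>g h. \<psi> 2 (tens [one_skew, of_grp g, of_grp h, one_skew]) = res_gen [g, h] []) \<and>
    (\<forall>g v. \<psi> 2 (tens [one_skew, of_grp g, of_vec v, one_skew] -
                tens [one_skew, of_vec (act g v), of_grp g, one_skew]) = res_gen [g] [v]) \<and>
    (\<forall>v g. g \<noteq> 0 \<longrightarrow> \<psi> 2 (tens [one_skew, of_vec v, of_grp g, one_skew]) = 0) \<and>
    (\<forall>v w. \<psi> 2 (tens [one_skew, of_vec v, of_vec w, one_skew] -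
                tens [one_skew, of_vec w, of_vec v, one_skew]) = res_gen [] [v, w]) \<and>
    (\<forall>i j. i < j \<and> j < length vs \<longrightarrow>
        \<psi> 2 (tens [one_skew, of_vec (vs ! i), of_vec (vs ! j), one_skew]) =
          res_gen [] [vs ! i, vs ! j] \<and>
        \<psi> 2 (tens [one_skew, of_vec (vs ! j), of_vec (vs ! i), one_skew]) = 0) \<and>
    (\<forall>g h l. \<phi> 3 (res_gen [g, h, l] []) =
        tens [one_skew, of_grp g, of_grp h, of_grp l, one_skew]) \<and>
    (\<forall>g h v. \<phi> 3 (res_gen [g, h] [v]) =
        tens [one_skew, of_grp g, of_grp h, of_vec v, one_skew] -
        tens [one_skew, of_grp g, of_vec (act h v), of_grp h, one_skew] +
        tens [one_skew, of_vec (act (g + h) v), of_grp g, of_grp h, one_skew]) \<and>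
    (\<forall>g v w. \<phi> 3 (res_gen [g] [v, w]) =
        tens [one_skew, of_grp g, of_vec v, of_vec w, one_skew] -
        tens [one_skew, of_grp g, of_vec w, of_vec v, one_skew] +
        tens [one_skew, of_vec (act g v), of_vec (act g w), of_grp g, one_skew] -
        tens [one_skew, of_vec (act g w), of_vec (act g v), of_grp g, one_skew] -
        tens [one_skew, of_vec (act g v), of_grp g, of_vec w, one_skew] +
        tens [one_skew, of_vec (act g w), of_grp g, of_vec v, one_skew]) \<and>
    (\<forall>u. \<phi> 3 (res_gen [] [u 0, u 1, u 2]) =
        (\<Sum>\<sigma> | \<sigma> permutes {..<3::nat}. pscale (of_int (sign \<sigma>))
           (tens [one_skew, of_vec (u (\<sigma> 0)), of_vec (u (\<sigma> 1)), of_vec (u (\<sigma> 2)), one_skew])))"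

subsection \<open>The Gerstenhaber bracket\<close>

text \<open>Linear maps \<open>A \<otimes> A \<rightarrow> A\<close> are treated as bilinear functions.\<close>

definition gerst_circ ::
    "(('g, 'k) skew_alg \<Rightarrow> ('g, 'k) skew_alg \<Rightarrow> ('g, 'k) skew_alg) \<Rightarrow>
     (('g, 'k) skew_alg \<Rightarrow> ('g, 'k) skew_alg \<Rightarrow> ('g, 'k) skew_alg) \<Rightarrow>
     ('g, 'k) skew_alg \<Rightarrow> ('g, 'k) skew_alg \<Rightarrow> ('g, 'k) skew_alg \<Rightarrow> ('g, 'k) skew_alg" where
  "gerst_circ \<mu> \<nu> a1 a2 a3 = \<mu> (\<nu> a1 a2) a3 - \<mu> a1 (\<nu> a2 a3)"

definition gerst_bracket ::
    "(('g, 'k) skew_alg \<Rightarrow> ('g, 'k) skew_alg \<Rightarrow> ('g, 'k) skew_alg) \<Rightarrow>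
     (('g, 'k) skew_alg \<Rightarrow> ('g, 'k) skew_alg \<Rightarrow> ('g, 'k) skew_alg) \<Rightarrow>
     ('g, 'k) skew_alg \<Rightarrow> ('g, 'k) skew_alg \<Rightarrow> ('g, 'k) skew_alg \<Rightarrow> ('g, 'k) skew_alg" where
  "gerst_bracket \<mu> \<nu> a1 a2 a3 =
     \<mu> (\<nu> a1 a2) a3 - \<mu> a1 (\<nu> a2 a3) + \<nu> (\<mu> a1 a2) a3 - \<nu> a1 (\<mu> a2 a3)"

text \<open>The \<open>A\<^sup>e\<close>-linear 3-cochain on the bar resolution given by a trilinear function.\<close>

definition bar_cochain3 ::
    "(('g, 'k) skew_alg \<Rightarrow> ('g, 'k) skew_alg \<Rightarrow> ('g, 'k) skew_alg \<Rightarrow> ('g, 'k) skew_alg) \<Rightarrow>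
     ('g, 'k) bar \<Rightarrow> ('g, 'k) skew_alg" where
  "bar_cochain3 f = lext (\<lambda>ps.
     bvec (ps ! 0) \<star> f (bvec (ps ! 1)) (bvec (ps ! 2)) (bvec (ps ! 3)) \<star> bvec (ps ! 4))"

definition pull_psi ::
    "(nat \<Rightarrow> ('g, 'k) bar \<Rightarrow> ('g, 'k) res) \<Rightarrow> (('g, 'k) res \<Rightarrow> ('g, 'k) skew_alg) \<Rightarrow>
     ('g, 'k) skew_alg \<Rightarrow> ('g, 'k) skew_alg \<Rightarrow> ('g, 'k) skew_alg" where
  "pull_psi \<psi> \<alpha> a1 a2 = \<alpha> (\<psi> 2 (tens [one_skew, a1, a2, one_skew]))"

definition bracket ::
    "(nat \<Rightarrow> ('g, 'k) res \<Rightarrow> ('g, 'k) bar) \<Rightarrow> (nat \<Rightarrow> ('g, 'k) bar \<Rightarrow> ('g, 'k) res) \<Rightarrow>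
     (('g, 'k) res \<Rightarrow> ('g, 'k) skew_alg) \<Rightarrow> (('g, 'k) res \<Rightarrow> ('g, 'k) skew_alg) \<Rightarrow>
     ('g, 'k) res \<Rightarrow> ('g, 'k) skew_alg" where
  "bracket \<phi> \<psi> \<alpha> \<beta> = bar_cochain3 (gerst_bracket (pull_psi \<psi> \<alpha>) (pull_psi \<psi> \<beta>)) \<circ> \<phi> 3"

text \<open>
  \<open>[\<alpha>, \<beta>] = \<alpha> \<circ> \<beta> + \<beta> \<circ> \<alpha>\<close> for this circle product; in particular \<open>[\<alpha>, \<alpha>] = 2 (\<alpha> \<circ> \<alpha>)\<close>, which
  carries no information in characteristic 2, where \<open>\<alpha> \<circ> \<alpha>\<close> takes its place.
\<close>

definition circ ::
    "(nat \<Rightarrow> ('g, 'k) res \<Rightarrow> ('g, 'k) bar) \<Rightarrow> (nat \<Rightarrow> ('g, 'k) bar \<Rightarrow> ('g, 'k) res) \<Rightarrow>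
     (('g, 'k) res \<Rightarrow> ('g, 'k) skew_alg) \<Rightarrow> (('g, 'k) res \<Rightarrow> ('g, 'k) skew_alg) \<Rightarrow>
     ('g, 'k) res \<Rightarrow> ('g, 'k) skew_alg" where
  "circ \<phi> \<psi> \<alpha> \<beta> = bar_cochain3 (gerst_circ (pull_psi \<psi> \<alpha>) (pull_psi \<psi> \<beta>)) \<circ> \<phi> 3"

subsection \<open>The algebra \<open>H\<close> and the PBW property\<close>

text \<open>The free algebra has generators \<open>Inl i\<close> for the basis vector \<open>vs ! i\<close> and \<open>Inr g\<close> for \<open>g\<close>.\<close>

definition letters :: "(nat + 'g) set" where
  "letters = Inl ` {..<length vs} \<union> Inr ` UNIV"

definition free_mult ::
    "((nat + 'g) list \<Rightarrow>\<^sub>0 'k) \<Rightarrow> ((nat + 'g) list \<Rightarrow>\<^sub>0 'k) \<Rightarrow> ((nat + 'g) list \<Rightarrow>\<^sub>0 'k)" where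
  "free_mult x y = lext (\<lambda>u. lext (\<lambda>w. bvec (u @ w)) y) x"

definition free_alg :: "((nat + 'g) list \<Rightarrow>\<^sub>0 'k) ring" where
  "free_alg = \<lparr>carrier = pspan (lists letters), mult = free_mult, one = bvec [],
     zero = 0, add = (+)\<rparr>"

definition free_vec :: "'v \<Rightarrow> ((nat + 'g) list \<Rightarrow>\<^sub>0 'k)" where
  "free_vec v = (\<Sum>i<length vs. Poly_Mapping.single [Inl i] (coord v i))"

definition free_grp :: "'g \<Rightarrow> ((nat + 'g) list \<Rightarrow>\<^sub>0 'k)" where
  "free_grp g = bvec [Inr g]"

definition free_grpalg :: "('g \<Rightarrow>\<^sub>0 'k) \<Rightarrow> ((nat + 'g) list \<Rightarrow>\<^sub>0 'k)" where
  "free_grpalg = lext free_grp"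

definition relators ::
    "(('g \<Rightarrow>\<^sub>0 'k) \<Rightarrow> 'v \<Rightarrow> ('g \<Rightarrow>\<^sub>0 'k)) \<Rightarrow> ('v \<Rightarrow> 'v \<Rightarrow> ('g \<Rightarrow>\<^sub>0 'k)) \<Rightarrow>
     ((nat + 'g) list \<Rightarrow>\<^sub>0 'k) set" where
  "relators lam kap =
     {free_grp 0 - bvec []} \<union>
     {free_mult (free_grp g) (free_grp h) - free_grp (g + h) | g h. True} \<union>
     {free_mult (free_vec v) (free_vec w) - free_mult (free_vec w) (free_vec v)
        - free_grpalg (kap v w) | v w. True} \<union>
     {free_mult (free_grp g) (free_vec v) - free_mult (free_vec (act g v)) (free_grp g)
        - free_grpalg (lam (bvec g) v) | g v. True}"

definition rel_ideal ::
    "(('g \<Rightarrow>\<^sub>0 'k) \<Rightarrow> 'v \<Rightarrow> ('g \<Rightarrow>\<^sub>0 'k)) \<Rightarrow> ('v \<Rightarrow> 'v \<Rightarrow> ('g \<Rightarrow>\<^sub>0 'k)) \<Rightarrow>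
     ((nat + 'g) list \<Rightarrow>\<^sub>0 'k) set" where
  "rel_ideal lam kap = Idl\<^bsub>free_alg\<^esub> (relators lam kap)"

definition H_alg ::
    "(('g \<Rightarrow>\<^sub>0 'k) \<Rightarrow> 'v \<Rightarrow> ('g \<Rightarrow>\<^sub>0 'k)) \<Rightarrow> ('v \<Rightarrow> 'v \<Rightarrow> ('g \<Rightarrow>\<^sub>0 'k)) \<Rightarrow>
     ((nat + 'g) list \<Rightarrow>\<^sub>0 'k) set ring" where
  "H_alg lam kap = free_alg Quot rel_ideal lam kap"

definition H_scale ::
    "(('g \<Rightarrow>\<^sub>0 'k) \<Rightarrow> 'v \<Rightarrow> ('g \<Rightarrow>\<^sub>0 'k)) \<Rightarrow> ('v \<Rightarrow> 'v \<Rightarrow> ('g \<Rightarrow>\<^sub>0 'k)) \<Rightarrow> 'k \<Rightarrow>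
     ((nat + 'g) list \<Rightarrow>\<^sub>0 'k) set \<Rightarrow> ((nat + 'g) list \<Rightarrow>\<^sub>0 'k) set" where
  "H_scale lam kap c x =
     (rel_ideal lam kap +>\<^bsub>free_alg\<^esub> Poly_Mapping.single [] c) \<otimes>\<^bsub>H_alg lam kap\<^esub> x"

definition word_deg :: "(nat + 'g) list \<Rightarrow> nat" where
  "word_deg w = length (filter isl w)"

definition H_filt ::
    "(('g \<Rightarrow>\<^sub>0 'k) \<Rightarrow> 'v \<Rightarrow> ('g \<Rightarrow>\<^sub>0 'k)) \<Rightarrow> ('v \<Rightarrow> 'v \<Rightarrow> ('g \<Rightarrow>\<^sub>0 'k)) \<Rightarrow> nat \<Rightarrow>
     ((nat + 'g) list \<Rightarrow>\<^sub>0 'k) set set" where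
  "H_filt lam kap n =
     (\<lambda>f. rel_ideal lam kap +>\<^bsub>free_alg\<^esub> f) ` pspan {w \<in> lists letters. word_deg w \<le> n}"

text \<open>The class of \<open>x\<close> in the \<open>n\<close>-th component \<open>F\<^sub>n H / F\<^bsub>n-1\<^esub> H\<close> of \<open>gr H\<close>, where \<open>F\<^bsub>-1\<^esub> H = 0\<close>.\<close>

definition gr_class ::
    "(('g \<Rightarrow>\<^sub>0 'k) \<Rightarrow> 'v \<Rightarrow> ('g \<Rightarrow>\<^sub>0 'k)) \<Rightarrow> ('v \<Rightarrow> 'v \<Rightarrow> ('g \<Rightarrow>\<^sub>0 'k)) \<Rightarrow> nat \<Rightarrow>
     ((nat + 'g) list \<Rightarrow>\<^sub>0 'k) set \<Rightarrow> ((nat + 'g) list \<Rightarrow>\<^sub>0 'k) set set" where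
  "gr_class lam kap n x =
     (if n = 0 then {\<zero>\<^bsub>H_alg lam kap\<^esub>} else H_filt lam kap (n - 1)) +>\<^bsub>H_alg lam kap\<^esub> x"

text \<open>
  \<open>gr H\<close> and \<open>A\<close> are isomorphic as graded algebras: \<open>\<Theta> n\<close> is the degree-\<open>n\<close> component of the
  isomorphism. The product in \<open>gr H\<close> of the classes of \<open>x\<close> in degree \<open>m\<close> and \<open>y\<close> in degree \<open>n\<close> is
  the class of \<open>xy\<close> in degree \<open>m + n\<close>.
\<close>

definition PBW ::
    "(('g \<Rightarrow>\<^sub>0 'k) \<Rightarrow> 'v \<Rightarrow> ('g \<Rightarrow>\<^sub>0 'k)) \<Rightarrow> ('v \<Rightarrow> 'v \<Rightarrow> ('g \<Rightarrow>\<^sub>0 'k)) \<Rightarrow> bool" where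
  "PBW lam kap \<longleftrightarrow>
    (\<exists>\<Theta> :: nat \<Rightarrow> ((nat + 'g) list \<Rightarrow>\<^sub>0 'k) set set \<Rightarrow> ('g, 'k) skew_alg.
      (\<forall>n. bij_betw (\<Theta> n) (gr_class lam kap n ` H_filt lam kap n) (skew_homog n)) \<and>
      (\<forall>n. \<forall>x\<in>H_filt lam kap n. \<forall>y\<in>H_filt lam kap n.
         \<Theta> n (gr_class lam kap n (x \<oplus>\<^bsub>H_alg lam kap\<^esub> y)) =
         \<Theta> n (gr_class lam kap n x) + \<Theta> n (gr_class lam kap n y)) \<and>
      (\<forall>n c. \<forall>x\<in>H_filt lam kap n.
         \<Theta> n (gr_class lam kap n (H_scale lam kap c x)) = pscale c (\<Theta> n (gr_class lam kap n x))) \<and>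
      (\<forall>m n. \<forall>x\<in>H_filt lam kap m. \<forall>y\<in>H_filt lam kap n.
         \<Theta> (m + n) (gr_class lam kap (m + n) (x \<otimes>\<^bsub>H_alg lam kap\<^esub> y)) =
         \<Theta> m (gr_class lam kap m x) \<star> \<Theta> n (gr_class lam kap n y)) \<and>
      \<Theta> 0 (gr_class lam kap 0 \<one>\<^bsub>H_alg lam kap\<^esub>) = one_skew)"

end

end

theory Submission
  imports Defs "HOL-Library.Multiset"
begin

text \<open>
  Both sides are equivalent to five identities in \<open>\<lambda>\<close> and \<open>\<kappa>\<close> that express that the overlaps \<open>ghv\<close>,
  \<open>gvw\<close> and \<open>uvw\<close> of the defining relations resolve.

  If \<open>H\<close> has the PBW property, then so does its canonical spanning set: the canonical surjections
  \<open>A\<^sub>n \<rightarrow> gr\<^sub>n H\<close> are injective, since both sides have the same finite dimension. Evaluating the three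
  overlaps in two ways and comparing components of degree at most 1 gives the identities.
  Conversely, let \<open>B\<close> be the quotient of the free algebra by all relations except those for
  \<open>vw - wv\<close>. By the first identity \<open>B\<close> has the words \<open>v\<^bsub>i1\<^esub> \<dots> v\<^bsub>in\<^esub> g\<close> as a basis, by the second and
  third the left ideal generated by the remaining relations is stable under \<open>G\<close>, and by the last two
  (a Jacobi identity) the overlaps \<open>v\<^sub>k v\<^sub>j v\<^sub>i\<close> resolve, so that the sorted words are linearly
  independent modulo that ideal.

  On the cochain side, both sides of each equation are bimodule maps on \<open>X\<^sub>3\<close>, so it suffices to evaluate
  them on generators, where the prescribed values of the chain maps reproduce the five identities.
\<close>

text \<open>The isomorphism in \<open>PBW\<close> is arbitrary and need not be the canonical one.
  Composed with the canonical map it becomes a surjective endomorphism of A_n, and this is where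
  finite dimension enters. In the converse direction B is not constructed as an algebra: it is the
  space T(V) \<otimes> kG with the operators of left multiplication by vectors and group elements,
  and the free algebra acts on it. The ideal I moves everything into the span of the commutator
  relations, while a normal form applied to the unit of B returns its own sorted words. Group
  elements mix the basis vectors and so ignore the order on words; stability under G is therefore a
  statement about lengths only. On the cochain side the obstacle is that the bar complex is not
  normalised: the value of \<psi>_2 at v \<otimes> 1_G is not prescribed. For \<kappa> a degree
  argument settles it, for \<lambda> the condition d*(\<lambda>) = 0 does, so all brackets are
  evaluated under that condition. Characteristic 2 is why arguments rest on alternating rather than
  antisymmetric maps and why the circle product accompanies the bracket.\<close>

abbreviation (input) "lookup \<equiv> Poly_Mapping.lookup"
abbreviation (input) "keys \<equiv> Poly_Mapping.keys"
abbreviation (input) "single \<equiv> Poly_Mapping.single"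

section \<open>Linear maps between spaces with a distinguished basis\<close>

abbreviation (input) lin :: "('k::field \<Rightarrow> 'v::ab_group_add \<Rightarrow> 'v) \<Rightarrow> ('v \<Rightarrow> ('y \<Rightarrow>\<^sub>0 'k)) \<Rightarrow> bool" where
  "lin s \<equiv> Vector_Spaces.linear s pscale"

lemma lookup_pscale [simp]: "lookup (pscale c f) p = c * lookup f p"
  unfolding pscale_def by (simp add: Poly_Mapping.map.rep_eq when_def)

interpretation pm: vector_space pscale
  by unfold_locales
    (auto intro!: poly_mapping_eqI simp: lookup_add algebra_simps)

lemma pscale_single [simp]: "pscale c (single p d) = single p (c * d)"
  by (intro poly_mapping_eqI) (auto simp: lookup_single when_def)

lemma keys_pscale: "keys (pscale c f) \<subseteq> keys f"
  by (auto simp: in_keys_iff)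

text \<open>The sum in \<open>lext\<close> runs over the support of its argument, which changes from
  argument to argument; a common finite index set makes such sums comparable. The added terms have
  coefficient 0.\<close>

lemma lext_superset:
  assumes "finite A" "keys x \<subseteq> A"
  shows "lext f x = (\<Sum>p\<in>A. pscale (lookup x p) (f p))"
  unfolding lext_def using assms
  by (intro sum.mono_neutral_left) (auto simp: in_keys_iff)

lemma lext_add: "lext f (x + y) = lext f x + lext f y"
proof -
  let ?A = "keys x \<union> keys y"
  have "lext f (x + y) = (\<Sum>p\<in>?A. pscale (lookup (x + y) p) (f p))"
    by (rule lext_superset) (auto simp: Poly_Mapping.keys_add)
  also have "\<dots> = (\<Sum>p\<in>?A. pscale (lookup x p) (f p))
      + (\<Sum>p\<in>?A. pscale (lookup y p) (f p))"
    by (simp add: lookup_add pm.scale_left_distrib sum.distrib)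
  also have "\<dots> = lext f x + lext f y"
    by (subst (1 2) lext_superset[of ?A]) auto
  finally show ?thesis .
qed

lemma lext_pscale: "lext f (pscale c x) = pscale c (lext f x)"
proof -
  have "lext f (pscale c x)
      = (\<Sum>p\<in>keys x. pscale (lookup (pscale c x) p) (f p))"
    by (rule lext_superset) (auto simp: keys_pscale)
  thus ?thesis by (simp add: lext_def pm.scale_sum_right)
qed

lemma linear_lext: "lin pscale (lext f)"
  by unfold_locales (simp_all add: lext_add lext_pscale)

lemma lext_single [simp]: "lext f (single p c) = pscale c (f p)"
  by (simp add: lext_def)

lemma lin_I:
  assumes "vector_space s" "\<And>x y. F (x + y) = F x + F y" "\<And>c x. F (s c x) = pscale c (F x)"
  shows "lin s F"
  by (intro Vector_Spaces.linear.intro module_hom.intro module_hom_axioms.intro)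
    (simp_all add: assms pm.vector_space_axioms pm.module_axioms module_iff_vector_space)

text \<open>Most later collections of distributivity rules are blocks \<open>linearD(2-7)\<close>,
  so positions inside a block are fixed: sum, scalar multiple, zero, difference, negative, finite
  sum.\<close>

lemma linearD:
  assumes "Vector_Spaces.linear s t F"
  shows "vector_space s" "F (x + y) = F x + F y" "F (s c x) = t c (F x)"
    "F 0 = 0" "F (x - y) = F x - F y" "F (- x) = - F x" "F (sum h A) = (\<Sum>a\<in>A. F (h a))"
proof -
  have m: "module_hom s t F" and v: "vector_space s"
    using assms by (auto simp: Vector_Spaces.linear_def)
  show "vector_space s" by (fact v)
  show "F (x + y) = F x + F y" by (rule module_hom.add[OF m])
  show "F (s c x) = t c (F x)" by (rule module_hom.scale[OF m])
  show "F 0 = 0" by (rule module_hom.zero[OF m])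
  show "F (x - y) = F x - F y" by (rule module_hom.diff[OF m])
  show "F (- x) = - F x" by (rule module_hom.neg[OF m])
  show "F (sum h A) = (\<Sum>a\<in>A. F (h a))" by (rule module_hom.sum[OF m])
qed

lemmas lext_0 [simp] = linearD(4)[OF linear_lext]
lemmas lext_diff = linearD(5)[OF linear_lext]
lemmas lext_sum = linearD(7)[OF linear_lext]

lemma lin_id: "lin pscale (\<lambda>x. x)"
  by (rule lin_I[OF pm.vector_space_axioms]) auto

lemma lin_zero: "vector_space s \<Longrightarrow> lin s (\<lambda>x. 0)"
  by (rule lin_I) auto

lemma lin_add:
  assumes "lin s F" "lin s H"
  shows "lin s (\<lambda>x. F x + H x)"
  by (rule lin_I[OF linearD(1)[OF assms(1)]])
    (simp_all add: linearD(2,3)[OF assms(1)] linearD(2,3)[OF assms(2)] pm.scale_right_distrib)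

lemma lin_diff:
  assumes "lin s F" "lin s H"
  shows "lin s (\<lambda>x. F x - H x)"
  by (rule lin_I[OF linearD(1)[OF assms(1)]])
    (simp_all add: linearD(2,3)[OF assms(1)] linearD(2,3)[OF assms(2)] pm.scale_right_diff_distrib)

lemma lin_uminus:
  assumes "lin s F"
  shows "lin s (\<lambda>x. - F x)"
  by (rule lin_I[OF linearD(1)[OF assms(1)]])
    (simp_all add: linearD(2,3)[OF assms(1)])

lemma lin_pscale:
  assumes "lin s F"
  shows "lin s (\<lambda>x. pscale c (F x))"
  by (rule lin_I[OF linearD(1)[OF assms(1)]])
    (simp_all add: linearD(2,3)[OF assms(1)] pm.scale_right_distrib mult.commute)

lemma lin_sum:
  assumes "vector_space s" "\<And>a. a \<in> A \<Longrightarrow> lin s (F a)"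
  shows "lin s (\<lambda>x. \<Sum>a\<in>A. F a x)"
  using assms(1)
  by (rule lin_I) (simp_all add: linearD(2,3)[OF assms(2)] sum.distrib pm.scale_sum_right)

lemma lin_comp:
  assumes "lin t L" "Vector_Spaces.linear s t F"
  shows "lin s (\<lambda>x. L (F x))"
  by (rule lin_I[OF linearD(1)[OF assms(2)]])
    (simp_all add: linearD(2,3)[OF assms(1)] linearD(2,3)[OF assms(2)])

lemmas lin_lext = lin_comp[OF linear_lext]

text \<open>Here the extended family depends on \<open>x\<close> and the argument \<open>a\<close>
  is fixed. This yields linearity in the second factor of products that are defined by nested
  \<open>lext\<close>.\<close>

lemma lin_lext2:
  assumes "vector_space s" "\<And>p. lin s (\<lambda>x. f x p)"
  shows "lin s (\<lambda>x. lext (f x) a)"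
  unfolding lext_def by (intro lin_sum lin_pscale assms)

lemma lin_case_prod:
  assumes "\<And>a b. lin s (\<lambda>x. f x a b)"
  shows "lin s (\<lambda>x. case_prod (f x) p)"
  using assms by (cases p) auto

lemma lin_single:
  assumes "vector_space s" "\<And>x y. f (x + y) = f x + f y" "\<And>c x. f (s c x) = c * f x"
  shows "lin s (\<lambda>x. single p (f x))"
  using assms by (intro lin_I) (simp_all add: single_add)

lemmas lin_intros = lin_id lin_zero lin_add lin_diff lin_uminus lin_pscale lin_sum lin_lext lin_lext2
  lin_case_prod pm.vector_space_axioms

section \<open>Subspaces spanned by basis elements\<close>

lemma pspan_eq_span: "pspan S = pm.span (bvec ` S)"
proof (intro equalityI subsetI)
  fix x :: "'a \<Rightarrow>\<^sub>0 'b" assume x: "x \<in> pspan S"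
  have "x = (\<Sum>p\<in>keys x. pscale (lookup x p) (bvec p))"
    by (intro poly_mapping_eqI) (auto simp: lookup_sum lookup_single when_def in_keys_iff)
  also have "\<dots> \<in> pm.span (bvec ` S)"
    using x by (intro pm.span_sum pm.span_scale pm.span_base) (auto simp: pspan_def)
  finally show "x \<in> pm.span (bvec ` S)" .
next
  fix x :: "'a \<Rightarrow>\<^sub>0 'b" assume "x \<in> pm.span (bvec ` S)"
  thus "x \<in> pspan S"
  proof (induction rule: pm.span_induct)
    case base
    show ?case
      by (auto simp: pm.subspace_def pspan_def in_keys_iff lookup_add dest!: subsetD)
  qed (auto simp: pspan_def)
qed

lemma subspace_pspan: "pm.subspace (pspan S)"
  by (simp add: pspan_eq_span)

lemmas pspan_add = subspace_pspan[THEN pm.subspace_add]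
lemmas pspan_diff = subspace_pspan[THEN pm.subspace_diff]
lemmas pspan_scale = subspace_pspan[THEN pm.subspace_scale]
lemmas pspan_sum = subspace_pspan[THEN pm.subspace_sum]

lemma pspan_0 [simp]: "0 \<in> pspan S"
  by (simp add: pspan_def)

lemma bvec_in_pspan [simp]: "bvec p \<in> pspan S \<longleftrightarrow> p \<in> S"
  by (simp add: pspan_def)

lemma single_in_pspan: "p \<in> S \<Longrightarrow> single p c \<in> pspan S"
  by (simp add: pspan_def)

lemma pspan_UNIV [simp]: "x \<in> pspan UNIV"
  by (simp add: pspan_def)

lemma pspan_mono: "S \<subseteq> T \<Longrightarrow> pspan S \<subseteq> pspan T"
  by (auto simp: pspan_def)

lemma pspan_empty [simp]: "pspan {} = {0}"
  by (auto simp: pspan_def)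

lemma pspan_induct [consumes 1, case_names subspace base]:
  assumes "x \<in> pspan S" "pm.subspace {x. P x}" "\<And>p. p \<in> S \<Longrightarrow> P (bvec p)"
  shows "P x"
  using assms(1) unfolding pspan_eq_span
  by (rule pm.span_induct) (use assms in auto)

lemma subspace_lin_eq:
  assumes "Vector_Spaces.linear s t f" "Vector_Spaces.linear s t g"
  shows "module.subspace s {x. f x = g x}"
  using linearD[OF assms(1)] linearD[OF assms(2)]
  by (simp add: module.subspace_def module_iff_vector_space)

lemma lin_eq_on_pspan:
  assumes "lin pscale f" "lin pscale g"
    and "\<And>p. p \<in> S \<Longrightarrow> f (bvec p) = g (bvec p)" and "x \<in> pspan S"
  shows "f x = g x"
  using assms(4) by (induction rule: pspan_induct) (use subspace_lin_eq assms in auto)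

lemma lin_eqI:
  assumes "lin pscale f" "lin pscale g"
    and "\<And>p. f (bvec p) = g (bvec p)"
  shows "f x = g x"
  using lin_eq_on_pspan[OF assms(1,2), of UNIV] assms(3) by simp

lemma lin_maps_pspan:
  assumes "lin pscale f" "pm.subspace U"
    and "\<And>p. p \<in> S \<Longrightarrow> f (bvec p) \<in> U" and "x \<in> pspan S"
  shows "f x \<in> U"
  using assms(4)
  by (induction rule: pspan_induct)
    (use assms in \<open>auto simp: pm.subspace_def linearD[OF assms(1)]\<close>)

lemma lext_mem:
  assumes "pm.subspace U" "\<And>p. p \<in> S \<Longrightarrow> f p \<in> U" "x \<in> pspan S"
  shows "lext f x \<in> U"
  using lin_maps_pspan[OF linear_lext assms(1)] assms by auto

lemma lext_bvec [simp]: "lext bvec x = x"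
  by (rule lin_eqI[OF linear_lext lin_id]) simp

lemma lin_lext_eq:
  assumes "lin pscale L"
  shows "L (lext f x) = lext (\<lambda>p. L (f p)) x"
  by (rule lin_eqI[OF lin_comp[OF assms linear_lext] linear_lext]) simp

text \<open>For maps that are known to be linear only on a carrier, such as the chain maps: their
  values elsewhere may be arbitrary, and this replaces them by a map that is linear on the whole
  type.\<close>

lemma linear_on_pspan_eq_lext:
  assumes add: "\<And>x y. x \<in> pspan S \<Longrightarrow> y \<in> pspan S \<Longrightarrow> f (x + y) = f x + f y"
    and scal: "\<And>c x. x \<in> pspan S \<Longrightarrow> f (pscale c x) = pscale c (f x)"
    and x: "x \<in> pspan S"
  shows "f x = lext (\<lambda>p. f (bvec p)) x"
proof -
  have "f 0 = 0" using scal[of 0 0] by simp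
  hence sub: "pm.subspace {x. x \<in> pspan S \<and> f x = lext (\<lambda>p. f (bvec p)) x}"
    using add scal by (auto simp: pm.subspace_def lext_add lext_pscale pspan_add pspan_scale)
  from x have "x \<in> pspan S \<and> f x = lext (\<lambda>p. f (bvec p)) x"
    by (rule pspan_induct[OF _ sub]) auto
  thus ?thesis by simp
qed

section \<open>Scalars and convolution products\<close>

lemma pscale_conv_mult:
  fixes x :: "'a::monoid_add \<Rightarrow>\<^sub>0 'k::field"
  shows "pscale c x = single 0 c * x"
  unfolding pscale_def by (rule mult_map_scale_conv_mult)

lemma pscale_mult_left:
  fixes x y :: "'a::monoid_add \<Rightarrow>\<^sub>0 'k::field"
  shows "pscale c x * y = pscale c (x * y)"
  by (simp add: pscale_conv_mult mult.assoc)

text \<open>The index monoid may be noncommutative, as for kG, so the centrality of scalars is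
  checked on basis elements, where both sides are multiples of one basis element.\<close>

lemma pscale_mult_right:
  fixes x y :: "'a::monoid_add \<Rightarrow>\<^sub>0 'k::field"
  shows "x * pscale c y = pscale c (x * y)"
proof -
  have b: "bvec p * pscale c y = pscale c (bvec p * y)" for c and p :: 'a and y :: "'a \<Rightarrow>\<^sub>0 'k"
  proof -
    have "y \<in> pspan UNIV" by simp
    hence "\<forall>c. bvec p * pscale c y = pscale c (bvec p * y)"
    proof (induction rule: pspan_induct)
      case subspace
      show ?case
        by (auto simp: pm.subspace_def pm.scale_right_distrib distrib_left)
    qed (simp add: mult_single)
    thus ?thesis by blast
  qed
  have "x \<in> pspan UNIV" by simp
  thus ?thesis
    by (induction rule: pspan_induct)
      (auto simp: pm.subspace_def b pm.scale_right_distrib distrib_right pscale_mult_left mult.commute)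
qed

lemma lin_mult_left:
  fixes F :: "'z::ab_group_add \<Rightarrow> ('a::monoid_add \<Rightarrow>\<^sub>0 'k::field)"
  shows "lin s F \<Longrightarrow> lin s (\<lambda>x. F x * a)"
  by (rule lin_I) (auto simp: linearD pscale_mult_left distrib_right)

lemma lin_mult_right:
  fixes F :: "'z::ab_group_add \<Rightarrow> ('a::monoid_add \<Rightarrow>\<^sub>0 'k::field)"
  shows "lin s F \<Longrightarrow> lin s (\<lambda>x. a * F x)"
  by (rule lin_I) (auto simp: linearD pscale_mult_right distrib_left)

lemmas lin_intros_mult = lin_intros lin_mult_left lin_mult_right

lemma bvec_add: "(bvec (a + b) :: 'a::monoid_add \<Rightarrow>\<^sub>0 'k::field) = bvec a * bvec b"
  by (simp add: mult_single)

lemma bvec_sum: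
  fixes f :: "'i \<Rightarrow> 'a::comm_monoid_add"
  shows "(bvec (sum f A) :: 'a \<Rightarrow>\<^sub>0 'k::field) = (\<Prod>i\<in>A. bvec (f i))"
  by (induction A rule: infinite_finite_induct) (simp_all add: bvec_add)

lemma bvec_single_power:
  "(bvec (single i 1) :: (nat \<Rightarrow>\<^sub>0 nat) \<Rightarrow>\<^sub>0 'k::field) ^ n = bvec (single i n)"
  by (induction n) (simp_all add: mult_single single_add[symmetric])

lemma exponent_expand:
  assumes "keys (\<beta> :: nat \<Rightarrow>\<^sub>0 nat) \<subseteq> A" "finite A"
  shows "\<beta> = (\<Sum>i\<in>A. single i (lookup \<beta> i))"
  using assms by (intro poly_mapping_eqI) (auto simp: lookup_sum lookup_single when_def in_keys_iff)

lemma mon_deg_superset: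
  assumes "keys (fst p) \<subseteq> A" "finite A"
  shows "mon_deg p = (\<Sum>i\<in>A. lookup (fst p) i)"
  unfolding mon_deg_def using assms by (intro sum.mono_neutral_left) (auto simp: in_keys_iff)

type_synonym ('g, 'k) free = "(nat + 'g) list \<Rightarrow>\<^sub>0 'k"
text \<open>The space T(V) \<otimes> kG underlying the algebra B: \<open>(w, g)\<close> is the word
  in basis vectors with indices \<open>w\<close>, followed by \<open>g\<close>.\<close>

type_synonym ('g, 'k) word_alg = "nat list \<times> 'g \<Rightarrow>\<^sub>0 'k"

context skew_setup
begin

section \<open>Coordinates of vectors\<close>

lemma sum_set_vs: "(\<Sum>b\<in>set vs. f b) = (\<Sum>i<length vs. f (vs ! i))"
proof -
  have "(\<Sum>b\<in>set vs. f b) = sum_list (map f vs)"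
    using distinct_vs by (simp add: sum_list_distinct_conv_sum_set)
  thus ?thesis by (simp add: sum_list_sum_nth atLeast0LessThan)
qed

lemma vec_expand: "(\<Sum>i<length vs. scale (coord v i) (vs ! i)) = v"
  using sum_representation_eq[of "set vs" v "set vs"] independent_Basis span_Basis
  by (simp add: sum_set_vs coord_def)

lemma coord_add: "coord (u + v) i = coord u i + coord v i"
  unfolding coord_def using independent_Basis span_Basis by (simp add: representation_add)

lemma coord_scale: "coord (scale c v) i = c * coord v i"
  unfolding coord_def using independent_Basis span_Basis by (simp add: representation_scale)

lemma coord_vs:
  assumes "i < length vs" "j < length vs"
  shows "coord (vs ! i) j = (if i = j then 1 else 0)"
  unfolding coord_def using independent_Basis assms distinct_vs
  by (subst representation_basis) (auto simp: nth_eq_iff_index_eq)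

lemma coord_eqI:
  assumes "\<And>i. i < length vs \<Longrightarrow> coord u i = coord v i"
  shows "u = v"
  using assms vec_expand[of u] vec_expand[of v] by (metis (no_types, lifting) lessThan_iff sum.cong)

lemma lin_vec_expand:
  assumes "lin scale F"
  shows "F v = (\<Sum>i<length vs. pscale (coord v i) (F (vs ! i)))"
  by (subst vec_expand[symmetric]) (simp add: linearD[OF assms])

lemma lin_vec_eqI:
  assumes "lin scale F" "lin scale H"
    and "\<And>i. i < length vs \<Longrightarrow> F (vs ! i) = H (vs ! i)"
  shows "F v = H v"
  unfolding lin_vec_expand[OF assms(1), of v] lin_vec_expand[OF assms(2), of v]
  using assms(3) by simp

lemma vector_space_scale: "vector_space scale"
  by (rule vector_space_axioms)

lemma lin_act: "Vector_Spaces.linear scale t F \<Longrightarrow> Vector_Spaces.linear scale t (\<lambda>v. F (act g v))"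
  using Vector_Spaces.linear_compose[OF linear_act, of t F g] by (simp add: o_def)

subsection \<open>The action on the symmetric algebra\<close>

lemma lin_sym_vec: "lin scale sym_vec"
  unfolding sym_vec_def
  by (intro lin_sum lin_single vector_space_scale) (simp_all add: coord_add coord_scale)

lemma lin_sym_act:
  "lin s F \<Longrightarrow> lin s (\<lambda>x. sym_act g (F x))"
  unfolding sym_act_def by (rule lin_lext)

lemma sym_act_bvec:
  "sym_act g (bvec \<beta>) = (\<Prod>i<length vs. sym_vec (act g (vs ! i)) ^ lookup \<beta> i)"
  by (simp add: sym_act_def)

lemma sym_act_mult: "sym_act g (x * y) = sym_act g x * sym_act g y"
proof (rule lin_eqI[where f = "\<lambda>x. sym_act g (x * y)" and g = "\<lambda>x. sym_act g x * sym_act g y"])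
  fix \<beta>
  show "sym_act g (bvec \<beta> * y) = sym_act g (bvec \<beta>) * sym_act g y"
    by (rule lin_eqI[where f = "\<lambda>y. sym_act g (bvec \<beta> * y)"])
      (auto intro!: lin_sym_act lin_intros_mult
        simp: sym_act_bvec mult_single lookup_add power_add prod.distrib)
qed (intro lin_sym_act lin_intros_mult)+

lemma sym_act_1 [simp]: "sym_act g 1 = 1"
  using sym_act_bvec[of g 0] by simp

lemma sym_act_power: "sym_act g (x ^ n) = sym_act g x ^ n"
  by (induction n) (simp_all add: sym_act_mult)

lemma sym_act_prod: "sym_act g (prod f A) = (\<Prod>i\<in>A. sym_act g (f i))"
  by (induction A rule: infinite_finite_induct) (simp_all add: sym_act_mult)

lemma sym_vec_vs: "i < length vs \<Longrightarrow> sym_vec (vs ! i) = bvec (single i 1)"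
proof -
  assume i: "i < length vs"
  have "sym_vec (vs ! i) = (\<Sum>j<length vs. if i = j then bvec (single j 1) else 0)"
    unfolding sym_vec_def using i by (intro sum.cong) (auto simp: coord_vs)
  thus ?thesis using i by simp
qed

lemma sym_act_vec: "sym_act g (sym_vec v) = sym_vec (act g v)"
proof (rule lin_vec_eqI[where F = "\<lambda>v. sym_act g (sym_vec v)"])
  fix i assume i: "i < length vs"
  have "sym_act g (sym_vec (vs ! i)) = (\<Prod>j<length vs. if i = j then sym_vec (act g (vs ! j)) else 1)"
    using i unfolding sym_vec_vs[OF i] sym_act_bvec
    by (intro prod.cong) (auto simp: lookup_single when_def)
  thus "sym_act g (sym_vec (vs ! i)) = sym_vec (act g (vs ! i))" using i by simp
qed (intro lin_sym_act lin_sym_vec lin_act)+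

lemma sym_act_act: "sym_act g (sym_act h x) = sym_act (g + h) x"
  by (rule lin_eqI[where f = "\<lambda>x. sym_act g (sym_act h x)"])
    (auto intro!: lin_sym_act lin_id simp: sym_act_bvec sym_act_prod sym_act_power sym_act_vec act_mult)

text \<open>The carrier matters: the product in \<open>sym_act\<close> runs over indices below dim V
  and forgets every other variable, so the neutral element acts as a projection on the full
  type.\<close>

lemma sym_act_zero:
  assumes "x \<in> pspan {\<beta>. keys \<beta> \<subseteq> {..<length vs}}"
  shows "sym_act 0 x = x"
proof (rule lin_eq_on_pspan[OF _ _ _ assms])
  fix \<beta> :: "nat \<Rightarrow>\<^sub>0 nat" assume b: "\<beta> \<in> {\<beta>. keys \<beta> \<subseteq> {..<length vs}}"
  have "sym_act 0 (bvec \<beta>) = (\<Prod>i<length vs. bvec (single i (lookup \<beta> i)))"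
    unfolding sym_act_bvec by (intro prod.cong) (simp_all add: act_one sym_vec_vs bvec_single_power del: One_nat_def)
  also have "\<dots> = bvec \<beta>"
    using exponent_expand[of \<beta> "{..<length vs}"] b by (simp add: bvec_sum[symmetric])
  finally show "sym_act 0 (bvec \<beta>) = bvec \<beta>" .
qed (intro lin_sym_act lin_id)+

text \<open>\<open>mon_deg\<close> takes pairs, so a dummy group element is supplied.\<close>

definition sym_homog :: "nat \<Rightarrow> ((nat \<Rightarrow>\<^sub>0 nat) \<Rightarrow>\<^sub>0 'k) set" where
  "sym_homog n = pspan {\<beta>. keys \<beta> \<subseteq> {..<length vs} \<and> mon_deg (\<beta>, 0::'g) = n}"

lemma subspace_sym_homog: "pm.subspace (sym_homog n)"
  by (simp add: sym_homog_def subspace_pspan)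

lemma mon_deg_add:
  assumes "keys \<beta> \<subseteq> {..<length vs}" "keys \<gamma> \<subseteq> {..<length vs}"
  shows "mon_deg (\<beta> + \<gamma>, g) = mon_deg (\<beta>, g) + mon_deg (\<gamma>, g)"
proof -
  have "keys (\<beta> + \<gamma>) \<subseteq> {..<length vs}"
    using assms Poly_Mapping.keys_add[of \<beta> \<gamma>] by blast
  thus ?thesis
    using assms by (simp add: mon_deg_superset[of _ "{..<length vs}"] lookup_add sum.distrib)
qed

lemma sym_homog_mult:
  assumes "x \<in> sym_homog a" "y \<in> sym_homog b"
  shows "x * y \<in> sym_homog (a + b)"
proof (rule lin_maps_pspan[OF _ subspace_sym_homog _ assms(1)[unfolded sym_homog_def]])
  fix \<beta> :: "nat \<Rightarrow>\<^sub>0 nat"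
  assume \<beta>: "\<beta> \<in> {\<beta>. keys \<beta> \<subseteq> {..<length vs} \<and> mon_deg (\<beta>, 0::'g) = a}"
  show "bvec \<beta> * y \<in> sym_homog (a + b)"
  proof (rule lin_maps_pspan[OF _ subspace_sym_homog _ assms(2)[unfolded sym_homog_def]])
    fix \<gamma> :: "nat \<Rightarrow>\<^sub>0 nat"
    assume \<gamma>: "\<gamma> \<in> {\<beta>. keys \<beta> \<subseteq> {..<length vs} \<and> mon_deg (\<beta>, 0::'g) = b}"
    show "bvec \<beta> * bvec \<gamma> \<in> sym_homog (a + b)"
      using \<beta> \<gamma> Poly_Mapping.keys_add[of \<beta> \<gamma>]
      by (auto simp: sym_homog_def mult_single mon_deg_add dest!: subsetD)
  qed (intro lin_intros_mult)
qed (intro lin_intros_mult)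

lemma sym_homog_1: "1 \<in> sym_homog 0"
proof -
  have "bvec 0 \<in> sym_homog 0" unfolding sym_homog_def bvec_in_pspan by (simp add: mon_deg_def)
  thus ?thesis by simp
qed

lemma sym_homog_power: "x \<in> sym_homog a \<Longrightarrow> x ^ n \<in> sym_homog (n * a)"
  by (induction n) (auto simp: sym_homog_1 sym_homog_mult)

lemma sym_homog_prod:
  "(\<And>i. i \<in> A \<Longrightarrow> f i \<in> sym_homog (d i)) \<Longrightarrow> prod f A \<in> sym_homog (sum d A)"
  by (induction A rule: infinite_finite_induct) (auto simp: sym_homog_1 sym_homog_mult)

lemma sym_vec_homog: "sym_vec v \<in> sym_homog 1"
  unfolding sym_vec_def sym_homog_def
  by (intro pspan_sum single_in_pspan) (auto simp: mon_deg_def split: if_splits)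

lemma sym_act_homog:
  assumes "x \<in> sym_homog n"
  shows "sym_act g x \<in> sym_homog n"
proof (rule lin_maps_pspan[OF _ subspace_sym_homog _ assms[unfolded sym_homog_def]])
  fix \<beta> :: "nat \<Rightarrow>\<^sub>0 nat"
  assume "\<beta> \<in> {\<beta>. keys \<beta> \<subseteq> {..<length vs} \<and> mon_deg (\<beta>, 0::'g) = n}"
  hence "(\<Sum>i<length vs. lookup \<beta> i * 1) = n"
    using mon_deg_superset[of "(\<beta>, 0::'g)" "{..<length vs}"] by simp
  moreover have "sym_act g (bvec \<beta>) \<in> sym_homog (\<Sum>i<length vs. lookup \<beta> i * 1)"
    unfolding sym_act_bvec by (intro sym_homog_prod sym_homog_power sym_vec_homog)
  ultimately show "sym_act g (bvec \<beta>) \<in> sym_homog n"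
    by simp
qed (intro lin_sym_act lin_id)

subsection \<open>The product of the skew group algebra\<close>

lemma lin_tensor_grp:
  "lin s F \<Longrightarrow> lin s (\<lambda>x. tensor_grp (F x) g)"
  unfolding tensor_grp_def by (rule lin_lext)

lemma tensor_grp_bvec [simp]: "tensor_grp (bvec \<alpha>) g = bvec (\<alpha>, g)"
  by (simp add: tensor_grp_def)

lemma lin_star_left:
  "lin s F \<Longrightarrow> lin s (\<lambda>x. F x \<star> b)"
  unfolding skew_mult_def by (rule lin_lext)

lemma lin_star_right:
  assumes "lin s F"
  shows "lin s (\<lambda>x. a \<star> F x)"
  unfolding skew_mult_def
  by (rule lin_lext2[OF linearD(1)[OF assms]], rule lin_case_prod, rule lin_lext, fact assms)

lemmas star_left = linearD(2-7)[OF lin_star_left[OF lin_id]]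
lemmas star_right = linearD(2-7)[OF lin_star_right[OF lin_id]]

lemma star_bvec:
  "bvec (\<alpha>, g) \<star> bvec (\<beta>, h) = tensor_grp (bvec \<alpha> * sym_act g (bvec \<beta>)) (g + h)"
  by (simp add: skew_mult_def)

lemma tensor_grp_star:
  "tensor_grp r g \<star> tensor_grp s h = tensor_grp (r * sym_act g s) (g + h)"
proof (rule lin_eqI[where f = "\<lambda>r. tensor_grp r g \<star> tensor_grp s h"])
  fix \<alpha>
  show "tensor_grp (bvec \<alpha>) g \<star> tensor_grp s h = tensor_grp (bvec \<alpha> * sym_act g s) (g + h)"
    by (rule lin_eqI[where f = "\<lambda>s. tensor_grp (bvec \<alpha>) g \<star> tensor_grp s h"])
      (auto intro!: lin_star_right lin_tensor_grp lin_intros_mult lin_sym_act simp: star_bvec)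
qed (intro lin_star_left lin_tensor_grp lin_intros_mult)+

text \<open>This holds on the full type, since \<open>sym_act\<close> is multiplicative and
  compatible with the group law on all exponents, not only on those of the carrier.\<close>

lemma star_assoc: "a \<star> b \<star> c = a \<star> (b \<star> c)"
proof -
  have 1: "bvec p \<star> bvec q \<star> bvec r = bvec p \<star> (bvec q \<star> bvec r)" for p q r :: "'g mon"
    by (cases p; cases q; cases r)
      (simp add: tensor_grp_star sym_act_mult sym_act_act mult.assoc add.assoc flip: tensor_grp_bvec)
  have 2: "bvec p \<star> bvec q \<star> c = bvec p \<star> (bvec q \<star> c)" for p q
    by (rule lin_eqI[where f = "\<lambda>c. bvec p \<star> bvec q \<star> c"])
      (intro lin_star_right lin_id 1)+
  have 3: "bvec p \<star> b \<star> c = bvec p \<star> (b \<star> c)" for p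
    by (rule lin_eqI[where f = "\<lambda>b. bvec p \<star> b \<star> c"])
      (intro lin_star_right lin_star_left lin_id 2)+
  show ?thesis
    by (rule lin_eqI[where f = "\<lambda>a. a \<star> b \<star> c"]) (intro lin_star_left lin_id 3)+
qed

lemma one_skew_tensor: "one_skew = tensor_grp 1 0"
  using tensor_grp_bvec[of 0 0] by (simp add: one_skew_def)

lemma of_grp_tensor: "of_grp g = tensor_grp 1 g"
  using tensor_grp_bvec[of 0 g] by (simp add: of_grp_def)

lemma star_one_right [simp]: "a \<star> one_skew = a"
proof (rule lin_eqI[where f = "\<lambda>a. a \<star> one_skew"])
  fix p :: "'g mon"
  show "bvec p \<star> one_skew = bvec p"
    by (cases p) (simp add: one_skew_tensor tensor_grp_star flip: tensor_grp_bvec)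
qed (intro lin_star_left lin_id)+

text \<open>Unlike the right unit law this needs the carrier, because the neutral group element acts
  on the right factor and fixes only exponents below dim V.\<close>

lemma star_one_left [simp]:
  assumes "a \<in> skew_space"
  shows "one_skew \<star> a = a"
proof (rule lin_eq_on_pspan[where f = "\<lambda>a. one_skew \<star> a", OF _ _ _ assms[unfolded skew_space_def]])
  fix p :: "'g mon" assume p: "p \<in> mons"
  show "one_skew \<star> bvec p = bvec p"
    using p by (cases p)
      (auto simp: mons_def one_skew_tensor tensor_grp_star sym_act_zero simp flip: tensor_grp_bvec)
qed (intro lin_star_right lin_id)+

lemma subspace_skew_space: "pm.subspace skew_space"
  by (simp add: skew_space_def subspace_pspan)

lemma subspace_skew_homog: "pm.subspace (skew_homog n)"
  by (simp add: skew_homog_def subspace_pspan)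

lemma tensor_grp_homog:
  assumes "r \<in> sym_homog n"
  shows "tensor_grp r g \<in> skew_homog n"
  unfolding tensor_grp_def
  by (rule lext_mem[OF subspace_skew_homog _ assms[unfolded sym_homog_def]])
    (auto simp: skew_homog_def mons_def mon_deg_def)

lemma bvec_sym_homog: "p \<in> mons \<Longrightarrow> bvec (fst p) \<in> sym_homog (mon_deg p)"
  by (cases p) (auto simp: sym_homog_def mons_def mon_deg_def)

lemma star_bvec_homog:
  assumes "p \<in> mons" "q \<in> mons"
  shows "bvec p \<star> bvec q \<in> skew_homog (mon_deg p + mon_deg q)"
  using bvec_sym_homog[OF assms(1)] bvec_sym_homog[OF assms(2)]
  by (cases p; cases q) (auto simp: star_bvec intro!: tensor_grp_homog sym_homog_mult sym_act_homog)

lemma skew_homog_subset: "skew_homog n \<subseteq> skew_space"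
  unfolding skew_homog_def skew_space_def by (rule pspan_mono) auto

lemma star_homog:
  assumes "x \<in> skew_homog a" "y \<in> skew_homog b"
  shows "x \<star> y \<in> skew_homog (a + b)"
proof (rule lin_maps_pspan[where f = "\<lambda>x. x \<star> y", OF _ subspace_skew_homog _ assms(1)[unfolded skew_homog_def]])
  fix p :: "'g mon" assume p: "p \<in> {p \<in> mons. mon_deg p = a}"
  show "bvec p \<star> y \<in> skew_homog (a + b)"
    by (rule lin_maps_pspan[where f = "\<lambda>y. bvec p \<star> y", OF _ subspace_skew_homog _ assms(2)[unfolded skew_homog_def]])
      (use p star_bvec_homog[of p] in \<open>force intro!: lin_star_right lin_id\<close>)+
qed (intro lin_star_left lin_id)

lemma star_skew_space:
  assumes "x \<in> skew_space" "y \<in> skew_space"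
  shows "x \<star> y \<in> skew_space"
proof (rule lin_maps_pspan[where f = "\<lambda>x. x \<star> y", OF _ subspace_skew_space _ assms(1)[unfolded skew_space_def]])
  fix p :: "'g mon" assume p: "p \<in> mons"
  show "bvec p \<star> y \<in> skew_space"
    by (rule lin_maps_pspan[where f = "\<lambda>y. bvec p \<star> y", OF _ subspace_skew_space _ assms(2)[unfolded skew_space_def]])
      (use p star_bvec_homog[of p, THEN subsetD[OF skew_homog_subset]]
        in \<open>force intro!: lin_star_right lin_id\<close>)+
qed (intro lin_star_left lin_id)

lemma bvec_skew_space [simp]: "bvec p \<in> skew_space \<longleftrightarrow> p \<in> mons"
  by (simp add: skew_space_def)

lemma one_skew_homog: "one_skew \<in> skew_homog 0"
  by (simp add: one_skew_def skew_homog_def mons_def mon_deg_def)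

lemma of_grp_homog: "of_grp g \<in> skew_homog 0"
  by (simp add: of_grp_def skew_homog_def mons_def mon_deg_def)

lemma of_vec_homog: "of_vec v \<in> skew_homog 1"
  unfolding of_vec_def by (intro tensor_grp_homog sym_vec_homog)

lemma of_grpalg_homog: "of_grpalg a \<in> skew_homog 0"
  unfolding of_grpalg_def
  by (rule lext_mem[where S = UNIV, OF subspace_skew_homog of_grp_homog]) simp

lemmas skew_space_mem [simp] =
  one_skew_homog[THEN subsetD[OF skew_homog_subset]]
  of_grp_homog[THEN subsetD[OF skew_homog_subset]]
  of_vec_homog[THEN subsetD[OF skew_homog_subset]]
  of_grpalg_homog[THEN subsetD[OF skew_homog_subset]]

lemma lin_of_vec: "lin scale of_vec"
  unfolding of_vec_def by (intro lin_tensor_grp lin_sym_vec)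

lemma lin_of_grpalg:
  "lin s F \<Longrightarrow> lin s (\<lambda>x. of_grpalg (F x))"
  unfolding of_grpalg_def by (rule lin_lext)

lemmas of_vec_simps = linearD(2-7)[OF lin_of_vec]
lemmas of_grpalg_simps = linearD(2-7)[OF lin_of_grpalg[OF lin_id]]

lemma of_grpalg_bvec [simp]: "of_grpalg (bvec g) = of_grp g"
  by (simp add: of_grpalg_def)

lemma of_grp_star_of_grp: "of_grp g \<star> of_grp h = of_grp (g + h)"
  by (simp add: of_grp_tensor tensor_grp_star)

lemma of_grpalg_mult: "of_grpalg (a * b) = of_grpalg a \<star> of_grpalg b"
proof (rule lin_eqI[where f = "\<lambda>a. of_grpalg (a * b)"])
  fix g
  show "of_grpalg (bvec g * b) = of_grpalg (bvec g) \<star> of_grpalg b"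
    by (rule lin_eqI[where f = "\<lambda>b. of_grpalg (bvec g * b)"])
      (auto intro!: lin_intros_mult lin_of_grpalg lin_star_right simp: mult_single of_grp_star_of_grp)
qed (intro lin_intros_mult lin_of_grpalg lin_star_left)+

lemma of_grp_star_of_vec: "of_grp g \<star> of_vec v = of_vec (act g v) \<star> of_grp g"
  by (simp add: of_grp_tensor of_vec_def tensor_grp_star sym_act_vec)

lemma of_vec_star_of_grp: "of_vec v \<star> of_grp g = tensor_grp (sym_vec v) g"
  by (simp add: of_grp_tensor of_vec_def tensor_grp_star)

lemma lookup_tensor_grp:
  "lookup (tensor_grp r g) (\<alpha>, h) = (if g = h then lookup r \<alpha> else 0)"
  by (auto simp: tensor_grp_def lext_def lookup_sum lookup_single when_def in_keys_iff sum.delta)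

lemma of_grpalg_inject: "of_grpalg a = of_grpalg b \<longleftrightarrow> a = b"
proof -
  have "lookup (of_grpalg a) (0, g) = lookup a g" for a g
    by (auto simp: of_grpalg_def of_grp_def lext_def lookup_sum lookup_single when_def in_keys_iff sum.delta)
  thus ?thesis by (metis poly_mapping_eqI)
qed

lemma lookup_sym_vec: "i < length vs \<Longrightarrow> lookup (sym_vec v) (single i 1) = coord v i"
proof -
  assume i: "i < length vs"
  have "single j (1::nat) = single i 1 \<longleftrightarrow> j = i" for j
    by (metis keys_single one_neq_zero singleton_inject)
  thus ?thesis using i by (simp add: sym_vec_def lookup_sum lookup_single when_def)
qed

text \<open>The degree 1 part of A is V \<otimes> kG, and the coordinates of \<open>f h\<close> are
  the coefficients at \<open>(single i 1, h)\<close>. Equations in this part thereby become one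
  equation in V for each group element.\<close>

lemma sum_of_vec_of_grp_eq_iff:
  "(\<Sum>g\<in>UNIV. of_vec (f g) \<star> of_grp g) = (\<Sum>g\<in>UNIV. of_vec (f' g) \<star> of_grp g) \<longleftrightarrow> f = f'"
proof
  assume eq: "(\<Sum>g\<in>UNIV. of_vec (f g) \<star> of_grp g) = (\<Sum>g\<in>UNIV. of_vec (f' g) \<star> of_grp g)"
  have lk: "lookup (\<Sum>g\<in>UNIV. of_vec (f g) \<star> of_grp g) (single i 1, h) = coord (f h) i"
    if "i < length vs" for f :: "'g \<Rightarrow> 'v" and i h
    using that by (simp add: of_vec_star_of_grp lookup_sum lookup_tensor_grp lookup_sym_vec del: One_nat_def)
  have "coord (f h) i = coord (f' h) i" if "i < length vs" for h i
    using lk[OF that, of f h] lk[OF that, of f' h] eq by simp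
  thus "f = f'" by (intro ext coord_eqI)
qed auto

text \<open>This product and the next are put into the form with the vector on the left and the
  group element on the right, where \<open>sum_of_vec_of_grp_eq_iff\<close> can compare
  them.\<close>

lemma of_grpalg_star_of_vec:
  "of_grpalg a \<star> of_vec v = (\<Sum>g\<in>UNIV. of_vec (scale (lookup a g) (act g v)) \<star> of_grp g)"
proof -
  have "of_grpalg a = (\<Sum>g\<in>UNIV. pscale (lookup a g) (of_grp g))"
    unfolding of_grpalg_def by (rule lext_superset) auto
  thus ?thesis
    by (simp add: star_left of_grp_star_of_vec of_vec_simps)
qed

lemma of_vec_star_of_grpalg:
  "of_vec v \<star> of_grpalg a = (\<Sum>g\<in>UNIV. of_vec (scale (lookup a g) v) \<star> of_grp g)"
proof -
  have "of_grpalg a = (\<Sum>g\<in>UNIV. pscale (lookup a g) (of_grp g))"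
    unfolding of_grpalg_def by (rule lext_superset) auto
  thus ?thesis
    by (simp add: star_left star_right of_vec_simps)
qed

end

locale pbw_data = skew_setup scale vs act
  for scale :: "'k::field \<Rightarrow> 'v::ab_group_add \<Rightarrow> 'v" and vs :: "'v list"
    and act :: "'g::{group_add, finite} \<Rightarrow> 'v \<Rightarrow> 'v" +
  fixes lam :: "('g \<Rightarrow>\<^sub>0 'k) \<Rightarrow> 'v \<Rightarrow> ('g \<Rightarrow>\<^sub>0 'k)"
    and kap :: "'v \<Rightarrow> 'v \<Rightarrow> ('g \<Rightarrow>\<^sub>0 'k)"
  assumes lam_linear1: "lin pscale (\<lambda>x. lam x v)"
    and lam_linear2: "lin scale (lam x)"
    and kap_linear1: "lin scale (\<lambda>v. kap v w)"
    and kap_linear2: "lin scale (kap v)"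
    and kap_alt [simp]: "kap v v = 0"

section \<open>The free algebra and its degree filtration\<close>

context skew_setup
begin

notation free_mult (infixl \<open>\<odot>\<close> 70)

lemma lin_fm_left:
  "lin s F \<Longrightarrow> lin s (\<lambda>x. F x \<odot> b)"
  unfolding free_mult_def by (rule lin_lext)

lemma lin_fm_right:
  assumes "lin s F"
  shows "lin s (\<lambda>x. a \<odot> F x)"
  unfolding free_mult_def
  by (rule lin_lext2[OF linearD(1)[OF assms]], rule lin_lext, fact assms)

lemmas fm_left = linearD(2-7)[OF lin_fm_left[OF lin_id]]
lemmas fm_right = linearD(2-7)[OF lin_fm_right[OF lin_id]]

lemma fm_bvec [simp]: "bvec u \<odot> bvec w = bvec (u @ w)"
  by (simp add: free_mult_def)

lemma fm_assoc: "a \<odot> b \<odot> c = a \<odot> (b \<odot> c)"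
proof -
  have 2: "bvec p \<odot> bvec q \<odot> c = bvec p \<odot> (bvec q \<odot> c)" for p q
    by (rule lin_eqI[where f = "\<lambda>c. bvec p \<odot> bvec q \<odot> c"])
      (intro lin_fm_right lin_id | simp)+
  have 3: "bvec p \<odot> b \<odot> c = bvec p \<odot> (b \<odot> c)" for p
    by (rule lin_eqI[where f = "\<lambda>b. bvec p \<odot> b \<odot> c"])
      (intro lin_fm_right lin_fm_left lin_id 2)+
  show ?thesis
    by (rule lin_eqI[where f = "\<lambda>a. a \<odot> b \<odot> c"]) (intro lin_fm_left lin_id 3)+
qed

lemma fm_one_left [simp]: "bvec [] \<odot> a = a"
  by (rule lin_eqI[where f = "\<lambda>a. bvec [] \<odot> a"]) (auto intro: lin_fm_right lin_id)

lemma fm_one_right [simp]: "a \<odot> bvec [] = a"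
  by (rule lin_eqI[where f = "\<lambda>a. a \<odot> bvec []"]) (auto intro: lin_fm_left lin_id)

lemma single_nil_fm: "single [] c \<odot> a = pscale c a"
  using fm_left(2)[of c "bvec []" a] by simp

lemma word_deg_append: "word_deg (u @ w) = word_deg u + word_deg w"
  by (simp add: word_deg_def)

lemma fm_pspan:
  assumes "x \<in> pspan S" "y \<in> pspan T" "\<And>u w. u \<in> S \<Longrightarrow> w \<in> T \<Longrightarrow> u @ w \<in> U"
  shows "x \<odot> y \<in> pspan U"
proof (rule lin_maps_pspan[where f = "\<lambda>x. x \<odot> y", OF _ subspace_pspan _ assms(1)])
  fix u assume u: "u \<in> S"
  show "bvec u \<odot> y \<in> pspan U"
    by (rule lin_maps_pspan[where f = "\<lambda>y. bvec u \<odot> y", OF _ subspace_pspan _ assms(2)])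
      (auto intro!: lin_fm_right lin_id assms(3) u)
qed (intro lin_fm_left lin_id)

definition free_space :: "('g, 'k) free set" where
  "free_space = pspan (lists letters)"

text \<open>Strict inequality makes the bottom layer \<open>free_lt 0\<close> zero, like \<open>F\<^bsub>-1\<^esub> H\<close>.\<close>

definition free_lt :: "nat \<Rightarrow> ('g, 'k) free set" where
  "free_lt n = pspan {w \<in> lists letters. word_deg w < n}"

lemma subspace_free_space: "pm.subspace free_space"
  and subspace_free_lt: "pm.subspace (free_lt n)"
  by (simp_all add: free_space_def free_lt_def subspace_pspan)

lemma free_lt_0 [simp]: "free_lt 0 = {0}"
  by (simp add: free_lt_def)

lemma free_lt_subset: "free_lt n \<subseteq> free_space"
  unfolding free_lt_def free_space_def by (rule pspan_mono) auto

lemma free_lt_mono: "m \<le> n \<Longrightarrow> free_lt m \<subseteq> free_lt n"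
  unfolding free_lt_def by (rule pspan_mono) auto

lemma fm_space: "x \<in> free_space \<Longrightarrow> y \<in> free_space \<Longrightarrow> x \<odot> y \<in> free_space"
  unfolding free_space_def by (erule (1) fm_pspan) auto

text \<open>Degrees at most m and at most n - 1 add up to at most m + n - 1: strictness in one
  factor suffices, whichever it is.\<close>

lemma fm_lt: "x \<in> free_lt (Suc m) \<Longrightarrow> y \<in> free_lt n \<Longrightarrow> x \<odot> y \<in> free_lt (m + n)"
  unfolding free_lt_def by (erule (1) fm_pspan) (auto simp: word_deg_append)

lemma fm_lt': "x \<in> free_lt m \<Longrightarrow> y \<in> free_lt (Suc n) \<Longrightarrow> x \<odot> y \<in> free_lt (m + n)"
  unfolding free_lt_def by (erule (1) fm_pspan) (auto simp: word_deg_append)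

lemma free_alg_simps [simp]:
  "carrier free_alg = free_space" "x \<otimes>\<^bsub>free_alg\<^esub> y = x \<odot> y" "x \<oplus>\<^bsub>free_alg\<^esub> y = x + y"
  "\<one>\<^bsub>free_alg\<^esub> = bvec []" "\<zero>\<^bsub>free_alg\<^esub> = 0"
  by (simp_all add: free_alg_def free_space_def)

lemma one_free_space [simp]: "bvec [] \<in> free_space"
  by (simp add: free_space_def)

lemma single_free_space [simp]: "single [] c \<in> free_space"
  by (simp add: free_space_def single_in_pspan)

lemmas free_space_closed =
  pm.subspace_0[OF subspace_free_space] pm.subspace_add[OF subspace_free_space]
  pm.subspace_diff[OF subspace_free_space] pm.subspace_neg[OF subspace_free_space]
  pm.subspace_scale[OF subspace_free_space] fm_space

lemma ring_free_alg: "ring free_alg"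
proof (rule ringI)
  show "abelian_group free_alg"
  proof (rule abelian_groupI)
    fix x assume "x \<in> carrier free_alg"
    thus "\<exists>y\<in>carrier free_alg. y \<oplus>\<^bsub>free_alg\<^esub> x = \<zero>\<^bsub>free_alg\<^esub>"
      by (intro bexI[of _ "- x"]) (auto simp: free_space_closed)
  qed (auto simp: free_space_closed add.assoc add.commute)
  show "Group.monoid free_alg"
    by (rule monoidI) (auto simp: free_space_closed fm_assoc)
qed (auto simp: fm_left fm_right)

lemma idealI_free:
  assumes "pm.subspace J" "J \<subseteq> free_space"
    and "\<And>a x. a \<in> J \<Longrightarrow> x \<in> free_space \<Longrightarrow> x \<odot> a \<in> J"
    and "\<And>a x. a \<in> J \<Longrightarrow> x \<in> free_space \<Longrightarrow> a \<odot> x \<in> J"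
  shows "ideal J free_alg"
proof (rule idealI[OF ring_free_alg])
  interpret ring free_alg by (rule ring_free_alg)
  show "subgroup J (add_monoid free_alg)"
  proof (rule add.subgroupI)
    fix a assume a: "a \<in> J"
    have "\<ominus>\<^bsub>free_alg\<^esub> a = - a"
      by (rule minus_equality) (use a assms in \<open>auto simp: free_space_closed\<close>)
    thus "\<ominus>\<^bsub>free_alg\<^esub> a \<in> J"
      using pm.subspace_neg[OF assms(1) a] by simp
  qed (use assms(1,2) pm.subspace_0[OF assms(1)] in \<open>auto simp: pm.subspace_add\<close>)
qed (use assms in auto)

lemma free_vec_space [simp]: "free_vec v \<in> free_space"
  unfolding free_vec_def free_space_def
  by (intro pspan_sum single_in_pspan) (auto simp: letters_def)

lemma free_grp_space [simp]: "free_grp g \<in> free_space"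
  by (simp add: free_grp_def free_space_def letters_def)

lemma free_grpalg_space [simp]: "free_grpalg a \<in> free_space"
  unfolding free_grpalg_def
  by (rule lext_mem[where S = UNIV, OF subspace_free_space free_grp_space]) simp

lemma free_grp_lt: "free_grp g \<in> free_lt (Suc 0)"
  by (simp add: free_grp_def free_lt_def letters_def word_deg_def)

lemma free_grpalg_lt: "free_grpalg a \<in> free_lt (Suc 0)"
  unfolding free_grpalg_def
  by (rule lext_mem[where S = UNIV, OF subspace_free_lt free_grp_lt]) simp

lemma lin_free_grpalg:
  "lin s F \<Longrightarrow> lin s (\<lambda>x. free_grpalg (F x))"
  unfolding free_grpalg_def by (rule lin_lext)

lemma lin_free_vec: "lin scale free_vec"
  unfolding free_vec_def
  by (intro lin_sum lin_single vector_space_scale) (simp_all add: coord_add coord_scale)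

lemmas free_grpalg_simps = linearD(2-7)[OF lin_free_grpalg[OF lin_id]]
lemmas free_vec_simps = linearD(2-7)[OF lin_free_vec]

lemma free_vec_vs: "i < length vs \<Longrightarrow> free_vec (vs ! i) = bvec [Inl i]"
proof -
  assume i: "i < length vs"
  have "free_vec (vs ! i) = (\<Sum>j<length vs. if i = j then bvec [Inl j] else 0)"
    unfolding free_vec_def using i by (intro sum.cong) (auto simp: coord_vs)
  thus ?thesis using i by simp
qed

end

context pbw_data
begin

lemmas lam_simps = linearD(2-7)[OF lam_linear1] linearD(2-7)[OF lam_linear2]
lemmas kap_simps = linearD(2-7)[OF kap_linear1] linearD(2-7)[OF kap_linear2]

lemma lin_lam1: "lin s F \<Longrightarrow> lin s (\<lambda>x. lam (F x) v)"
  by (rule lin_comp[OF lam_linear1])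

lemma kap_anti: "kap v w = - kap w v"
proof -
  have "kap (v + w) (v + w) = kap v w + kap w v"
    unfolding kap_simps by simp
  thus ?thesis by (simp add: eq_neg_iff_add_eq_0)
qed

subsection \<open>The ideal of relations\<close>

abbreviation "I \<equiv> rel_ideal lam kap"
abbreviation "H \<equiv> H_alg lam kap"

lemma relators_space: "relators lam kap \<subseteq> free_space"
  by (auto simp: relators_def intro!: free_space_closed)

lemma ideal_I: "ideal I free_alg"
  unfolding rel_ideal_def using relators_space by (intro ring.genideal_ideal ring_free_alg) simp

lemma relators_I: "relators lam kap \<subseteq> I"
  unfolding rel_ideal_def using relators_space by (intro ring.genideal_self ring_free_alg) simp

lemma I_minimal: "ideal J free_alg \<Longrightarrow> relators lam kap \<subseteq> J \<Longrightarrow> I \<subseteq> J"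
  unfolding rel_ideal_def by (intro ring.genideal_minimal ring_free_alg)

lemma I_left: "x \<in> I \<Longrightarrow> a \<in> free_space \<Longrightarrow> a \<odot> x \<in> I"
  using ideal.I_l_closed[OF ideal_I] by simp

lemma I_right: "x \<in> I \<Longrightarrow> a \<in> free_space \<Longrightarrow> x \<odot> a \<in> I"
  using ideal.I_r_closed[OF ideal_I] by simp

text \<open>An ideal of the ring is closed under ring operations; closure under scalars comes from
  multiplying by \<open>single [] c\<close>, a multiple of the unit.\<close>

lemma subspace_I: "pm.subspace I"
proof -
  note sub = ideal.axioms(1)[OF ideal_I]
  have "pscale c x \<in> I" if "x \<in> I" for c x
    using I_left[OF that, of "single [] c"] by (simp add: single_nil_fm)
  thus ?thesis 
    using additive_subgroup.zero_closed[OF sub] additive_subgroup.a_closed[OF sub]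
    by (auto simp: pm.subspace_def)
qed

lemmas I_closed = pm.subspace_0[OF subspace_I] pm.subspace_add[OF subspace_I]
  pm.subspace_diff[OF subspace_I] pm.subspace_neg[OF subspace_I] pm.subspace_scale[OF subspace_I]

text \<open>The conditions on the parameters that resolve the ambiguities \<open>ghv\<close>, \<open>gvw\<close> and \<open>uvw\<close>.\<close>

definition mult_cond :: bool where
  "mult_cond \<longleftrightarrow> (\<forall>g h v.
     lam (bvec (g + h)) v = lam (bvec g) (act h v) * bvec h + bvec g * lam (bvec h) v)"

definition kap_cond :: bool where
  "kap_cond \<longleftrightarrow> (\<forall>g u v. bvec g * kap u v - kap (act g u) (act g v) * bvec g
     = lam (lam (bvec g) u) v - lam (lam (bvec g) v) u)"

text \<open>The overlap \<open>gvw\<close> yields two conditions. Its degree 0 component is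
  \<open>kap_cond\<close>; this is its degree 1 component, an element of V \<otimes> kG, read off at
  each h.\<close>

definition lam_cond :: bool where
  "lam_cond \<longleftrightarrow> (\<forall>g h u v. scale (lookup (lam (bvec g) v) h) (act h u - act g u)
     = scale (lookup (lam (bvec g) u) h) (act h v - act g v))"

text \<open>The overlap \<open>uvw\<close> splits in the same way: degree 1 at each h here, degree 0
  in \<open>jac_grp_cond\<close>.\<close>

definition jac_vec_cond :: bool where
  "jac_vec_cond \<longleftrightarrow> (\<forall>h u v w. scale (lookup (kap u v) h) (act h w - w)
     + scale (lookup (kap v w) h) (act h u - u)
     + scale (lookup (kap w u) h) (act h v - v) = 0)"

definition jac_grp_cond :: bool where
  "jac_grp_cond \<longleftrightarrow> (\<forall>u v w. lam (kap u v) w + lam (kap v w) u + lam (kap w u) v = 0)"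

definition cls :: "('g, 'k) free \<Rightarrow> ('g, 'k) free set" where
  "cls f = I +>\<^bsub>free_alg\<^esub> f"

lemma cls_alt: "cls f = {x + f | x. x \<in> I}"
  by (auto simp: cls_def a_r_coset_def')

lemma cls_eq_iff: "cls f = cls f' \<longleftrightarrow> f - f' \<in> I"
proof
  assume "cls f = cls f'"
  hence "0 + f \<in> cls f'" unfolding cls_alt using I_closed(1) by blast
  then obtain x where "x \<in> I" "0 + f = x + f'" unfolding cls_alt by blast
  thus "f - f' \<in> I" by simp
next
  assume d: "f - f' \<in> I"
  have "\<exists>y\<in>I. x + f = y + f'" "\<exists>y\<in>I. x + f' = y + f" if "x \<in> I" for x
    using that d I_closed(2)[OF that d] I_closed(3)[OF that d]
    by (intro bexI[of _ "x + (f - f')"] bexI[of _ "x - (f - f')"]; simp add: algebra_simps)+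
  thus "cls f = cls f'" unfolding cls_alt by blast
qed

lemma H_zero: "\<zero>\<^bsub>H\<^esub> = cls 0"
  by (simp add: H_alg_def FactRing_def cls_alt)

lemma H_one: "\<one>\<^bsub>H\<^esub> = cls (bvec [])"
  by (simp add: H_alg_def FactRing_def cls_def)

lemma H_add: "cls f \<oplus>\<^bsub>H\<^esub> cls f' = cls (f + f')"
proof -
  have "cls f \<oplus>\<^bsub>H\<^esub> cls f' = {x + f + (y + f') | x y. x \<in> I \<and> y \<in> I}"
    by (auto simp: H_alg_def FactRing_def set_add_def' cls_alt)
  also have "\<dots> = {x + (f + f') | x. x \<in> I}"
  proof (intro equalityI subsetI)
    fix z assume "z \<in> {x + f + (y + f') | x y. x \<in> I \<and> y \<in> I}"
    then obtain x y where "x \<in> I" "y \<in> I" "z = (x + y) + (f + f')" by (auto simp: algebra_simps)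
    thus "z \<in> {x + (f + f') | x. x \<in> I}" using I_closed(2) by blast
  next
    fix z assume "z \<in> {x + (f + f') | x. x \<in> I}"
    then obtain x where "x \<in> I" "z = x + f + (0 + f')" by (auto simp: algebra_simps)
    thus "z \<in> {x + f + (y + f') | x y. x \<in> I \<and> y \<in> I}" using I_closed(1) by blast
  qed
  finally show ?thesis by (simp add: cls_alt)
qed

lemma H_mult: "f \<in> free_space \<Longrightarrow> f' \<in> free_space \<Longrightarrow> cls f \<otimes>\<^bsub>H\<^esub> cls f' = cls (f \<odot> f')"
  using ideal.rcoset_mult_add[OF ideal_I, of f f'] by (simp add: H_alg_def FactRing_def cls_def)

lemma H_scale_cls: "f \<in> free_space \<Longrightarrow> H_scale lam kap c (cls f) = cls (pscale c f)"
  unfolding H_scale_def cls_def[symmetric] by (simp add: H_mult single_nil_fm)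

lemma H_filt_cls: "H_filt lam kap n = cls ` free_lt (Suc n)"
  unfolding H_filt_def free_lt_def less_Suc_eq_le by (simp add: cls_def[abs_def])

text \<open>The preimage of F_{n-1} H in the free algebra. Every computation in degree n of gr H is
  a congruence modulo this space.\<close>

definition filt_ideal :: "nat \<Rightarrow> ('g, 'k) free set" where
  "filt_ideal n = {x + y | x y. x \<in> I \<and> y \<in> free_lt n}"

lemma subspace_filt_ideal: "pm.subspace (filt_ideal n)"
  unfolding filt_ideal_def by (intro pm.subspace_sums subspace_I subspace_free_lt)

lemmas filt_ideal_closed = pm.subspace_0[OF subspace_filt_ideal] pm.subspace_add[OF subspace_filt_ideal]
  pm.subspace_diff[OF subspace_filt_ideal] pm.subspace_neg[OF subspace_filt_ideal]
  pm.subspace_scale[OF subspace_filt_ideal]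

lemma I_filt_ideal: "x \<in> I \<Longrightarrow> x \<in> filt_ideal n"
  unfolding filt_ideal_def using pm.subspace_0[OF subspace_free_lt, of n] by force

lemma lt_filt_ideal: "x \<in> free_lt n \<Longrightarrow> x \<in> filt_ideal n"
  unfolding filt_ideal_def using I_closed(1) by force

lemma filt_ideal_0: "filt_ideal 0 = I"
  by (auto simp: filt_ideal_def)

lemma filt_ideal_left:
  assumes "a \<in> free_lt (Suc m)" "x \<in> filt_ideal n"
  shows "a \<odot> x \<in> filt_ideal (m + n)"
proof -
  from assms(2) obtain y z where x: "x = y + z" "y \<in> I" "z \<in> free_lt n"
    by (auto simp: filt_ideal_def)
  have "a \<odot> y \<in> I" using x(2) assms(1) free_lt_subset by (intro I_left) auto
  moreover have "a \<odot> z \<in> free_lt (m + n)" by (rule fm_lt[OF assms(1) x(3)])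
  ultimately show ?thesis
    unfolding x(1) fm_right(1) by (intro filt_ideal_closed(2) I_filt_ideal lt_filt_ideal)
qed

lemma filt_ideal_right:
  assumes "a \<in> free_lt (Suc m)" "x \<in> filt_ideal n"
  shows "x \<odot> a \<in> filt_ideal (n + m)"
proof -
  from assms(2) obtain y z where x: "x = y + z" "y \<in> I" "z \<in> free_lt n"
    by (auto simp: filt_ideal_def)
  have "y \<odot> a \<in> I" using x(2) assms(1) free_lt_subset by (intro I_right) auto
  moreover have "z \<odot> a \<in> free_lt (n + m)" by (rule fm_lt'[OF x(3) assms(1)])
  ultimately show ?thesis
    unfolding x(1) fm_left(1) by (intro filt_ideal_closed(2) I_filt_ideal lt_filt_ideal)
qed

lemma gr_class_cls: "gr_class lam kap n (cls f) = {cls (y + f) | y. y \<in> free_lt n}"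
proof -
  have "(if n = 0 then {\<zero>\<^bsub>H\<^esub>} else H_filt lam kap (n - 1)) = cls ` free_lt n"
    by (auto simp: H_zero H_filt_cls)
  thus ?thesis unfolding gr_class_def a_r_coset_def' by (auto simp: H_add)
qed

lemma gr_class_eq_iff:
  "gr_class lam kap n (cls f) = gr_class lam kap n (cls f') \<longleftrightarrow> f - f' \<in> filt_ideal n"
proof
  assume "gr_class lam kap n (cls f) = gr_class lam kap n (cls f')"
  hence "cls (0 + f) \<in> {cls (y + f') | y. y \<in> free_lt n}"
    unfolding gr_class_cls using pm.subspace_0[OF subspace_free_lt, of n] by blast
  then obtain y where y: "y \<in> free_lt n" "f - (y + f') \<in> I" by (auto simp: cls_eq_iff)
  have "f - f' = (f - (y + f')) + y" by simp
  thus "f - f' \<in> filt_ideal n" unfolding filt_ideal_def using y by blast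
next
  assume "f - f' \<in> filt_ideal n"
  then obtain x z where xz: "f - f' = x + z" "x \<in> I" "z \<in> free_lt n" by (auto simp: filt_ideal_def)
  have 1: "cls (y + f) = cls ((y + z) + f')" for y
    using xz by (simp add: cls_eq_iff algebra_simps)
  have 2: "cls (y + f') = cls ((y - z) + f)" for y
    unfolding 1 by simp
  show "gr_class lam kap n (cls f) = gr_class lam kap n (cls f')"
    unfolding gr_class_cls using xz(3) 1 2 pm.subspace_add[OF subspace_free_lt, of _ n]
      pm.subspace_diff[OF subspace_free_lt, of _ n] by blast
qed

end

section \<open>Dimension count\<close>

lemma bvec_eq_iff [simp]: "(bvec p :: 'x \<Rightarrow>\<^sub>0 'k::field) = bvec q \<longleftrightarrow> p = q"
  by (metis lookup_single_eq lookup_single_not_eq zero_neq_one)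

lemma independent_bvec: "pm.independent (bvec ` (S :: 'a set) :: ('a \<Rightarrow>\<^sub>0 'b::field) set)"
proof
  assume "pm.dependent (bvec ` S :: ('a \<Rightarrow>\<^sub>0 'b) set)"
  then obtain p where p: "p \<in> S" "(bvec p :: 'a \<Rightarrow>\<^sub>0 'b) \<in> pm.span (bvec ` S - {bvec p})"
    by (auto simp: pm.dependent_def)
  have "bvec ` S - {bvec p} = (bvec ` (S - {p}) :: ('a \<Rightarrow>\<^sub>0 'b) set)" by auto
  with p(2) have "(bvec p :: 'a \<Rightarrow>\<^sub>0 'b) \<in> pspan (S - {p})" by (simp add: pspan_eq_span)
  thus False by simp
qed

text \<open>If \<open>a\<close> is in the kernel and has a nonzero coefficient at \<open>p\<close>,
  the image of \<open>p\<close> is a combination of the images of the other basis elements. Then |S|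
  independent vectors would lie in the span of at most |S| - 1 vectors.\<close>

lemma surj_imp_inj_pspan:
  fixes T :: "('x \<Rightarrow>\<^sub>0 'k::field) \<Rightarrow> ('x \<Rightarrow>\<^sub>0 'k)"
  assumes fin: "finite S" and lin: "lin pscale T"
    and surj: "pspan S \<subseteq> T ` pspan S" and a: "a \<in> pspan S" "T a = 0"
  shows "a = 0"
proof (rule ccontr)
  assume "a \<noteq> 0"
  then obtain p where p: "lookup a p \<noteq> 0" by (metis lookup_zero poly_mapping_eqI)
  have pS: "p \<in> S" using p a(1) by (auto simp: pspan_def in_keys_iff)
  let ?R = "(\<lambda>q. T (bvec q)) ` (S - {p})"
  have T: "T x = (\<Sum>q\<in>S. pscale (lookup x q) (T (bvec q)))" if "x \<in> pspan S" for x
  proof -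
    have "x = (\<Sum>q\<in>S. pscale (lookup x q) (bvec q))"
      using lext_superset[of S x bvec] fin that by (simp add: pspan_def)
    thus ?thesis using linearD(3,7)[OF lin] by (metis (no_types, lifting) sum.cong)
  qed
  have "0 = pscale (lookup a p) (T (bvec p))
      + (\<Sum>q\<in>S - {p}. pscale (lookup a q) (T (bvec q)))"
    using T[OF a(1)] a(2) by (simp add: sum.remove[OF fin pS])
  hence "pscale (lookup a p) (T (bvec p))
      = - (\<Sum>q\<in>S - {p}. pscale (lookup a q) (T (bvec q)))"
    by (simp add: eq_neg_iff_add_eq_0)
  also have "\<dots> \<in> pm.span ?R"
    by (intro pm.span_neg pm.span_sum pm.span_scale pm.span_base) auto
  finally have "pscale (inverse (lookup a p)) (pscale (lookup a p) (T (bvec p)))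
      \<in> pm.span ?R" by (rule pm.span_scale)
  hence Tp: "T (bvec p) \<in> pm.span ?R" using p by simp
  have "bvec ` S \<subseteq> pm.span ?R"
  proof
    fix y :: "'x \<Rightarrow>\<^sub>0 'k" assume "y \<in> bvec ` S"
    hence "y \<in> pspan S" by auto
    then obtain x where x: "x \<in> pspan S" "y = T x" using surj by blast
    have "T (bvec q) \<in> pm.span ?R" if "q \<in> S" for q
      using that Tp by (cases "q = p") (auto intro: pm.span_base)
    thus "y \<in> pm.span ?R" unfolding x(2) T[OF x(1)] by (intro pm.span_sum pm.span_scale)
  qed
  hence "card (bvec ` S :: ('x \<Rightarrow>\<^sub>0 'k) set) \<le> card ?R"
    using pm.independent_span_bound[of ?R "bvec ` S"] fin independent_bvec by auto
  also have "\<dots> \<le> card (S - {p})" using fin by (intro card_image_le) auto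
  also have "\<dots> < card S" using fin pS by (intro psubset_card_mono) auto
  also have "card S = card (bvec ` S :: ('x \<Rightarrow>\<^sub>0 'k) set)"
    by (intro card_image[symmetric] inj_onI) simp
  finally show False by simp
qed

context skew_setup
begin

subsection \<open>Leading symbols and normal words\<close>

definition letter_val :: "nat + 'g \<Rightarrow> ('g, 'k) skew_alg" where
  "letter_val l = (case l of Inl i \<Rightarrow> of_vec (vs ! i) | Inr g \<Rightarrow> of_grp g)"

definition word_val :: "(nat + 'g) list \<Rightarrow> ('g, 'k) skew_alg" where
  "word_val w = foldr (\<lambda>l a. letter_val l \<star> a) w one_skew"

lemma word_val_Nil [simp]: "word_val [] = one_skew"
  and word_val_Cons [simp]: "word_val (l # w) = letter_val l \<star> word_val w"
  by (simp_all add: word_val_def)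

lemma word_val_homog: "word_val w \<in> skew_homog (word_deg w)"
proof (induction w)
  case (Cons l w)
  have "letter_val l \<in> skew_homog (word_deg [l])"
    using of_vec_homog of_grp_homog by (auto simp: letter_val_def word_deg_def split: sum.split)
  from star_homog[OF this Cons.IH] show ?case by (simp add: word_deg_append[symmetric])
qed (simp add: word_deg_def one_skew_homog)

lemma word_val_space [simp]: "word_val w \<in> skew_space"
  using word_val_homog skew_homog_subset by blast

lemma word_val_append: "word_val (u @ w) = word_val u \<star> word_val w"
  by (induction u) (simp_all add: star_assoc)

text \<open>The substitution homomorphism from the free algebra to A, cut down to words of degree n.
  On elements of degree at most n it is the leading symbol, the candidate for the inverse of the
  canonical map from A_n to gr_n H.\<close>

definition symb :: "nat \<Rightarrow> ('g, 'k) free \<Rightarrow> ('g, 'k) skew_alg" where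
  "symb n = lext (\<lambda>w. if word_deg w = n then word_val w else 0)"

lemma lin_symb: "lin s F \<Longrightarrow> lin s (\<lambda>x. symb n (F x))"
  unfolding symb_def by (rule lin_lext)

lemmas symb_simps = linearD(2-7)[OF lin_symb[OF lin_id]]

lemma symb_bvec: "symb n (bvec w) = (if word_deg w = n then word_val w else 0)"
  by (simp add: symb_def)

lemma symb_homog: "symb n f \<in> skew_homog n"
  unfolding symb_def
  by (rule lext_mem[where S = UNIV, OF subspace_skew_homog])
    (auto simp: word_val_homog pm.subspace_0[OF subspace_skew_homog])

text \<open>A product of words of degrees at most m and n has degree m + n only if both bounds are
  attained, so lower words contribute 0 to either side.\<close>

lemma symb_mult:
  assumes "x \<in> free_lt (Suc m)" "y \<in> free_lt (Suc n)"
  shows "symb (m + n) (x \<odot> y) = symb m x \<star> symb n y"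
proof (rule lin_eq_on_pspan[where f = "\<lambda>x. symb (m + n) (x \<odot> y)", OF _ _ _ assms(1)[unfolded free_lt_def]])
  fix u assume u: "u \<in> {w \<in> lists letters. word_deg w < Suc m}"
  show "symb (m + n) (bvec u \<odot> y) = symb m (bvec u) \<star> symb n y"
    by (rule lin_eq_on_pspan[where f = "\<lambda>y. symb (m + n) (bvec u \<odot> y)", OF _ _ _ assms(2)[unfolded free_lt_def]])
      (use u in \<open>auto intro!: lin_symb lin_fm_right lin_star_right lin_id lin_zero pm.vector_space_axioms
        simp: symb_bvec word_deg_append word_val_append star_right star_left\<close>)
qed (intro lin_symb lin_fm_left lin_star_left lin_id)+

lemma exps_count:
  "lookup (\<Sum>i\<leftarrow>u. single i (1::nat)) j = count (mset u) j"
  by (induction u) (auto simp: lookup_add lookup_single when_def)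

definition exp_word :: "(nat \<Rightarrow>\<^sub>0 nat) \<Rightarrow> nat list" where
  "exp_word \<alpha> = concat (map (\<lambda>i. replicate (lookup \<alpha> i) i) [0..<length vs])"

lemma set_exp_word: "set (exp_word \<alpha>) \<subseteq> {..<length vs}"
  by (auto simp: exp_word_def)

lemma sorted_exp_word: "sorted (exp_word \<alpha>)"
proof -
  have "sorted (concat (map (\<lambda>i. replicate (lookup \<alpha> i) i) [0..<n]))" for n
    by (induction n) (auto simp: sorted_append)
  thus ?thesis by (simp add: exp_word_def)
qed

lemma count_exp_word: "j < length vs \<Longrightarrow> count (mset (exp_word \<alpha>)) j = lookup \<alpha> j"
proof -
  have "count (mset (concat (map (\<lambda>i. replicate (lookup \<alpha> i) i) [0..<n]))) j
      = (if j < n then lookup \<alpha> j else 0)" for n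
    by (induction n) auto
  thus "j < length vs \<Longrightarrow> ?thesis" by (simp add: exp_word_def)
qed

lemma exps_exp_word:
  assumes "keys \<alpha> \<subseteq> {..<length vs}"
  shows "(\<Sum>i\<leftarrow>exp_word \<alpha>. single i (1::nat)) = \<alpha>"
proof (rule poly_mapping_eqI, unfold exps_count)
  fix j
  show "count (mset (exp_word \<alpha>)) j = lookup \<alpha> j"
  proof (cases "j < length vs")
    case False
    hence "j \<notin> set (exp_word \<alpha>)" "j \<notin> keys \<alpha>" using assms set_exp_word[of \<alpha>] by auto
    thus ?thesis by (simp add: in_keys_iff count_eq_zero_iff)
  qed (simp add: count_exp_word)
qed

lemma mset_exp_word_eqI:
  assumes "set u \<subseteq> {..<length vs}"
  shows "mset u = mset (exp_word (\<Sum>i\<leftarrow>u. single i 1))"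
proof (rule multiset_eqI)
  fix j
  show "count (mset u) j = count (mset (exp_word (\<Sum>i\<leftarrow>u. single i 1))) j"
  proof (cases "j < length vs")
    case False
    hence "j \<notin> set u" "j \<notin> set (exp_word (\<Sum>i\<leftarrow>u. single i 1))"
      using assms set_exp_word by blast+
    thus ?thesis by (metis count_eq_zero_iff set_mset_mset)
  qed (simp add: count_exp_word exps_count del: One_nat_def)
qed

lemma length_exp_word: "p \<in> mons \<Longrightarrow> length (exp_word (fst p)) = mon_deg p"
  by (auto simp: mons_def exp_word_def length_concat o_def mon_deg_superset[of p "{..<length vs}"]
      sum_list_distinct_conv_sum_set atLeast0LessThan intro!: sum.cong)

text \<open>The group letter is present even for the neutral element. The unit of A is thus sent to
  a word of one letter and not to the empty word; the relator for the unit reconciles the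
  two.\<close>

definition nf_word :: "'g mon \<Rightarrow> (nat + 'g) list" where
  "nf_word p = map Inl (exp_word (fst p)) @ [Inr (snd p)]"

definition nf :: "('g, 'k) skew_alg \<Rightarrow> ('g, 'k) free" where
  "nf = lext (\<lambda>p. bvec (nf_word p))"

lemma lin_nf: "lin s F \<Longrightarrow> lin s (\<lambda>x. nf (F x))"
  unfolding nf_def by (rule lin_lext)

lemmas nf_simps = linearD(2-7)[OF lin_nf[OF lin_id]]

lemma nf_bvec: "nf (bvec p) = bvec (nf_word p)"
  by (simp add: nf_def)

lemma word_deg_map_Inl [simp]: "word_deg (map Inl u) = length u"
  by (simp add: word_deg_def filter_map o_def)

lemma map_Inl_letters: "set u \<subseteq> {..<length vs} \<Longrightarrow> map Inl u \<in> lists letters"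
  by (auto simp: letters_def image_iff subset_iff)

lemma nf_word_letters: "nf_word p \<in> lists letters"
  unfolding nf_word_def using map_Inl_letters[OF set_exp_word] by (auto simp: letters_def)

lemma word_deg_nf_word: "p \<in> mons \<Longrightarrow> word_deg (nf_word p) = mon_deg p"
  unfolding nf_word_def word_deg_append by (simp add: length_exp_word) (simp add: word_deg_def)

lemma nf_lt:
  assumes "a \<in> skew_homog n"
  shows "nf a \<in> free_lt (Suc n)"
  unfolding nf_def
  by (rule lext_mem[OF subspace_free_lt _ assms[unfolded skew_homog_def]])
    (auto simp: free_lt_def word_deg_nf_word nf_word_letters)

lemma word_val_map_Inl:
  assumes "set u \<subseteq> {..<length vs}"
  shows "word_val (map Inl u) = bvec (\<Sum>i\<leftarrow>u. single i 1, 0)"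
  using assms
proof (induction u)
  case (Cons i u)
  have k: "keys (\<Sum>i\<leftarrow>u. single i (1::nat)) \<subseteq> {..<length vs}"
  proof
    fix j assume "j \<in> keys (\<Sum>i\<leftarrow>u. single i (1::nat))"
    hence "j \<in> set u" unfolding in_keys_iff exps_count by (simp add: count_eq_zero_iff)
    thus "j \<in> {..<length vs}" using Cons.prems by auto
  qed
  have "word_val (map Inl (i # u)) = of_vec (vs ! i) \<star> bvec (\<Sum>i\<leftarrow>u. single i 1, 0)"
    using Cons by (simp add: letter_val_def)
  also have "\<dots> = bvec (single i 1 + (\<Sum>i\<leftarrow>u. single i 1), 0)"
    using Cons.prems k unfolding tensor_grp_bvec[symmetric] of_vec_def
    by (simp add: tensor_grp_star sym_act_zero sym_vec_vs mult_single del: tensor_grp_bvec One_nat_def)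
  finally show ?case by simp
qed (simp add: one_skew_def)

lemma word_val_nf_word:
  assumes "p \<in> mons"
  shows "word_val (nf_word p) = bvec p"
proof -
  obtain \<alpha> g where p: "p = (\<alpha>, g)" by (cases p)
  have "word_val (map Inl (exp_word \<alpha>)) = bvec (\<alpha>, 0)"
    using assms word_val_map_Inl[OF set_exp_word] exps_exp_word[of \<alpha>] by (simp add: mons_def p)
  thus ?thesis
    by (simp add: p nf_word_def word_val_append letter_val_def of_grp_tensor tensor_grp_star
        del: tensor_grp_bvec flip: tensor_grp_bvec)
qed

lemma symb_nf:
  assumes "a \<in> skew_homog n"
  shows "symb n (nf a) = a"
  by (rule lin_eq_on_pspan[where f = "\<lambda>a. symb n (nf a)", OF _ _ _ assms[unfolded skew_homog_def]])
    (auto intro!: lin_symb lin_nf lin_id simp: nf_bvec symb_bvec word_deg_nf_word word_val_nf_word)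

text \<open>An exponent of degree n takes values at most n on the finitely many indices below dim V,
  and G is finite.\<close>

lemma finite_mons_deg: "finite {p \<in> mons. mon_deg p = n}"
proof -
  let ?F = "{f :: nat \<Rightarrow> nat. \<forall>x. (x \<in> {..<length vs} \<longrightarrow> f x \<in> {..n}) \<and> (x \<notin> {..<length vs} \<longrightarrow> f x = 0)}"
  have "finite ?F" by (rule finite_set_of_finite_funs) auto
  hence "finite (?F \<times> (UNIV :: 'g set))" by simp
  moreover have "(\<lambda>p. (lookup (fst p), snd p)) ` {p \<in> mons. mon_deg p = n} \<subseteq> ?F \<times> UNIV"
  proof clarsimp
    fix \<alpha> g x assume p: "(\<alpha>, g :: 'g) \<in> mons" "n = mon_deg (\<alpha>, g)"
    have "lookup \<alpha> x \<le> (\<Sum>i<length vs. lookup \<alpha> i)" if "x < length vs"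
      using that by (intro member_le_sum) auto
    thus "(x < length vs \<longrightarrow> lookup \<alpha> x \<le> mon_deg (\<alpha>, g)) \<and>
      (\<not> x < length vs \<longrightarrow> lookup \<alpha> x = 0)"
      using p by (auto simp: mons_def mon_deg_superset[of "(\<alpha>, g)" "{..<length vs}"] in_keys_iff)
  qed
  ultimately have "finite ((\<lambda>p. (lookup (fst p), snd p)) ` {p \<in> mons. mon_deg p = n})"
    by (rule rev_finite_subset)
  moreover have "inj_on (\<lambda>p. (lookup (fst p), snd p)) {p \<in> mons. mon_deg p = n}"
    by (rule inj_onI, rule prod_eqI, elim Pair_inject, rule poly_mapping_eq_iff[THEN iffD2], assumption,
        elim Pair_inject)
  ultimately show ?thesis by (rule finite_imageD)
qed

end

section \<open>Normal words span gr H\<close>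

context pbw_data
begin

lemma relator_one: "free_grp 0 - bvec [] \<in> I"
  and relator_grp: "free_grp g \<odot> free_grp h - free_grp (g + h) \<in> I"
  and relator_vec: "free_vec v \<odot> free_vec w - free_vec w \<odot> free_vec v - free_grpalg (kap v w) \<in> I"
  and relator_grp_vec:
    "free_grp g \<odot> free_vec v - free_vec (act g v) \<odot> free_grp g - free_grpalg (lam (bvec g) v) \<in> I"
proof -
  have "free_grp 0 - bvec [] \<in> relators lam kap"
    "free_grp g \<odot> free_grp h - free_grp (g + h) \<in> relators lam kap"
    "free_vec v \<odot> free_vec w - free_vec w \<odot> free_vec v - free_grpalg (kap v w) \<in> relators lam kap"
    "free_grp g \<odot> free_vec v - free_vec (act g v) \<odot> free_grp g - free_grpalg (lam (bvec g) v)
      \<in> relators lam kap"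
    unfolding relators_def by (intro UnI1 UnI2 CollectI exI conjI refl TrueI singletonI; fail | simp; fail | blast)+
  thus "free_grp 0 - bvec [] \<in> I"
    "free_grp g \<odot> free_grp h - free_grp (g + h) \<in> I"
    "free_vec v \<odot> free_vec w - free_vec w \<odot> free_vec v - free_grpalg (kap v w) \<in> I"
    "free_grp g \<odot> free_vec v - free_vec (act g v) \<odot> free_grp g - free_grpalg (lam (bvec g) v) \<in> I"
    using relators_I by (meson subsetD)+
qed

lemma word_lt: "w \<in> lists letters \<Longrightarrow> bvec w \<in> free_lt (Suc (word_deg w))"
  by (simp add: free_lt_def)

text \<open>The relation replaces the commutator by a value of \<open>kap\<close>, of degree 0 and
  so negligible in degree 2.\<close>

lemma swap_filt_ideal:
  assumes "i < length vs" "j < length vs"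
  shows "bvec [Inl i, Inl j] - bvec [Inl j, Inl i] \<in> filt_ideal 2"
proof -
  have "bvec [Inl i, Inl j] - bvec [Inl j, Inl i] - free_grpalg (kap (vs ! i) (vs ! j)) \<in> I"
    using relator_vec[of "vs ! i" "vs ! j"] assms by (simp add: free_vec_vs)
  moreover have "free_grpalg (kap (vs ! i) (vs ! j)) \<in> free_lt 2"
    using free_grpalg_lt free_lt_mono[of "Suc 0" 2] by auto
  ultimately have "bvec [Inl i, Inl j] - bvec [Inl j, Inl i] - free_grpalg (kap (vs ! i) (vs ! j))
      + free_grpalg (kap (vs ! i) (vs ! j)) \<in> filt_ideal 2"
    by (intro filt_ideal_closed(2) I_filt_ideal lt_filt_ideal)
  thus ?thesis by simp
qed

lemma move_filt_ideal:
  assumes "i < length vs" "set u \<subseteq> {..<length vs}"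
  shows "bvec (map Inl (i # u)) - bvec (map Inl (u @ [i])) \<in> filt_ideal (Suc (length u))"
  using assms(2)
proof (induction u)
  case (Cons j u)
  have j: "j < length vs" and u: "set u \<subseteq> {..<length vs}" using Cons.prems by auto
  have "(bvec [Inl i, Inl j] - bvec [Inl j, Inl i]) \<odot> bvec (map Inl u) \<in> filt_ideal (2 + length u)"
    using word_lt[OF map_Inl_letters[OF u]] by (intro filt_ideal_right swap_filt_ideal assms j) simp
  moreover have "bvec [Inl j] \<odot> (bvec (map Inl (i # u)) - bvec (map Inl (u @ [i])))
      \<in> filt_ideal (1 + Suc (length u))"
    using word_lt[of "[Inl j]"] j
    by (intro filt_ideal_left Cons.IH u) (auto simp: letters_def word_deg_def)
  ultimately have "(bvec [Inl i, Inl j] - bvec [Inl j, Inl i]) \<odot> bvec (map Inl u)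
     + bvec [Inl j] \<odot> (bvec (map Inl (i # u)) - bvec (map Inl (u @ [i])))
      \<in> filt_ideal (Suc (Suc (length u)))"
    by (intro filt_ideal_closed(2)) auto
  thus ?case by (simp add: fm_left fm_right)
qed (simp add: filt_ideal_closed)

text \<open>Induction on \<open>u\<close>: the remaining letters are permuted behind the first one,
  which then moves to its place in \<open>u'\<close>.\<close>

lemma perm_filt_ideal:
  assumes "mset u = mset u'" "set u \<subseteq> {..<length vs}"
  shows "bvec (map Inl u) - bvec (map Inl u') \<in> filt_ideal (length u)"
  using assms
proof (induction u arbitrary: u')
  case (Cons i u)
  have i: "i < length vs" and u: "set u \<subseteq> {..<length vs}" using Cons.prems by auto
  have "i \<in> set u'" using Cons.prems(1) by (metis list.set_intros(1) mset_eq_setD)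
  then obtain a b where u': "u' = a @ i # b" by (auto dest: split_list)
  have m: "mset u = mset (a @ b)" using Cons.prems(1) by (simp add: u')
  have ab: "set a \<subseteq> {..<length vs}" "set b \<subseteq> {..<length vs}" "length u = length a + length b"
    using mset_eq_setD[OF m] mset_eq_length[OF m] u by auto
  have "bvec [Inl i] \<odot> (bvec (map Inl u) - bvec (map Inl (a @ b))) \<in> filt_ideal (1 + length u)"
    using word_lt[of "[Inl i]"] i
    by (intro filt_ideal_left Cons.IH m u) (auto simp: letters_def word_deg_def)
  moreover have "(bvec (map Inl (i # a)) - bvec (map Inl (a @ [i]))) \<odot> bvec (map Inl b)
      \<in> filt_ideal (Suc (length a) + length b)"
    using word_lt[OF map_Inl_letters[OF ab(2)]]
    by (intro filt_ideal_right move_filt_ideal i ab) simp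
  ultimately have "bvec [Inl i] \<odot> (bvec (map Inl u) - bvec (map Inl (a @ b)))
      + (bvec (map Inl (i # a)) - bvec (map Inl (a @ [i]))) \<odot> bvec (map Inl b)
      \<in> filt_ideal (Suc (length u))"
    by (intro filt_ideal_closed(2)) (auto simp: ab)
  thus ?case by (simp add: fm_left fm_right u')
qed (simp add: filt_ideal_closed)

lemma sort_filt_ideal:
  assumes "set u \<subseteq> {..<length vs}"
  shows "bvec (map Inl u @ [Inr g]) - bvec (nf_word (\<Sum>i\<leftarrow>u. single i 1, g))
    \<in> filt_ideal (length u)"
proof -
  have "(bvec (map Inl u) - bvec (map Inl (exp_word (\<Sum>i\<leftarrow>u. single i 1)))) \<odot> free_grp g
      \<in> filt_ideal (length u + 0)"
    by (intro filt_ideal_right perm_filt_ideal mset_exp_word_eqI assms free_grp_lt)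
  thus ?thesis by (simp add: fm_left free_grp_def nf_word_def)
qed

lemma nf_word_grp: "bvec (nf_word p) \<odot> free_grp h - nf (bvec p \<star> of_grp h) \<in> I"
proof -
  obtain \<alpha> g where p: "p = (\<alpha>, g)" by (cases p)
  have "bvec (map Inl (exp_word \<alpha>)) \<odot> (free_grp g \<odot> free_grp h - free_grp (g + h)) \<in> I"
    using map_Inl_letters[OF set_exp_word] by (intro I_left relator_grp) (simp add: free_space_def)
  moreover have "bvec p \<star> of_grp h = bvec (\<alpha>, g + h)"
    unfolding p tensor_grp_bvec[symmetric] of_grp_tensor tensor_grp_star by simp
  ultimately show ?thesis by (simp add: p fm_right nf_bvec nf_word_def free_grp_def)
qed

text \<open>The vector passes the group letter by the relation, whose \<open>lam\<close> term drops
  the degree; the new letter then ends the word of vectors and is sorted in.\<close>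

lemma nf_word_vec:
  assumes p: "p \<in> mons"
  shows "bvec (nf_word p) \<odot> free_vec v - nf (bvec p \<star> of_vec v) \<in> filt_ideal (Suc (mon_deg p))"
proof -
  obtain \<alpha> g where pe: "p = (\<alpha>, g)" by (cases p)
  let ?u = "exp_word \<alpha>" and ?m = "length vs"
  let ?w = "bvec (map Inl ?u) :: (nat + 'g) list \<Rightarrow>\<^sub>0 'k"
  have len: "length ?u = mon_deg p" using length_exp_word[OF p] by (simp add: pe)
  have w: "?w \<in> free_lt (Suc (mon_deg p))"
    using word_lt[OF map_Inl_letters[OF set_exp_word[of \<alpha>]]] by (simp only: word_deg_map_Inl len)
  have 1: "?w \<odot> (free_grp g \<odot> free_vec v - free_vec (act g v) \<odot> free_grp g - free_grpalg (lam (bvec g) v))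
      \<in> filt_ideal (Suc (mon_deg p))"
    using w free_lt_subset by (intro I_filt_ideal I_left relator_grp_vec) auto
  have 2: "?w \<odot> free_grpalg (lam (bvec g) v) \<in> filt_ideal (Suc (mon_deg p))"
    using fm_lt[OF w free_grpalg_lt] by (intro lt_filt_ideal) simp
  have 3: "?w \<odot> (bvec [Inl j] \<odot> free_grp g) - nf (bvec (\<alpha> + single j 1, g))
      \<in> filt_ideal (Suc (mon_deg p))" if "j < ?m" for j
  proof -
    have "set (?u @ [j]) \<subseteq> {..<?m}" using set_exp_word[of \<alpha>] that by auto
    from sort_filt_ideal[OF this, of g] exps_exp_word[of \<alpha>] p show ?thesis
      by (simp add: pe mons_def len nf_bvec free_grp_def)
  qed
  have "bvec p \<star> of_vec v = tensor_grp (bvec \<alpha> * sym_vec (act g v)) g"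
    unfolding pe tensor_grp_bvec[symmetric] of_vec_def tensor_grp_star sym_act_vec by simp
  also have "bvec \<alpha> * sym_vec (act g v)
      = (\<Sum>j<?m. pscale (coord (act g v) j) (bvec (\<alpha> + single j 1)))"
    by (simp add: sym_vec_def sum_distrib_left mult_single)
  finally have "nf (bvec p \<star> of_vec v)
      = (\<Sum>j<?m. pscale (coord (act g v) j) (nf (bvec (\<alpha> + single j 1, g))))"
    by (simp add: linearD[OF lin_tensor_grp[OF lin_id]] nf_simps tensor_grp_def nf_def lext_sum)
  moreover have "free_vec (act g v) = (\<Sum>j<?m. pscale (coord (act g v) j) (bvec [Inl j]))"
    by (simp add: free_vec_def)
  hence "?w \<odot> (free_vec (act g v) \<odot> free_grp g)
      = (\<Sum>j<?m. pscale (coord (act g v) j) (?w \<odot> (bvec [Inl j] \<odot> free_grp g)))"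
    by (simp add: fm_left(2,6) fm_right(2,6) del: pscale_single)
  ultimately have "?w \<odot> (free_vec (act g v) \<odot> free_grp g) - nf (bvec p \<star> of_vec v)
      = (\<Sum>j<?m. pscale (coord (act g v) j)
          (?w \<odot> (bvec [Inl j] \<odot> free_grp g) - nf (bvec (\<alpha> + single j 1, g))))"
    by (simp add: sum_subtractf pm.scale_right_diff_distrib)
  also have "\<dots> \<in> filt_ideal (Suc (mon_deg p))"
    using 3 by (intro pm.subspace_sum[OF subspace_filt_ideal] pm.subspace_scale[OF subspace_filt_ideal]) simp
  finally have 4: "?w \<odot> (free_vec (act g v) \<odot> free_grp g) - nf (bvec p \<star> of_vec v)
      \<in> filt_ideal (Suc (mon_deg p))" .
  have "bvec (nf_word p) \<odot> free_vec v = ?w \<odot> (free_grp g \<odot> free_vec v)"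
    by (simp add: pe nf_word_def free_grp_def fm_assoc[symmetric])
  hence "bvec (nf_word p) \<odot> free_vec v - nf (bvec p \<star> of_vec v)
    = ?w \<odot> (free_grp g \<odot> free_vec v - free_vec (act g v) \<odot> free_grp g - free_grpalg (lam (bvec g) v))
      + ?w \<odot> free_grpalg (lam (bvec g) v)
      + (?w \<odot> (free_vec (act g v) \<odot> free_grp g) - nf (bvec p \<star> of_vec v))"
    by (simp add: fm_right)
  also have "\<dots> \<in> filt_ideal (Suc (mon_deg p))"
    by (intro filt_ideal_closed(2) 1 2 4)
  finally show ?thesis .
qed

lemma nf_word_letter:
  assumes "p \<in> mons" "l \<in> letters"
  shows "bvec (nf_word p) \<odot> bvec [l] - nf (bvec p \<star> letter_val l) \<in> filt_ideal (mon_deg p + word_deg [l])"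
proof (cases l)
  case (Inl i)
  thus ?thesis using nf_word_vec[OF assms(1), of "vs ! i"] assms(2)
    by (auto simp: letter_val_def letters_def free_vec_vs word_deg_def)
next
  case (Inr h)
  thus ?thesis using I_filt_ideal[OF nf_word_grp[of p h]]
    by (simp add: letter_val_def free_grp_def word_deg_def)
qed

text \<open>Words grow on the right, where the normal word carries its group letter, so a single
  letter has to be absorbed at each step. The empty word needs the relator that identifies the
  neutral group letter with the unit.\<close>

lemma word_sub_nf:
  "w \<in> lists letters \<Longrightarrow> bvec w - nf (word_val w) \<in> filt_ideal (word_deg w)"
proof (induction w rule: rev_induct)
  case Nil
  have "exp_word 0 = []" by (simp add: exp_word_def)
  hence "bvec [] - nf (word_val []) = - (free_grp 0 - bvec [])"
    by (simp add: one_skew_def nf_bvec nf_word_def free_grp_def)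
  also have "\<dots> \<in> filt_ideal (word_deg [])"
    by (intro I_filt_ideal I_closed relator_one)
  finally show ?case .
next
  case (snoc l w)
  have l: "l \<in> letters" and w: "w \<in> lists letters" using snoc.prems by auto
  have "(bvec w - nf (word_val w)) \<odot> bvec [l] \<in> filt_ideal (word_deg w + word_deg [l])"
    using word_lt[of "[l]"] l by (intro filt_ideal_right snoc.IH w) auto
  moreover have "nf x \<odot> bvec [l] - nf (x \<star> letter_val l) \<in> filt_ideal (word_deg w + word_deg [l])"
    if x: "x \<in> skew_homog (word_deg w)" for x
  proof (rule lin_maps_pspan[where f = "\<lambda>x. nf x \<odot> bvec [l] - nf (x \<star> letter_val l)",
        OF _ subspace_filt_ideal _ x[unfolded skew_homog_def]])
    fix p :: "'g mon" assume "p \<in> {p \<in> mons. mon_deg p = word_deg w}"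
    thus "nf (bvec p) \<odot> bvec [l] - nf (bvec p \<star> letter_val l) \<in> filt_ideal (word_deg w + word_deg [l])"
      using nf_word_letter[OF _ l, of p] by (simp add: nf_bvec)
  qed (intro lin_intros_mult lin_nf lin_fm_left lin_star_left)
  ultimately have "(bvec w - nf (word_val w)) \<odot> bvec [l]
      + (nf (word_val w) \<odot> bvec [l] - nf (word_val w \<star> letter_val l)) \<in> filt_ideal (word_deg w + word_deg [l])"
    by (intro filt_ideal_closed(2)) (auto intro: word_val_homog)
  thus ?case by (simp add: fm_left word_val_append word_deg_append)
qed

text \<open>Surjectivity of the canonical map: an element of degree at most n agrees in gr_n H with
  the normal form of its symbol. Words of lower degree have symbol 0 and are negligible
  themselves.\<close>

lemma sub_nf_symb:
  assumes "f \<in> free_lt (Suc n)"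
  shows "f - nf (symb n f) \<in> filt_ideal n"
proof (rule lin_maps_pspan[where f = "\<lambda>f. f - nf (symb n f)",
      OF _ subspace_filt_ideal _ assms[unfolded free_lt_def]])
  fix w assume w: "w \<in> {w \<in> lists letters. word_deg w < Suc n}"
  show "bvec w - nf (symb n (bvec w)) \<in> filt_ideal n"
  proof (cases "word_deg w = n")
    case True
    thus ?thesis using w word_sub_nf[of w] by (simp add: symb_bvec)
  next
    case False
    thus ?thesis using w by (auto simp: symb_bvec nf_simps free_lt_def intro!: lt_filt_ideal)
  qed
qed (intro lin_intros_mult lin_nf lin_symb)

text \<open>Injectivity of the canonical map from A_n to gr_n H.\<close>

definition nf_indep :: "nat \<Rightarrow> bool" where
  "nf_indep n \<longleftrightarrow> (\<forall>a\<in>skew_homog n. nf a \<in> filt_ideal n \<longrightarrow> a = 0)"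

text \<open>The given \<open>\<Theta>\<close> composed with the canonical map is a linear surjection
  \<open>T\<close> of A_n onto itself, so the dimension count takes place inside A_n, where a basis
  is known.\<close>

lemma PBW_imp_nf_indep:
  assumes "PBW lam kap"
  shows "nf_indep n"
  unfolding nf_indep_def
proof (intro ballI impI)
  fix a assume a: "a \<in> skew_homog n" and na: "nf a \<in> filt_ideal n"
  let ?gr = "\<lambda>f. gr_class lam kap n (cls f)"
  obtain \<Theta> where bij: "bij_betw \<Theta> (gr_class lam kap n ` H_filt lam kap n) (skew_homog n)"
    and add: "\<And>x y. x \<in> H_filt lam kap n \<Longrightarrow> y \<in> H_filt lam kap n \<Longrightarrow>
      \<Theta> (gr_class lam kap n (x \<oplus>\<^bsub>H\<^esub> y)) = \<Theta> (gr_class lam kap n x) + \<Theta> (gr_class lam kap n y)"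
    and scal: "\<And>c x. x \<in> H_filt lam kap n \<Longrightarrow>
      \<Theta> (gr_class lam kap n (H_scale lam kap c x)) = pscale c (\<Theta> (gr_class lam kap n x))"
    using assms unfolding PBW_def by metis
  define t where "t f = \<Theta> (?gr f)" for f
  have t_add: "t (f + f') = t f + t f'" if "f \<in> free_lt (Suc n)" "f' \<in> free_lt (Suc n)" for f f'
    using add[of "cls f" "cls f'"] that by (simp add: t_def H_filt_cls H_add)
  have t_scale: "t (pscale c f) = pscale c (t f)" if "f \<in> free_lt (Suc n)" for f c
    using scal[of "cls f" c] that H_scale_cls[of f c] free_lt_subset[of "Suc n"]
    by (auto simp: t_def H_filt_cls)
  \<comment> \<open>\<open>\<Theta>\<close> is controlled only on classes of filtered elements; the
    linear extension from the basis of A gives a map that is linear on the whole type.\<close>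
  define T where "T = lext (\<lambda>p. t (nf (bvec p)))"
  have T: "T x = t (nf x)" if "x \<in> skew_homog n" for x
    unfolding T_def using that unfolding skew_homog_def
    by (intro linear_on_pspan_eq_lext[symmetric, where f = "\<lambda>x. t (nf x)"])
      (simp_all add: nf_simps t_add t_scale nf_lt skew_homog_def)
  have "skew_homog n \<subseteq> T ` skew_homog n"
  proof
    fix b assume "b \<in> skew_homog n"
    then obtain f where f: "f \<in> free_lt (Suc n)" "b = t f"
      using bij by (auto simp: bij_betw_def H_filt_cls t_def)
    have "?gr f = ?gr (nf (symb n f))" using sub_nf_symb[OF f(1)] by (simp add: gr_class_eq_iff)
    hence "b = T (symb n f)" by (simp add: T symb_homog f(2) t_def)
    thus "b \<in> T ` skew_homog n" using symb_homog by blast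
  qed
  moreover have "T a = 0"
  proof -
    have "?gr (nf a) = ?gr 0" using na by (simp add: gr_class_eq_iff)
    moreover have "t 0 = 0" using t_scale[of 0 0] pm.subspace_0[OF subspace_free_lt] by simp
    ultimately show ?thesis by (simp add: T a t_def)
  qed
  ultimately show "a = 0"
    using surj_imp_inj_pspan[OF finite_mons_deg, of T n a] a
    by (simp add: skew_homog_def T_def linear_lext)
qed

text \<open>Independence makes two elements of degree at most n have the same class in gr_n H
  exactly when they have the same symbol. So the symbol descends to classes, and multiplicativity is
  that of the symbol.\<close>

lemma nf_indep_imp_PBW:
  assumes "\<And>n. nf_indep n"
  shows "PBW lam kap"
proof -
  let ?gr = "\<lambda>n f. gr_class lam kap n (cls f)"
  define \<Theta> where
    "\<Theta> n C = (THE a. \<exists>f\<in>free_lt (Suc n). C = gr_class lam kap n (cls f) \<and> a = symb n f)" for n C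
  have eq: "f - f' \<in> filt_ideal n \<longleftrightarrow> symb n f = symb n f'"
    if "f \<in> free_lt (Suc n)" "f' \<in> free_lt (Suc n)" for f f' n
  proof -
    let ?h = "f - f'"
    have h: "?h \<in> free_lt (Suc n)" using that by (rule pm.subspace_diff[OF subspace_free_lt])
    have "?h \<in> filt_ideal n \<longleftrightarrow> nf (symb n ?h) \<in> filt_ideal n"
      using sub_nf_symb[OF h] filt_ideal_closed(2)[of "?h - nf (symb n ?h)" n "nf (symb n ?h)"]
        filt_ideal_closed(3)[of ?h n "?h - nf (symb n ?h)"] by auto
    also have "\<dots> \<longleftrightarrow> symb n ?h = 0"
      using assms[of n] symb_homog by (auto simp: nf_indep_def nf_simps filt_ideal_closed)
    finally show ?thesis by (simp add: symb_simps)
  qed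
  have \<Theta>: "\<Theta> n (?gr n f) = symb n f" if "f \<in> free_lt (Suc n)" for n f
    unfolding \<Theta>_def
  proof (rule the_equality)
    fix a assume "\<exists>f'\<in>free_lt (Suc n). ?gr n f = ?gr n f' \<and> a = symb n f'"
    thus "a = symb n f" using eq that by (auto simp: gr_class_eq_iff)
  qed (use that in auto)
  have space: "f \<in> free_space" if "f \<in> free_lt n" for f n using that free_lt_subset by auto
  show ?thesis
    unfolding PBW_def
  proof (intro exI[of _ \<Theta>] conjI allI ballI)
    fix n
    have "inj_on (\<Theta> n) (gr_class lam kap n ` H_filt lam kap n)"
      by (rule inj_onI) (clarsimp simp: H_filt_cls \<Theta> gr_class_eq_iff eq)
    moreover have "\<Theta> n ` gr_class lam kap n ` H_filt lam kap n = skew_homog n"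
    proof (intro equalityI subsetI)
      fix a assume a: "a \<in> skew_homog n"
      hence "a = \<Theta> n (?gr n (nf a))" by (simp add: \<Theta> nf_lt symb_nf)
      thus "a \<in> \<Theta> n ` gr_class lam kap n ` H_filt lam kap n"
        unfolding H_filt_cls using nf_lt[OF a] by blast
    qed (auto simp: H_filt_cls \<Theta> symb_homog)
    ultimately show "bij_betw (\<Theta> n) (gr_class lam kap n ` H_filt lam kap n) (skew_homog n)"
      by (simp add: bij_betw_def)
  next
    fix n x y assume "x \<in> H_filt lam kap n" "y \<in> H_filt lam kap n"
    thus "\<Theta> n (gr_class lam kap n (x \<oplus>\<^bsub>H\<^esub> y)) = \<Theta> n (gr_class lam kap n x) + \<Theta> n (gr_class lam kap n y)"
      by (auto simp: H_filt_cls H_add \<Theta> symb_simps pm.subspace_add[OF subspace_free_lt])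
  next
    fix n c x assume "x \<in> H_filt lam kap n"
    thus "\<Theta> n (gr_class lam kap n (H_scale lam kap c x)) = pscale c (\<Theta> n (gr_class lam kap n x))"
      by (auto simp: H_filt_cls H_scale_cls space \<Theta> symb_simps pm.subspace_scale[OF subspace_free_lt])
  next
    fix m n x y assume "x \<in> H_filt lam kap m" "y \<in> H_filt lam kap n"
    then obtain f f' where f: "f \<in> free_lt (Suc m)" "x = cls f" "f' \<in> free_lt (Suc n)" "y = cls f'"
      by (auto simp: H_filt_cls)
    have "f \<odot> f' \<in> free_lt (Suc (m + n))" using fm_lt[OF f(1,3)] by simp
    thus "\<Theta> (m + n) (gr_class lam kap (m + n) (x \<otimes>\<^bsub>H\<^esub> y)) =
        \<Theta> m (gr_class lam kap m x) \<star> \<Theta> n (gr_class lam kap n y)"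
      using f by (simp add: H_mult space \<Theta> symb_mult)
  next
    have "bvec [] \<in> free_lt (Suc 0)" by (simp add: free_lt_def word_deg_def)
    thus "\<Theta> 0 (gr_class lam kap 0 \<one>\<^bsub>H\<^esub>) = one_skew"
      by (simp add: H_one \<Theta> symb_bvec word_deg_def)
  qed
qed

end

context skew_setup
begin

subsection \<open>Words with group elements on the right\<close>

definition word_span :: "nat \<Rightarrow> ('g, 'k) word_alg set" where
  "word_span n = pspan {(w, g). set w \<subseteq> {..<length vs} \<and> length w \<le> n}"

text \<open>B enters only through its left regular representation; this is left multiplication by
  \<open>v\<close>, and \<open>prefix_op\<close> is left multiplication by a word in basis
  vectors.\<close>

definition vop :: "'v \<Rightarrow> ('g, 'k) word_alg \<Rightarrow> ('g, 'k) word_alg" where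
  "vop v = lext (\<lambda>(w, h). \<Sum>j<length vs. single (j # w, h) (coord v j))"

definition prefix_op :: "nat list \<Rightarrow> ('g, 'k) word_alg \<Rightarrow> ('g, 'k) word_alg" where
  "prefix_op p = lext (\<lambda>(w, h). bvec (p @ w, h))"

lemma subspace_word_span: "pm.subspace (word_span n)"
  by (simp add: word_span_def subspace_pspan)

lemma word_span_mono: "m \<le> n \<Longrightarrow> word_span m \<subseteq> word_span n"
  unfolding word_span_def by (rule pspan_mono) auto

lemma lin_vop: "lin s F \<Longrightarrow> lin s (\<lambda>x. vop v (F x))"
  unfolding vop_def by (rule lin_lext)

lemma lin_vop_vec: "lin scale (\<lambda>v. vop v x)"
  unfolding vop_def
  by (intro lin_lext2 lin_case_prod lin_sum lin_single vector_space_scale) (simp_all add: coord_add coord_scale)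

lemmas vop_simps = linearD(2-7)[OF lin_vop[OF lin_id]]
lemmas vop_vec_simps = linearD(2-7)[OF lin_vop_vec]

lemma vop_vs: "i < length vs \<Longrightarrow> vop (vs ! i) (bvec (w, h)) = bvec (i # w, h)"
proof -
  assume i: "i < length vs"
  have "(\<Sum>j<length vs. single (j # w, h) (coord (vs ! i) j))
      = (\<Sum>j<length vs. if i = j then bvec (j # w, h) else 0)"
    using i by (intro sum.cong) (auto simp: coord_vs)
  thus ?thesis using i by (simp add: vop_def)
qed

lemma vop_word_span: "x \<in> word_span n \<Longrightarrow> vop v x \<in> word_span (Suc n)"
  unfolding vop_def
  by (rule lext_mem[OF subspace_word_span, of "{(w, g). set w \<subseteq> {..<length vs} \<and> length w \<le> n}"])
    (auto simp: word_span_def intro!: pspan_sum single_in_pspan)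

lemma lin_prefix_op:
  "lin s F \<Longrightarrow> lin s (\<lambda>x. prefix_op p (F x))"
  unfolding prefix_op_def by (rule lin_lext)

lemmas prefix_op_simps = linearD(2-7)[OF lin_prefix_op[OF lin_id]]

lemma prefix_op_bvec [simp]: "prefix_op p (bvec (w, h)) = bvec (p @ w, h)"
  by (simp add: prefix_op_def)

lemma prefix_op_prefix_op: "prefix_op p (prefix_op q x) = prefix_op (p @ q) x"
  by (rule lin_eqI[where f = "\<lambda>x. prefix_op p (prefix_op q x)"])
    (auto intro!: lin_prefix_op lin_id)

lemma prefix_op_Nil [simp]: "prefix_op [] x = x"
  by (rule lin_eqI[where f = "\<lambda>x. prefix_op [] x"]) (auto intro!: lin_prefix_op lin_id)

lemma vop_vs': "i < length vs \<Longrightarrow> vop (vs ! i) x = prefix_op [i] x"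
  by (rule lin_eqI[where f = "\<lambda>x. vop (vs ! i) x"]) (auto intro!: lin_prefix_op lin_vop lin_id simp: vop_vs)

lemma vop_expand: "vop v x = (\<Sum>i<length vs. pscale (coord v i) (prefix_op [i] x))"
  using lin_vec_expand[OF lin_vop_vec, of v x] by (simp add: vop_vs')

lemma prefix_op_word_span:
  "set p \<subseteq> {..<length vs} \<Longrightarrow> x \<in> word_span n \<Longrightarrow> prefix_op p x \<in> word_span (length p + n)"
  unfolding prefix_op_def
  by (rule lext_mem[OF subspace_word_span, of "{(w, g). set w \<subseteq> {..<length vs} \<and> length w \<le> n}"])
    (auto simp: word_span_def)

end

context pbw_data
begin

text \<open>\<open>grp_act w g h\<close> is the product \<open>g w h\<close> with \<open>g\<close> moved past \<open>w\<close> by the relation for \<open>gv\<close>.\<close>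

primrec grp_act :: "nat list \<Rightarrow> 'g \<Rightarrow> 'g \<Rightarrow> ('g, 'k) word_alg" where
  "grp_act [] g h = bvec ([], g + h)"
| "grp_act (i # w) g h =
     vop (act g (vs ! i)) (grp_act w g h) + lext (\<lambda>g'. grp_act w g' h) (lam (bvec g) (vs ! i))"

definition gop :: "'g \<Rightarrow> ('g, 'k) word_alg \<Rightarrow> ('g, 'k) word_alg" where
  "gop g = lext (\<lambda>(w, h). grp_act w g h)"

definition aop :: "('g \<Rightarrow>\<^sub>0 'k) \<Rightarrow> ('g, 'k) word_alg \<Rightarrow> ('g, 'k) word_alg" where
  "aop a x = lext (\<lambda>g. gop g x) a"

lemma lin_gop: "lin s F \<Longrightarrow> lin s (\<lambda>x. gop g (F x))"
  unfolding gop_def by (rule lin_lext)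

lemma lin_aop:
  assumes "lin s F"
  shows "lin s (\<lambda>x. aop a (F x))"
  unfolding aop_def by (intro lin_lext2 lin_gop assms linearD(1)[OF assms])

lemma lin_aop1: "lin s F \<Longrightarrow> lin s (\<lambda>a. aop (F a) x)"
  unfolding aop_def by (rule lin_lext)

lemmas gop_simps = linearD(2-7)[OF lin_gop[OF lin_id]]
lemmas aop_simps = linearD(2-7)[OF lin_aop[OF lin_id]]
lemmas aop_simps1 = linearD(2-7)[OF lin_aop1[OF lin_id]]

lemma aop_bvec [simp]: "aop (bvec g) x = gop g x"
  by (simp add: aop_def)

lemma gop_vop: "gop g (vop v x) = vop (act g v) (gop g x) + aop (lam (bvec g) v) x"
proof (rule lin_vec_eqI[where F = "\<lambda>v. gop g (vop v x)"])
  fix i assume i: "i < length vs"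
  show "gop g (vop (vs ! i) x) = vop (act g (vs ! i)) (gop g x) + aop (lam (bvec g) (vs ! i)) x"
  proof (rule lin_eqI[where f = "\<lambda>x. gop g (vop (vs ! i) x)"])
    fix p :: "nat list \<times> 'g"
    obtain w h where p: "p = (w, h)" by (cases p)
    show "gop g (vop (vs ! i) (bvec p)) = vop (act g (vs ! i)) (gop g (bvec p)) + aop (lam (bvec g) (vs ! i)) (bvec p)"
      unfolding p vop_vs[OF i] by (simp add: gop_def aop_def)
  qed (intro lin_gop lin_vop lin_aop lin_intros_mult)+
qed (intro lin_gop lin_vop_vec lin_act lin_aop1 lam_linear2 lin_add)+

lemma aop_vop: "aop a (vop v x) = lext (\<lambda>h. vop (act h v) (gop h x)) a + aop (lam a v) x"
  by (rule lin_eqI[where f = "\<lambda>a. aop a (vop v x)"])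
    (auto intro!: lin_aop1 lin_lam1 lin_intros_mult simp: gop_vop)

lemma vop_aop: "vop u (aop a x) = lext (\<lambda>h. vop u (gop h x)) a"
  by (rule lin_eqI[where f = "\<lambda>a. vop u (aop a x)"]) (auto intro!: lin_aop1 lin_vop lin_intros_mult)

text \<open>Collecting the terms at each group element, with the scalar moved into the vector, lets
  identities in V for fixed h be applied term by term.\<close>

lemma lext_vop_gop:
  "lext (\<lambda>h. vop (f h) (gop h x)) a = (\<Sum>h\<in>UNIV. vop (scale (lookup a h) (f h)) (gop h x))"
  by (subst lext_superset[of UNIV]) (auto simp: vop_vec_simps)

lemma grp_act_word_span: "set w \<subseteq> {..<length vs} \<Longrightarrow> grp_act w g h \<in> word_span (length w)"
proof (induction w arbitrary: g)
  case (Cons i w)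
  hence IH: "grp_act w g h \<in> word_span (length w)" for g by simp
  have "lext (\<lambda>g'. grp_act w g' h) a \<in> word_span (length w)" for a
    by (rule lext_mem[OF subspace_word_span, of UNIV]) (auto intro: IH)
  thus ?case using vop_word_span[OF IH, of "act g (vs ! i)" g] word_span_mono[of "length w" "Suc (length w)"]
    by (auto intro!: pm.subspace_add[OF subspace_word_span])
qed (simp add: word_span_def)

lemma gop_word_span:
  assumes "x \<in> word_span n"
  shows "gop g x \<in> word_span n"
  unfolding gop_def
proof (rule lext_mem[OF subspace_word_span _ assms[unfolded word_span_def]])
  fix p :: "nat list \<times> 'g"
  assume "p \<in> {(w, g). set w \<subseteq> {..<length vs} \<and> length w \<le> n}"
  then obtain w h where p: "p = (w, h)" "set w \<subseteq> {..<length vs}" "length w \<le> n" by auto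
  show "(case p of (w, h) \<Rightarrow> grp_act w g h) \<in> word_span n"
    using grp_act_word_span[OF p(2)] word_span_mono[OF p(3)] by (auto simp: p(1))
qed

lemma aop_word_span: "x \<in> word_span n \<Longrightarrow> aop a x \<in> word_span n"
  unfolding aop_def by (rule lext_mem[OF subspace_word_span, of UNIV]) (auto intro: gop_word_span)

text \<open>Left multiplication in B by the relator uv - vu - \<kappa>(u, v).\<close>

definition rop :: "'v \<Rightarrow> 'v \<Rightarrow> ('g, 'k) word_alg \<Rightarrow> ('g, 'k) word_alg" where
  "rop u v x = vop u (vop v x) - vop v (vop u x) - aop (kap u v) x"

lemma lin_rop: "lin s F \<Longrightarrow> lin s (\<lambda>x. rop u v (F x))"
  unfolding rop_def by (intro lin_intros_mult lin_vop lin_aop)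

lemma lin_rop1: "lin scale (\<lambda>u. rop u v x)"
  unfolding rop_def by (intro lin_intros_mult lin_vop lin_vop_vec lin_aop1 kap_linear1)

lemma lin_rop2: "lin scale (\<lambda>v. rop u v x)"
  unfolding rop_def by (intro lin_intros_mult lin_vop lin_vop_vec lin_aop1 kap_linear2)


lemma rop_anti: "rop u v x = - rop v u x"
  unfolding rop_def kap_anti[of u v] by (simp add: aop_simps1)

lemma rop_self [simp]: "rop v v x = 0"
  by (simp add: rop_def aop_simps1)

subsection \<open>The span of the commutator relations\<close>

text \<open>A quadruple marks a descent j > i in the word p j i s. A word with several descents has
  several indices.\<close>

definition crel_idx :: "(nat list \<times> nat \<times> nat \<times> nat list) set" where
  "crel_idx = {(p, j, i, s). i < j \<and> j < length vs \<and> set p \<subseteq> {..<length vs} \<and> set s \<subseteq> {..<length vs}}"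

definition crel_lead :: "nat list \<times> nat \<times> nat \<times> nat list \<Rightarrow> nat list" where
  "crel_lead = (\<lambda>(p, j, i, s). p @ j # i # s)"

text \<open>In B this is the product of the word p, the relator of the pair v_j, v_i, the word s and
  g.\<close>

definition crel :: "nat list \<times> nat \<times> nat \<times> nat list \<Rightarrow> 'g \<Rightarrow> ('g, 'k) word_alg" where
  "crel = (\<lambda>(p, j, i, s) g. prefix_op p (rop (vs ! j) (vs ! i) (bvec (s, g))))"

text \<open>The set \<open>W\<close> limits the leading words: by length for the operators, by the
  order on words for the resolution of ambiguities.\<close>

definition crel_span :: "nat list set \<Rightarrow> ('g, 'k) word_alg set" where
  "crel_span W = pm.span {crel q g | q g. q \<in> crel_idx \<and> crel_lead q \<in> W}"

abbreviation "crel_le n \<equiv> crel_span {w. length w \<le> n}"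

lemma subspace_crel_span: "pm.subspace (crel_span W)"
  by (simp add: crel_span_def)

lemmas crel_span_closed = pm.subspace_0[OF subspace_crel_span] pm.subspace_add[OF subspace_crel_span]
  pm.subspace_diff[OF subspace_crel_span] pm.subspace_neg[OF subspace_crel_span]
  pm.subspace_scale[OF subspace_crel_span] pm.subspace_sum[OF subspace_crel_span]

lemma crel_span_base: "q \<in> crel_idx \<Longrightarrow> crel_lead q \<in> W \<Longrightarrow> crel q g \<in> crel_span W"
  unfolding crel_span_def by (rule pm.span_base) blast

lemma crel_span_mono: "W \<subseteq> W' \<Longrightarrow> crel_span W \<subseteq> crel_span W'"
  unfolding crel_span_def by (intro pm.span_mono) blast

lemma crel_span_maps:
  assumes "x \<in> crel_span W" "lin pscale f" "pm.subspace U"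
    and "\<And>q g. q \<in> crel_idx \<Longrightarrow> crel_lead q \<in> W \<Longrightarrow> f (crel q g) \<in> U"
  shows "f x \<in> U"
proof -
  have sub: "pm.subspace {x. f x \<in> U}"
    using assms(3) by (auto simp: pm.subspace_def linearD[OF assms(2)])
  show ?thesis
    using assms(1) unfolding crel_span_def
    by (rule pm.span_induct) (use sub assms(4) in auto)
qed

lemma prefix_op_crel_span:
  assumes "x \<in> crel_le n" "set p \<subseteq> {..<length vs}"
  shows "prefix_op p x \<in> crel_le (length p + n)"
proof (rule crel_span_maps[OF assms(1) _ subspace_crel_span])
  fix q :: "nat list \<times> nat \<times> nat \<times> nat list" and g
  obtain p' j i s where q: "q = (p', j, i, s)" by (cases q)
  assume "q \<in> crel_idx" "crel_lead q \<in> {w. length w \<le> n}"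
  hence "crel (p @ p', j, i, s) g \<in> crel_le (length p + n)"
    using assms(2) by (intro crel_span_base) (auto simp: crel_idx_def crel_lead_def q)
  thus "prefix_op p (crel q g) \<in> crel_le (length p + n)"
    by (simp add: crel_def q prefix_op_prefix_op)
qed (intro lin_prefix_op lin_id)

lemma vop_crel_span: "x \<in> crel_le n \<Longrightarrow> vop v x \<in> crel_le (Suc n)"
  unfolding vop_expand using prefix_op_crel_span[of x n "[i]" for i]
  by (intro crel_span_closed) auto

text \<open>The generators contain only relators of descents j > i. Since \<open>rop\<close> is
  bilinear, and alternating because \<open>kap\<close> is, these account for all vectors.\<close>

lemma rop_crel_span:
  assumes "y \<in> word_span n"
  shows "rop u v y \<in> crel_le (n + 2)"
proof (rule lin_maps_pspan[where f = "\<lambda>y. rop u v y", OF _ subspace_crel_span _ assms[unfolded word_span_def]])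
  fix p :: "nat list \<times> 'g"
  assume "p \<in> {(w, g). set w \<subseteq> {..<length vs} \<and> length w \<le> n}"
  then obtain w g where p: "p = (w, g)" "set w \<subseteq> {..<length vs}" "length w \<le> n" by auto
  have lt: "rop (vs ! j) (vs ! i) (bvec p) \<in> crel_le (n + 2)" if "i < j" "j < length vs" for i j
    using crel_span_base[of "([], j, i, w)" "{w. length w \<le> n + 2}" g] that p
    by (simp add: crel_idx_def crel_lead_def crel_def)
  have "rop (vs ! j) (vs ! i) (bvec p) \<in> crel_le (n + 2)" if "j < length vs" "i < length vs" for i j
    using that lt[of i j] crel_span_closed(4)[OF lt[of j i]] rop_anti[of "vs ! i" "vs ! j"]
    by (cases i j rule: linorder_cases) (auto simp: crel_span_closed)
  thus "rop u v (bvec p) \<in> crel_le (n + 2)"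
    unfolding lin_vec_expand[OF lin_rop1, of u] lin_vec_expand[OF lin_rop2, of _ v]
    by (intro crel_span_closed) auto
qed (intro lin_rop lin_id)

end

section \<open>Operator identities on B under the five conditions\<close>

locale pbw_cond = pbw_data scale vs act lam kap
  for scale :: "'k::field \<Rightarrow> 'v::ab_group_add \<Rightarrow> 'v" and vs :: "'v list"
    and act :: "'g::{group_add, finite} \<Rightarrow> 'v \<Rightarrow> 'v"
    and lam :: "('g \<Rightarrow>\<^sub>0 'k) \<Rightarrow> 'v \<Rightarrow> ('g \<Rightarrow>\<^sub>0 'k)"
    and kap :: "'v \<Rightarrow> 'v \<Rightarrow> ('g \<Rightarrow>\<^sub>0 'k)" +
  assumes mult_cond: mult_cond and kap_cond: kap_cond and lam_cond: lam_cond
    and jac_vec_cond: jac_vec_cond and jac_grp_cond: jac_grp_cond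
begin

lemmas cond_mult = mult_cond[unfolded mult_cond_def, rule_format]
lemmas cond_kap = kap_cond[unfolded kap_cond_def, rule_format]
lemmas cond_lam = lam_cond[unfolded lam_cond_def, rule_format]
lemmas cond_jac_vec = jac_vec_cond[unfolded jac_vec_cond_def, rule_format]
lemmas cond_jac_grp = jac_grp_cond[unfolded jac_grp_cond_def, rule_format]


text \<open>Associativity at \<open>y\<close> is an explicit hypothesis because the lemma is needed
  inside the induction that establishes associativity.\<close>

lemma aop_gop_gen:
  assumes "\<And>g h. gop g (gop h y) = gop (g + h) y"
  shows "aop a (gop h y) = aop (a * bvec h) y"
  by (rule lin_eqI[where f = "\<lambda>a. aop a (gop h y)"])
    (auto intro!: lin_aop1 lin_intros_mult simp: mult_single assms)

lemma gop_aop_gen: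
  assumes "\<And>g h. gop g (gop h y) = gop (g + h) y"
  shows "gop g (aop a y) = aop (bvec g * a) y"
  by (rule lin_eqI[where f = "\<lambda>a. gop g (aop a y)"])
    (auto intro!: lin_aop1 lin_gop lin_intros_mult simp: mult_single assms)

text \<open>Induction on the word. Moving h and then g past the first vector produces the two
  summands on the right of \<open>cond_mult\<close>; moving gh past it produces the left
  side.\<close>

lemma gop_gop:
  assumes "x \<in> word_span n"
  shows "gop g (gop h x) = gop (g + h) x"
proof (rule lin_eq_on_pspan[OF _ _ _ assms[unfolded word_span_def]])
  fix p :: "nat list \<times> 'g"
  assume "p \<in> {(w, g). set w \<subseteq> {..<length vs} \<and> length w \<le> n}"
  then obtain w l where p: "p = (w, l)" "set w \<subseteq> {..<length vs}" by auto
  have "gop g (gop h (bvec (w, l))) = gop (g + h) (bvec (w, l))"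
    using p(2)
  proof (induction w arbitrary: g h)
    case Nil
    show ?case by (simp add: gop_def add.assoc)
  next
    case (Cons i w)
    let ?y = "bvec (w, l)" and ?v = "vs ! i"
    have IH: "gop g (gop h ?y) = gop (g + h) ?y" for g h using Cons by simp
    have "bvec (i # w, l) = vop ?v ?y" using Cons.prems by (simp add: vop_vs)
    moreover have "gop g (gop h (vop ?v ?y)) = gop (g + h) (vop ?v ?y)"
      unfolding gop_vop gop_simps(1) cond_mult aop_simps1(1)
        IH aop_gop_gen[OF IH] gop_aop_gen[OF IH] act_mult by simp
    ultimately show ?case by simp
  qed
  thus "gop g (gop h (bvec p)) = gop (g + h) (bvec p)" by (simp add: p)
qed (intro lin_gop lin_id)+

lemma gop_zero:
  assumes "x \<in> word_span n"
  shows "gop 0 x = x"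
proof (rule lin_eq_on_pspan[where f = "\<lambda>x. gop 0 x", OF _ _ _ assms[unfolded word_span_def]])
  fix p :: "nat list \<times> 'g"
  assume "p \<in> {(w, g). set w \<subseteq> {..<length vs} \<and> length w \<le> n}"
  then obtain w l where p: "p = (w, l)" "set w \<subseteq> {..<length vs}" by auto
  \<comment> \<open>At the neutral element \<open>cond_mult\<close> reads lam(1, v) = lam(1, v) +
    lam(1, v).\<close>
  have lam0: "lam 1 v = 0" for v using cond_mult[of 0 0 v] by (simp add: act_one)
  have "gop 0 (bvec (w, l)) = bvec (w, l)"
    using p(2)
  proof (induction w)
    case (Cons i w)
    have "bvec (i # w, l) = vop (vs ! i) (bvec (w, l))" using Cons.prems by (simp add: vop_vs)
    thus ?case using Cons by (simp add: gop_vop act_one lam0 aop_simps1)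
  qed (simp add: gop_def)
  thus "gop 0 (bvec p) = bvec p" by (simp add: p)
qed (intro lin_gop lin_id)+

text \<open>The relators are permuted by G. Passing g through uv and vu leaves terms with one
  vector, which cancel by \<open>cond_lam\<close>, and terms without vectors, which match the two
  \<open>kap\<close> terms by \<open>cond_kap\<close>.\<close>

lemma gop_rop:
  assumes x: "x \<in> word_span n"
  shows "gop g (rop u v x) = rop (act g u) (act g v) (gop g x)"
proof -
  let ?S = "\<lambda>f. \<Sum>h\<in>UNIV. vop (f h) (gop h x)" and ?l = "\<lambda>v h. lookup (lam (bvec g) v) h"
  have A: "gop g (vop u (vop v x)) = vop (act g u) (vop (act g v) (gop g x))
      + ?S (\<lambda>h. scale (?l v h) (act g u)) + ?S (\<lambda>h. scale (?l u h) (act h v))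
      + aop (lam (lam (bvec g) u) v) x" for u v
    by (simp add: gop_vop aop_vop vop_simps vop_aop lext_vop_gop)
  have "?S (\<lambda>h. scale (?l v h) (act g u)) + ?S (\<lambda>h. scale (?l u h) (act h v))
      - ?S (\<lambda>h. scale (?l u h) (act g v)) - ?S (\<lambda>h. scale (?l v h) (act h u))
    = ?S (\<lambda>h. scale (?l u h) (act h v - act g v) - scale (?l v h) (act h u - act g u))"
    by (simp add: vop_vec_simps sum.distrib[symmetric] sum_subtractf[symmetric]
        scale_right_diff_distrib pm.scale_right_diff_distrib algebra_simps)
  also have "\<dots> = 0" by (simp add: cond_lam[of g v] vop_vec_simps)
  finally have B: "?S (\<lambda>h. scale (?l v h) (act g u)) + ?S (\<lambda>h. scale (?l u h) (act h v))
      - ?S (\<lambda>h. scale (?l u h) (act g v)) - ?S (\<lambda>h. scale (?l v h) (act h u)) = 0" .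
  have "aop (bvec g * kap u v - kap (act g u) (act g v) * bvec g) x
      = aop (lam (lam (bvec g) u) v) x - aop (lam (lam (bvec g) v) u) x"
    unfolding cond_kap by (simp add: aop_simps1)
  moreover have "gop g (aop (kap u v) x) = aop (bvec g * kap u v) x"
    "aop (kap (act g u) (act g v)) (gop g x) = aop (kap (act g u) (act g v) * bvec g) x"
    by (rule gop_aop_gen aop_gop_gen, rule gop_gop[OF x])+
  ultimately have C: "gop g (aop (kap u v) x) - aop (kap (act g u) (act g v)) (gop g x)
      = aop (lam (lam (bvec g) u) v) x - aop (lam (lam (bvec g) v) u) x"
    by (simp add: aop_simps1)
  show ?thesis
    using B C unfolding rop_def gop_simps A by (simp add: algebra_simps)
qed

text \<open>A commutator of \<open>u\<close> with an element a of kG is minus the sum of a_h (hu -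
  u) h, minus lam(a, u). The cyclic sum of the first parts vanishes by \<open>cond_jac_vec\<close>,
  that of the second by \<open>cond_jac_grp\<close>.\<close>

lemma jacobi:
  "vop u (aop (kap v w) x) - aop (kap v w) (vop u x) + (vop v (aop (kap w u) x) - aop (kap w u) (vop v x))
    + (vop w (aop (kap u v) x) - aop (kap u v) (vop w x)) = 0"
proof -
  let ?S = "\<lambda>f. \<Sum>h\<in>UNIV. vop (f h) (gop h x)" and ?k = "\<lambda>u v h. lookup (kap u v) h"
  have A: "vop u (aop (kap v w) x) - aop (kap v w) (vop u x)
      = - ?S (\<lambda>h. scale (?k v w h) (act h u - u)) - aop (lam (kap v w) u) x" for u v w
    by (simp add: aop_vop vop_aop lext_vop_gop vop_vec_simps sum_subtractf
        scale_right_diff_distrib pm.scale_right_diff_distrib)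
  have "?S (\<lambda>h. scale (?k u v h) (act h w - w)) + ?S (\<lambda>h. scale (?k v w h) (act h u - u))
      + ?S (\<lambda>h. scale (?k w u h) (act h v - v)) = 0"
    by (simp add: cond_jac_vec sum.distrib[symmetric] vop_vec_simps(1)[symmetric] vop_vec_simps(3))
  moreover have "aop (lam (kap u v) w) x + aop (lam (kap v w) u) x + aop (lam (kap w u) v) x = 0"
    by (simp add: aop_simps1(1)[symmetric] cond_jac_grp aop_simps1(3))
  moreover have "- b - e + (- c - f) + (- a - d) = 0" if "a + b + c = 0" "d + e + f = 0"
    for a b c d e f :: "('g, 'k) word_alg"
  proof -
    have "- b - e + (- c - f) + (- a - d) = - (a + b + c) - (d + e + f)" by (simp add: algebra_simps)
    thus ?thesis using that by simp
  qed
  ultimately show ?thesis unfolding A by blast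
qed

text \<open>Induction on the prefix: passing its first vector leaves a group element before a
  shorter prefix, until \<open>gop_rop\<close> applies at the relator. As gv may involve every basis
  vector, leading words are not preserved and only their length is bounded.\<close>

lemma gop_crel_span:
  assumes "x \<in> crel_le n"
  shows "gop g x \<in> crel_le n"
proof (rule crel_span_maps[OF assms _ subspace_crel_span])
  fix q :: "nat list \<times> nat \<times> nat \<times> nat list" and l :: 'g
  obtain p j i s where q: "q = (p, j, i, s)" by (cases q)
  assume qi: "q \<in> crel_idx" and n: "crel_lead q \<in> {w. length w \<le> n}"
  have "gop g (crel (p, j, i, s) l) \<in> crel_le (length p + length s + 2)"
    using qi unfolding q
  proof (induction p arbitrary: g)
    case Nil
    have s: "bvec (s, l) \<in> word_span (length s)" using Nil by (simp add: word_span_def crel_idx_def)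
    show ?case
      using rop_crel_span[OF gop_word_span[OF s, of g], of "act g (vs ! j)" "act g (vs ! i)"]
      by (simp add: crel_def gop_rop[OF s])
  next
    case (Cons a p)
    have IH: "gop g (crel (p, j, i, s) l) \<in> crel_le (length p + length s + 2)" for g
      using Cons by (simp add: crel_idx_def)
    have a: "a < length vs" using Cons.prems by (simp add: crel_idx_def)
    have "crel (a # p, j, i, s) l = vop (vs ! a) (crel (p, j, i, s) l)"
      by (simp add: crel_def vop_vs'[OF a] prefix_op_prefix_op)
    hence "gop g (crel (a # p, j, i, s) l) = vop (act g (vs ! a)) (gop g (crel (p, j, i, s) l))
        + aop (lam (bvec g) (vs ! a)) (crel (p, j, i, s) l)"
      by (simp add: gop_vop)
    moreover have "aop (lam (bvec g) (vs ! a)) (crel (p, j, i, s) l) \<in> crel_le (length p + length s + 2)"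
      unfolding aop_def by (rule lext_mem[OF subspace_crel_span, of UNIV]) (use IH in auto)
    hence "aop (lam (bvec g) (vs ! a)) (crel (p, j, i, s) l) \<in> crel_le (Suc (length p + length s + 2))"
      by (rule subsetD[OF crel_span_mono, rotated]) auto
    ultimately show ?case
      using vop_crel_span[OF IH, of "act g (vs ! a)" g] by (auto intro: crel_span_closed(2))
  qed
  thus "gop g (crel q l) \<in> crel_le n"
    using n by (auto simp: q crel_lead_def elim!: subsetD[OF crel_span_mono, rotated])
qed (intro lin_gop lin_id)

lemma aop_crel_span: "x \<in> crel_le n \<Longrightarrow> aop a x \<in> crel_le n"
  unfolding aop_def by (rule lext_mem[OF subspace_crel_span, of UNIV]) (auto intro: gop_crel_span)

end

text \<open>Coefficients are attached to the indices of the family, so that an extremal index with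
  nonzero coefficient can be singled out later.\<close>

lemma span_image_bvec:
  fixes f :: "'x \<Rightarrow> ('y \<Rightarrow>\<^sub>0 'k::field)"
  assumes "x \<in> pm.span (f ` S)"
  shows "\<exists>a\<in>pspan S. x = lext f a"
  using assms
proof (induction rule: pm.span_induct)
  case base
  show ?case
    unfolding pm.subspace_def
  proof (intro conjI ballI allI CollectI; (elim CollectE bexE)?)
    show "\<exists>a\<in>pspan S. 0 = lext f a" by (rule bexI[of _ 0]) auto
  next
    fix x y a b assume "a \<in> pspan S" "x = lext f a" "b \<in> pspan S" "y = lext f b"
    thus "\<exists>a\<in>pspan S. x + y = lext f a" by (intro bexI[of _ "a + b"]) (auto simp: lext_add pspan_add)
  next
    fix c x a assume "a \<in> pspan S" "x = lext f a"
    thus "\<exists>a\<in>pspan S. pscale c x = lext f a"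
      by (intro bexI[of _ "pscale c a"]) (auto simp: lext_pscale pspan_scale)
  qed
next
  case (step x)
  then obtain p where "p \<in> S" "x = f p" by auto
  thus ?case by (intro bexI[of _ "bvec p"]) auto
qed

context pbw_cond
begin

subsection \<open>Resolving ambiguities\<close>

text \<open>The degree-lexicographic order. Length comes first, so that the terms with
  \<open>kap\<close>, which shorten a word, always lie below it.\<close>

abbreviation "below W \<equiv> {w. (w, W) \<in> lenlex less_than}"

lemma below_shorter: "n < length W \<Longrightarrow> crel_le n \<subseteq> crel_span (below W)"
  by (rule crel_span_mono) (auto simp: lenlex_conv)

lemma append_lenlex_iff: "(p @ u, p @ w) \<in> lenlex less_than \<longleftrightarrow> (u, w) \<in> lenlex less_than"
  by (rule lenlex_append2) (simp add: irrefl_def)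

lemma crel_Cons:
  "i < length vs \<Longrightarrow> crel (p, k, j, i # s) g
    = prefix_op p (rop (vs ! k) (vs ! j) (vop (vs ! i) (bvec (s, g))))"
  by (simp add: crel_def vop_vs)

lemma crel_snoc:
  "i < length vs \<Longrightarrow> crel (p @ [i], k, j, s) g
    = prefix_op p (vop (vs ! i) (rop (vs ! k) (vs ! j) (bvec (s, g))))"
  by (simp add: crel_def vop_vs' prefix_op_prefix_op)

text \<open>With r_ab the relator of v_a and v_b: r_kj v_i - v_k r_ji = r_ki v_j - v_j r_ki + v_i
  r_kj - r_ji v_k. The cubic terms agree as in the Jacobi identity for commutators, the others by
  \<open>jacobi\<close>. The leading words on the right are kij, jki, ikj and jik, all below
  kji.\<close>

lemma overlap_resolved:
  assumes ijk: "i < j" "j < k" "k < length vs" and ps: "set p \<subseteq> {..<length vs}" "set s \<subseteq> {..<length vs}"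
  shows "crel (p, k, j, i # s) g - crel (p @ [k], j, i, s) g \<in> crel_span (below (p @ k # j # i # s))"
proof -
  let ?X = "\<lambda>a. vop (vs ! a)" and ?R = "\<lambda>a b. rop (vs ! a) (vs ! b)" and ?y = "bvec (s, g)"
  \<comment> \<open>The relators carry \<open>kap\<close> with the larger index first; taking
    \<open>jacobi\<close> at v_i, v_k, v_j leaves only the pair (i, k) to be reversed.\<close>
  have J: "?X i (aop (kap (vs ! k) (vs ! j)) ?y) - aop (kap (vs ! k) (vs ! j)) (?X i ?y)
    + (?X k (aop (kap (vs ! j) (vs ! i)) ?y) - aop (kap (vs ! j) (vs ! i)) (?X k ?y))
    = ?X j (aop (kap (vs ! k) (vs ! i)) ?y) - aop (kap (vs ! k) (vs ! i)) (?X j ?y)"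
    using jacobi[of "vs ! i" "vs ! k" "vs ! j" ?y] unfolding kap_anti[of "vs ! i" "vs ! k"]
    by (simp add: aop_simps1 vop_simps algebra_simps)
  have "?R k j (?X i ?y) - ?X k (?R j i ?y)
      = ?R k i (?X j ?y) - ?X j (?R k i ?y) + ?X i (?R k j ?y) - ?R j i (?X k ?y)"
    using J by (simp add: rop_def vop_simps algebra_simps)
  hence "crel (p, k, j, i # s) g - crel (p @ [k], j, i, s) g
      = crel (p, k, i, j # s) g - crel (p @ [j], k, i, s) g + crel (p @ [i], k, j, s) g - crel (p, j, i, k # s) g"
    using ijk by (simp add: crel_Cons crel_snoc prefix_op_simps(1,4)[symmetric])
  also have "\<dots> \<in> crel_span (below (p @ k # j # i # s))"
    using ijk ps by (intro crel_span_closed crel_span_base)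
      (auto simp: crel_idx_def crel_lead_def Cons_lenlex_iff append_lenlex_iff)
  finally show ?thesis .
qed

text \<open>The product r_ji v_q r_lk is expanded at either relator, and the two expansions are
  compared. One remaining term has elements of kG in front of a relator, and there the stability of
  the span under G is essential.\<close>

lemma disjoint_resolved:
  assumes ij: "i < j" "j < length vs" and kl: "k < l" "l < length vs"
    and ps: "set p \<subseteq> {..<length vs}" "set q \<subseteq> {..<length vs}" "set s \<subseteq> {..<length vs}"
  shows "crel (p, j, i, q @ l # k # s) g - crel (p @ j # i # q, l, k, s) g
    \<in> crel_span (below (p @ j # i # q @ l # k # s))"
proof -
  let ?X = "\<lambda>a. vop (vs ! a)" and ?R = "\<lambda>a b. rop (vs ! a) (vs ! b)" and ?y = "bvec (s, g)"
  let ?K = "\<lambda>a b. aop (kap (vs ! a) (vs ! b))" and ?Q = "prefix_op q" and ?W = "p @ j # i # q @ l # k # s"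
  have ik: "i < length vs" "k < length vs" using ij kl by auto
  have lk: "bvec (q @ l # k # s, g) = ?Q (?X l (?X k ?y))" "bvec (q @ k # l # s, g) = ?Q (?X k (?X l ?y))"
    using kl ik by (simp_all add: vop_vs)
  have ji: "prefix_op (p @ j # i # q) x = prefix_op p (?X j (?X i (?Q x)))"
    "prefix_op (p @ i # j # q) x = prefix_op p (?X i (?X j (?Q x)))" for x
    using ij ik by (simp_all add: vop_vs' prefix_op_prefix_op)
  have "?R j i (?Q (?X l (?X k ?y))) - ?X j (?X i (?Q (?R l k ?y)))
      = ?R j i (?Q (?X k (?X l ?y))) + ?R j i (?Q (?K l k ?y)) - ?X i (?X j (?Q (?R l k ?y)))
        - ?K j i (?Q (?R l k ?y))"
    by (simp add: rop_def vop_simps prefix_op_simps aop_simps algebra_simps)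
  hence "crel (p, j, i, q @ l # k # s) g - crel (p @ j # i # q, l, k, s) g
      = crel (p, j, i, q @ k # l # s) g + prefix_op p (?R j i (?Q (?K l k ?y)))
        - crel (p @ i # j # q, l, k, s) g - prefix_op p (?K j i (?Q (?R l k ?y)))"
    by (simp add: crel_def lk ji prefix_op_simps(1,4)[symmetric])
  also have "\<dots> \<in> crel_span (below ?W)"
  proof (intro crel_span_closed(2,3))
    show "crel (p, j, i, q @ k # l # s) g \<in> crel_span (below ?W)"
      "crel (p @ i # j # q, l, k, s) g \<in> crel_span (below ?W)"
      using ij kl ps by (auto intro!: crel_span_base simp: crel_idx_def crel_lead_def Cons_lenlex_iff append_lenlex_iff)
    have y: "?y \<in> word_span (length s)" using ps by (simp add: word_span_def)
    have "prefix_op p (?R j i (?Q (?K l k ?y))) \<in> crel_le (length p + (length q + length s + 2))"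
      by (intro prefix_op_crel_span rop_crel_span prefix_op_word_span aop_word_span y ps)
    thus "prefix_op p (?R j i (?Q (?K l k ?y))) \<in> crel_span (below ?W)"
      by (rule subsetD[OF below_shorter, rotated]) simp
    have "prefix_op p (?K j i (?Q (?R l k ?y))) \<in> crel_le (length p + (length q + (length s + 2)))"
      by (intro prefix_op_crel_span aop_crel_span rop_crel_span y ps)
    thus "prefix_op p (?K j i (?Q (?R l k ?y))) \<in> crel_span (below ?W)"
      by (rule subsetD[OF below_shorter, rotated]) simp
  qed
  finally show ?thesis .
qed

text \<open>Let \<open>r\<close> be what the prefix of the second descent adds to that of the first.
  Length 0 means the same descent, length 1 a common letter, and at least 2 disjoint
  descents.\<close>

lemma ambiguity_resolved_le:
  assumes q: "q \<in> crel_idx" "q' \<in> crel_idx" "crel_lead q = crel_lead q'"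
    and le: "length (fst q) \<le> length (fst q')"
  shows "crel q g - crel q' g \<in> crel_span (below (crel_lead q))"
proof -
  obtain p j i s where qe: "q = (p, j, i, s)" by (cases q)
  obtain p' j' i' s' where qe': "q' = (p', j', i', s')" by (cases q')
  have W: "p @ j # i # s = p' @ j' # i' # s'" using q(3) by (simp add: crel_lead_def qe qe')
  have "length p \<le> length p'" using le by (simp add: qe qe')
  with W obtain r where r: "p' = p @ r" "j # i # s = r @ j' # i' # s'"
    by (auto simp: append_eq_append_conv2)
  consider "r = []" | "r = [j]" | r' where "r = j # i # r'"
    using r(2) by (cases r; cases "tl r") auto
  thus ?thesis
  proof cases
    case 1
    thus ?thesis using r by (simp add: qe qe' crel_span_closed)
  next
    case 2
    thus ?thesis
      using r overlap_resolved[of i' i j p s' g] q(1,2) by (auto simp: qe qe' crel_idx_def crel_lead_def)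
  next
    case 3
    thus ?thesis
      using r disjoint_resolved[of i j i' j' p r' s' g] q(1,2) by (auto simp: qe qe' crel_idx_def crel_lead_def)
  qed
qed

lemma ambiguity_resolved:
  assumes "q \<in> crel_idx" "q' \<in> crel_idx" "crel_lead q = crel_lead q'"
  shows "crel q g - crel q' g \<in> crel_span (below (crel_lead q))"
proof (cases "length (fst q) \<le> length (fst q')")
  case True
  thus ?thesis by (rule ambiguity_resolved_le[OF assms])
next
  case False
  hence "crel q' g - crel q g \<in> crel_span (below (crel_lead q'))"
    by (intro ambiguity_resolved_le) (use assms in auto)
  from crel_span_closed(4)[OF this] show ?thesis by (simp add: assms(3))
qed

definition choose_idx :: "nat list \<Rightarrow> nat list \<times> nat \<times> nat \<times> nat list" where
  "choose_idx W = (SOME q. q \<in> crel_idx \<and> crel_lead q = W)"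

lemma choose_idx:
  assumes "W \<in> crel_lead ` crel_idx"
  shows "choose_idx W \<in> crel_idx" "crel_lead (choose_idx W) = W"
  using someI_ex[of "\<lambda>q. q \<in> crel_idx \<and> crel_lead q = W"] assms by (auto simp: choose_idx_def)

text \<open>Well-founded induction on the leading word: exchanging a relation for the chosen one
  with the same leading word costs only relations with smaller leading words.\<close>

lemma crel_chosen:
  assumes "q \<in> crel_idx"
  shows "crel q g \<in> pm.span ((\<lambda>(W, g). crel (choose_idx W) g) ` (crel_lead ` crel_idx \<times> UNIV))"
    (is "_ \<in> pm.span ?C")
proof -
  have "\<forall>q g. q \<in> crel_idx \<longrightarrow> crel_lead q = W \<longrightarrow> crel q g \<in> pm.span ?C" for W
  proof (induction W rule: wf_induct_rule[OF wf_lenlex[OF wf_less_than]])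
    case (1 W)
    show ?case
    proof (intro allI impI)
      fix q g assume q: "q \<in> crel_idx" "crel_lead q = W"
      hence W: "W \<in> crel_lead ` crel_idx" by auto
      have "crel_span (below W) \<subseteq> pm.span ?C"
        unfolding crel_span_def using 1 by (intro pm.span_minimal) auto
      moreover have "crel q g - crel (choose_idx W) g \<in> crel_span (below W)"
        using ambiguity_resolved[of q "choose_idx W" g] choose_idx[OF W] q by auto
      moreover have "crel (choose_idx W) g \<in> pm.span ?C" using W by (intro pm.span_base) auto
      ultimately have "(crel q g - crel (choose_idx W) g) + crel (choose_idx W) g \<in> pm.span ?C"
        by (intro pm.span_add) auto
      thus "crel q g \<in> pm.span ?C" by simp
    qed
  qed
  thus ?thesis using assms by blast
qed

text \<open>The other terms of a relation lie below its leading word: undoing the descent lowers the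
  word at the same length, and the \<open>kap\<close> part is shorter. At a word not below, only the
  leading coefficient 1 can appear.\<close>

lemma lookup_crel:
  assumes q: "q \<in> crel_idx" and W: "W \<notin> below (crel_lead q)"
  shows "lookup (crel q g) (W, h) = (if crel_lead q = W \<and> g = h then 1 else 0)"
proof -
  obtain p j i s where qe: "q = (p, j, i, s)" by (cases q)
  have ij: "i < j" "j < length vs" "i < length vs" using q by (auto simp: qe crel_idx_def)
  have ps: "set p \<subseteq> {..<length vs}" "set s \<subseteq> {..<length vs}" using q by (auto simp: qe crel_idx_def)
  let ?K = "prefix_op p (aop (kap (vs ! j) (vs ! i)) (bvec (s, g)))"
  have "?K \<in> word_span (length p + length s)"
    using ps by (intro prefix_op_word_span aop_word_span) (auto simp: word_span_def)
  moreover have "length p + length s < length W"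
    using W by (auto simp: qe crel_lead_def lenlex_conv)
  ultimately have "lookup ?K (W, h) = 0"
    by (auto simp: word_span_def pspan_def in_keys_iff)
  moreover have "W \<noteq> p @ i # j # s" using W ij by (auto simp: qe crel_lead_def Cons_lenlex_iff append_lenlex_iff)
  moreover have "crel q g = bvec (p @ j # i # s, g) - bvec (p @ i # j # s, g) - ?K"
    using ij by (simp add: qe crel_def rop_def vop_vs prefix_op_simps)
  ultimately show ?thesis by (auto simp: lookup_minus lookup_single when_def qe crel_lead_def)
qed

lemma crel_lead_not_sorted: "q \<in> crel_idx \<Longrightarrow> \<not> sorted (crel_lead q)"
  by (auto simp: crel_idx_def crel_lead_def sorted_append)

text \<open>The linear form of the diamond lemma: one relation per reducible word suffices, and these
  have distinct leading words.\<close>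

lemma crel_span_sorted:
  assumes x: "x \<in> crel_span UNIV" and sorted: "x \<in> pspan {(w, g). sorted w}"
  shows "x = 0"
proof -
  let ?f = "\<lambda>(W, g). crel (choose_idx W) g" and ?S = "crel_lead ` crel_idx \<times> (UNIV :: 'g set)"
  have "crel_span UNIV \<subseteq> pm.span (?f ` ?S)"
    unfolding crel_span_def using crel_chosen by (intro pm.span_minimal) auto
  with x obtain a where a: "a \<in> pspan ?S" "x = lext ?f a" using span_image_bvec by blast
  have "a = 0"
  proof (rule ccontr)
    assume "a \<noteq> 0"
    hence ne: "keys a \<noteq> {}" by (auto simp: poly_mapping_eq_iff fun_eq_iff in_keys_iff)
    \<comment> \<open>Only words are compared. Keys with equal words and different group elements
      are incomparable, and \<open>lookup_crel\<close> separates them by the group element.\<close>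
    let ?R = "\<lambda>x y :: nat list \<times> 'g. (fst x, fst y) \<in> lenlex less_than"
    have "asymp_on (keys a) ?R"
      using asymD[OF asym_lenlex[OF asym_less_than]] by (intro asymp_onI) blast
    moreover have "transp_on (keys a) ?R"
      by (intro transp_onI) (auto intro: lenlex_trans)
    ultimately obtain m where m: "m \<in> keys a"
      "\<forall>y\<in>keys a. y \<noteq> m \<longrightarrow> \<not> ?R m y"
      using Finite_Set.bex_max_element[OF finite_keys _ _ ne, of ?R] by blast
    obtain W g where mW: "m = (W, g)" by (cases m)
    have lk: "lookup (?f y) (W, g) = (if y = m then 1 else 0)"
      if y: "y \<in> keys a" for y
    proof -
      obtain W' g' where ye: "y = (W', g')" by (cases y)
      have W': "W' \<in> crel_lead ` crel_idx" using y a(1) by (auto simp: pspan_def ye)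
      have "W \<notin> below W'"
        using m(2) y lenlex_irreflexive[of less_than W] by (cases "y = m") (auto simp: ye mW)
      thus ?thesis
        using lookup_crel[OF choose_idx(1)[OF W'], of W g' g] choose_idx(2)[OF W'] by (auto simp: ye mW)
    qed
    have "lookup x (W, g)
        = (\<Sum>y\<in>keys a. lookup a y * (if y = m then 1 else 0))"
      unfolding a(2) lext_def lookup_sum lookup_pscale by (intro sum.cong) (simp_all add: lk)
    also have "\<dots> = lookup a m"
      using m(1) by (simp add: if_distrib[of "\<lambda>c. _ * c"] sum.delta cong: if_cong)
    finally have "(W, g) \<in> keys x" using m(1) by (simp add: in_keys_iff)
    hence "sorted W" using sorted by (auto simp: pspan_def)
    moreover have "W \<in> crel_lead ` crel_idx" using a(1) m(1) by (auto simp: pspan_def mW)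
    ultimately show False using crel_lead_not_sorted by blast
  qed
  thus ?thesis by (simp add: a(2))
qed

subsection \<open>The action of the free algebra\<close>

definition letter_op :: "nat + 'g \<Rightarrow> ('g, 'k) word_alg \<Rightarrow> ('g, 'k) word_alg" where
  "letter_op l = (case l of Inl i \<Rightarrow> vop (vs ! i) | Inr g \<Rightarrow> gop g)"

text \<open>The action of the free algebra on B by left multiplication; the last letter of a word
  acts before the others.\<close>

definition free_op :: "('g, 'k) free \<Rightarrow> ('g, 'k) word_alg \<Rightarrow> ('g, 'k) word_alg" where
  "free_op f x = lext (\<lambda>w. foldr letter_op w x) f"

lemma lin_foldr_letter_op:
  "lin s F \<Longrightarrow> lin s (\<lambda>x. foldr letter_op w (F x))"
  by (induction w) (auto simp: letter_op_def intro: lin_vop lin_gop split: sum.split)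

lemma lin_free_op:
  assumes "lin s F"
  shows "lin s (\<lambda>x. free_op f (F x))"
  unfolding free_op_def by (intro lin_lext2 lin_foldr_letter_op assms linearD(1)[OF assms])

lemma lin_free_op1: "lin s F \<Longrightarrow> lin s (\<lambda>f. free_op (F f) x)"
  unfolding free_op_def by (rule lin_lext)

lemmas free_op_simps1 = linearD(2-7)[OF lin_free_op1[OF lin_id]]

lemma free_op_bvec [simp]: "free_op (bvec w) x = foldr letter_op w x"
  by (simp add: free_op_def)

lemma free_op_fm: "free_op (a \<odot> b) x = free_op a (free_op b x)"
proof (rule lin_eqI[where f = "\<lambda>a. free_op (a \<odot> b) x"])
  fix u
  show "free_op (bvec u \<odot> b) x = free_op (bvec u) (free_op b x)"
    by (rule lin_eqI[where f = "\<lambda>b. free_op (bvec u \<odot> b) x"])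
      (auto intro!: lin_free_op lin_free_op1 lin_fm_right lin_foldr_letter_op lin_id)
qed (intro lin_free_op lin_free_op1 lin_fm_left lin_id)+

lemma free_op_vec: "free_op (free_vec v) x = vop v x"
  by (rule lin_vec_eqI[where F = "\<lambda>v. free_op (free_vec v) x"])
    (auto intro!: lin_free_op1 lin_free_vec lin_vop_vec simp: free_vec_vs letter_op_def)

lemma free_op_grp: "free_op (free_grp g) x = gop g x"
  by (simp add: free_grp_def letter_op_def)

lemma free_op_grpalg: "free_op (free_grpalg a) x = aop a x"
proof (rule lin_eqI[where f = "\<lambda>a. free_op (free_grpalg a) x"])
  show "free_op (free_grpalg (bvec g)) x = aop (bvec g) x" for g
    by (simp add: free_grpalg_def free_op_grp)
qed (intro lin_free_op1 lin_free_grpalg lin_aop1 lin_id)+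

definition words :: "('g, 'k) word_alg set" where
  "words = pspan {(w, g). set w \<subseteq> {..<length vs}}"

lemma words_word_span: "x \<in> words \<Longrightarrow> \<exists>n. x \<in> word_span n"
proof -
  assume x: "x \<in> words"
  have "length w \<le> Max ((length \<circ> fst) ` keys x)" if "(w, g) \<in> keys x" for w g
    using that by (intro Max_ge) force+
  hence "x \<in> word_span (Max ((length \<circ> fst) ` keys x))"
    using x by (auto simp: words_def word_span_def pspan_def)
  thus ?thesis by blast
qed

lemma word_span_words: "word_span n \<subseteq> words"
  unfolding words_def word_span_def by (rule pspan_mono) auto

text \<open>Stability under the operators is available for bounded length; an element of the span
  involves finitely many relations and therefore has such a bound.\<close>

lemma crel_span_le: "x \<in> crel_span UNIV \<Longrightarrow> \<exists>n. x \<in> crel_le n"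
proof (unfold crel_span_def[of UNIV], induction rule: pm.span_induct)
  case base
  have mono: "x \<in> crel_le m \<Longrightarrow> m \<le> n \<Longrightarrow> x \<in> crel_le n" for x m n
    by (erule subsetD[OF crel_span_mono, rotated]) auto
  show ?case
    unfolding pm.subspace_def
  proof (intro conjI ballI allI CollectI; (elim CollectE exE)?)
    show "\<exists>n. 0 \<in> crel_le n" using crel_span_closed(1) by blast
  next
    fix x y m n assume "x \<in> crel_le m" "y \<in> crel_le n"
    hence "x + y \<in> crel_le (max m n)" by (intro crel_span_closed(2)) (auto intro: mono)
    thus "\<exists>n. x + y \<in> crel_le n" by blast
  next
    fix c x n assume "x \<in> crel_le n"
    thus "\<exists>n. pscale c x \<in> crel_le n" using crel_span_closed(5) by blast
  qed
next
  case (step x)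
  then obtain q g where "q \<in> crel_idx" "x = crel q g" by auto
  thus ?case using crel_span_base[of q "{w. length w \<le> length (crel_lead q)}" g] by blast
qed

lemma letter_op_closed:
  assumes "l \<in> letters"
  shows "x \<in> words \<Longrightarrow> letter_op l x \<in> words"
    and "x \<in> crel_span UNIV \<Longrightarrow> letter_op l x \<in> crel_span UNIV"
proof -
  assume "x \<in> words"
  thus "letter_op l x \<in> words"
    using words_word_span[of x] vop_word_span gop_word_span word_span_words
    by (cases l) (auto simp: letter_op_def, blast+)
next
  assume "x \<in> crel_span UNIV"
  thus "letter_op l x \<in> crel_span UNIV"
    using crel_span_le[of x] vop_crel_span gop_crel_span crel_span_mono[OF subset_UNIV]
    by (cases l) (auto simp: letter_op_def, blast+)
qed

lemma subspace_words: "pm.subspace words"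
  by (simp add: words_def subspace_pspan)

lemma free_op_closed:
  assumes "f \<in> free_space"
  shows "x \<in> words \<Longrightarrow> free_op f x \<in> words"
    and "x \<in> crel_span UNIV \<Longrightarrow> free_op f x \<in> crel_span UNIV"
proof -
  have "foldr letter_op w x \<in> words" if "w \<in> lists letters" "x \<in> words" for w
    using that by (induction w) (auto simp: letter_op_closed)
  thus "free_op f x \<in> words" if "x \<in> words"
    unfolding free_op_def using that assms[unfolded free_space_def]
    by (intro lext_mem[OF subspace_words]) auto
  have "foldr letter_op w x \<in> crel_span UNIV" if "w \<in> lists letters" "x \<in> crel_span UNIV" for w
    using that by (induction w) (auto simp: letter_op_closed)
  thus "free_op f x \<in> crel_span UNIV" if "x \<in> crel_span UNIV"
    unfolding free_op_def using that assms[unfolded free_space_def]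
    by (intro lext_mem[OF subspace_crel_span]) auto
qed

text \<open>The elements that map B into the span form an ideal, since the span is stable under the
  action. The relators belong to it: a commutator relator acts as \<open>rop\<close>, and the others
  act as 0.\<close>

lemma free_op_I:
  assumes "f \<in> I" "x \<in> words"
  shows "free_op f x \<in> crel_span UNIV"
proof -
  define J where "J = {f \<in> free_space. \<forall>x\<in>words. free_op f x \<in> crel_span UNIV}"
  have "ideal J free_alg"
    by (rule idealI_free)
      (auto simp: J_def pm.subspace_def free_space_closed free_op_simps1 crel_span_closed free_op_fm free_op_closed)
  moreover have "relators lam kap \<subseteq> J"
  proof
    fix r assume r: "r \<in> relators lam kap"
    have "free_op r x \<in> crel_span UNIV" if x: "x \<in> words" for x
    proof -
      obtain n where n: "x \<in> word_span n" using words_word_span[OF x] by blast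
      have "rop u v x \<in> crel_span UNIV" for u v
        using rop_crel_span[OF n] crel_span_mono[OF subset_UNIV] by blast
      thus ?thesis
        using r gop_gop[OF n] gop_zero[OF n]
        by (auto simp: relators_def free_op_simps1 free_op_fm free_op_vec free_op_grp free_op_grpalg
            gop_vop crel_span_closed(1) rop_def)
    qed
    thus "r \<in> J" using r relators_space by (auto simp: J_def)
  qed
  ultimately have "I \<subseteq> J" by (rule I_minimal)
  thus ?thesis using assms by (auto simp: J_def)
qed

text \<open>On the unit of B a normal word acts without rewriting: its group letter multiplies the
  neutral element and the vectors are then prepended.\<close>

lemma free_op_nf:
  "free_op (nf a) (bvec ([], 0)) = lext (\<lambda>p. bvec (exp_word (fst p), snd p)) a"
proof (rule lin_eqI[where f = "\<lambda>a. free_op (nf a) (bvec ([], 0))"])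
  fix p :: "'g mon"
  have "foldr letter_op (map Inl u) (bvec ([], h)) = bvec (u, h)" if "set u \<subseteq> {..<length vs}" for u h
    using that by (induction u) (auto simp: letter_op_def vop_vs)
  thus "free_op (nf (bvec p)) (bvec ([], 0)) = lext (\<lambda>p. bvec (exp_word (fst p), snd p)) (bvec p)"
    using set_exp_word[of "fst p"] by (simp add: nf_bvec nf_word_def letter_op_def gop_def)
qed (intro lin_free_op1 lin_nf lin_lext lin_id)+

text \<open>Applied to the unit of B, such a normal form lands in the span of the relations and is
  supported on sorted words, so it vanishes there. Sorted words determine the exponents, hence
  \<open>a\<close> is 0.\<close>

lemma nf_in_I:
  assumes a: "a \<in> skew_space" "nf a \<in> I"
  shows "a = 0"
proof -
  let ?e = "\<lambda>p :: 'g mon. (exp_word (fst p), snd p)"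
  have "free_op (nf a) (bvec ([], 0)) \<in> crel_span UNIV"
    by (rule free_op_I[OF a(2)]) (simp add: words_def)
  moreover have "free_op (nf a) (bvec ([], 0)) \<in> pspan {(w, g). sorted w}"
    unfolding free_op_nf
    by (rule lext_mem[OF subspace_pspan, of UNIV]) (auto simp: sorted_exp_word)
  ultimately have z: "lext (\<lambda>p. bvec (?e p)) a = 0"
    unfolding free_op_nf using crel_span_sorted by blast
  have inj: "p = q" if "?e p = ?e q" "p \<in> mons" "q \<in> mons" for p q
    using that exps_exp_word[of "fst p"] exps_exp_word[of "fst q"] by (cases p; cases q) (auto simp: mons_def)
  have "lookup a p = 0" if p: "p \<in> mons" for p
  proof -
    have "0 = lookup (lext (\<lambda>p. bvec (?e p)) a) (?e p)" by (simp add: z)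
    also have "\<dots> = (\<Sum>q\<in>keys a. if q = p then lookup a q else 0)"
      unfolding lext_def lookup_sum
      using inj[OF _ _ p] a(1)
      by (intro sum.cong) (auto simp: lookup_single when_def skew_space_def pspan_def)
    also have "\<dots> = lookup a p" by (simp add: in_keys_iff)
    finally show ?thesis by simp
  qed
  moreover have "lookup a p = 0" if "p \<notin> mons" for p
    using that a(1) by (auto simp: skew_space_def pspan_def in_keys_iff)
  ultimately show ?thesis by (intro poly_mapping_eqI) (metis lookup_zero)
qed

text \<open>Iteration of \<open>sub_nf_symb\<close> through the degrees: the error of lower degree
  is normalised in turn until only an element of I is left.\<close>

lemma lt_nf:
  "y \<in> free_lt n \<Longrightarrow> \<exists>b\<in>pspan {p \<in> mons. mon_deg p < n}. y - nf b \<in> I"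
proof (induction n arbitrary: y)
  case 0
  thus ?case by (auto intro!: bexI[of _ 0] simp: nf_simps I_closed)
next
  case (Suc n)
  from sub_nf_symb[OF Suc.prems] obtain x z
    where xz: "y - nf (symb n y) = x + z" "x \<in> I" "z \<in> free_lt n" by (auto simp: filt_ideal_def)
  from Suc.IH[OF xz(3)] obtain b where b: "b \<in> pspan {p \<in> mons. mon_deg p < n}" "z - nf b \<in> I" by blast
  have "symb n y + b \<in> pspan {p \<in> mons. mon_deg p < Suc n}"
    using symb_homog[of n y] b(1) unfolding skew_homog_def
    by (intro pspan_add) (auto elim!: subsetD[OF pspan_mono, rotated])
  moreover have "y - nf (symb n y + b) = x + (z - nf b)" using xz(1) by (simp add: nf_simps algebra_simps)
  hence "y - nf (symb n y + b) \<in> I" using xz(2) b(2) by (simp add: I_closed)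
  ultimately show ?case by blast
qed

text \<open>Independence modulo I is strengthened to independence modulo I + F_{n-1}: the part of
  lower degree is itself a normal form \<open>nf b\<close>, and a = b is impossible for nonzero
  \<open>a\<close>, since the degrees differ.\<close>

theorem PBW_if_cond: "PBW lam kap"
proof (rule nf_indep_imp_PBW, unfold nf_indep_def, intro ballI impI)
  fix n a assume a: "a \<in> skew_homog n" "nf a \<in> filt_ideal n"
  then obtain x y where xy: "nf a = x + y" "x \<in> I" "y \<in> free_lt n" by (auto simp: filt_ideal_def)
  from lt_nf[OF xy(3)] obtain b where b: "b \<in> pspan {p \<in> mons. mon_deg p < n}" "y - nf b \<in> I" by blast
  have "nf (a - b) = x + (y - nf b)" by (simp add: nf_simps xy(1) algebra_simps)
  hence "nf (a - b) \<in> I" using xy(2) b(2) by (simp add: I_closed)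
  moreover have "b \<in> skew_space"
    using b(1) unfolding skew_space_def by (rule subsetD[OF pspan_mono, rotated]) auto
  ultimately have "a - b = 0"
    using a(1) skew_homog_subset pm.subspace_diff[OF subspace_skew_space] by (intro nf_in_I) blast+
  hence "a \<in> pspan ({p \<in> mons. mon_deg p = n} \<inter> {p \<in> mons. mon_deg p < n})"
    using a(1) b(1) by (auto simp: pspan_def skew_homog_def)
  also have "{p \<in> mons. mon_deg p = n} \<inter> {p \<in> mons. mon_deg p < n} = {}" by auto
  finally show "a = 0" by simp
qed

end

section \<open>Necessity of the five identities\<close>

context pbw_data
begin

text \<open>A general element of V \<otimes> kG in normal order; with \<open>free_grpalg\<close> it
  makes up all normal forms of degree at most 1.\<close>

definition vec_grp_sum :: "('g \<Rightarrow> 'v) \<Rightarrow> ('g, 'k) free" where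
  "vec_grp_sum f = (\<Sum>h\<in>UNIV. free_vec (f h) \<odot> free_grp h)"

lemma vec_grp_sum_add: "vec_grp_sum (\<lambda>h. f h + f' h) = vec_grp_sum f + vec_grp_sum f'"
  and vec_grp_sum_diff: "vec_grp_sum (\<lambda>h. f h - f' h) = vec_grp_sum f - vec_grp_sum f'"
  by (simp_all add: vec_grp_sum_def free_vec_simps fm_left sum.distrib sum_subtractf)

lemma free_grpalg_expand: "free_grpalg a = (\<Sum>h\<in>UNIV. pscale (lookup a h) (free_grp h))"
  unfolding free_grpalg_def by (rule lext_superset) auto

lemma free_grpalg_bvec: "free_grpalg (bvec g) = free_grp g"
  by (simp add: free_grpalg_def)

lemma free_vec_grpalg:
  "free_vec v \<odot> free_grpalg a = vec_grp_sum (\<lambda>h. scale (lookup a h) v)"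
  by (simp add: free_grpalg_expand vec_grp_sum_def fm_right fm_left free_vec_simps)

lemma free_grpalg_vec:
  "free_grpalg a \<odot> free_vec v
    - (vec_grp_sum (\<lambda>h. scale (lookup a h) (act h v)) + free_grpalg (lam a v)) \<in> I"
proof -
  have "lam a v = lext (\<lambda>h. lam (bvec h) v) a"
    using lin_lext_eq[OF lam_linear1[of v], of bvec a] by simp
  hence "lam a v = (\<Sum>h\<in>UNIV. pscale (lookup a h) (lam (bvec h) v))"
    by (simp add: lext_superset[of UNIV])
  hence "free_grpalg a \<odot> free_vec v
    - (vec_grp_sum (\<lambda>h. scale (lookup a h) (act h v)) + free_grpalg (lam a v))
    = (\<Sum>h\<in>UNIV. pscale (lookup a h)
        (free_grp h \<odot> free_vec v - free_vec (act h v) \<odot> free_grp h - free_grpalg (lam (bvec h) v)))"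
    by (simp add: free_grpalg_expand[of a] vec_grp_sum_def fm_left free_vec_simps
        free_grpalg_simps pm.scale_right_diff_distrib sum_subtractf sum.distrib)
  also have "\<dots> \<in> I"
    by (intro pm.subspace_sum[OF subspace_I] I_closed(5) relator_grp_vec)
  finally show ?thesis .
qed

lemma free_grpalg_mult: "free_grpalg a \<odot> free_grpalg b - free_grpalg (a * b) \<in> I"
proof (rule lin_maps_pspan[where f = "\<lambda>a. free_grpalg a \<odot> free_grpalg b - free_grpalg (a * b)" and S = UNIV,
      OF _ subspace_I])
  fix g
  show "free_grpalg (bvec g) \<odot> free_grpalg b - free_grpalg (bvec g * b) \<in> I"
    by (rule lin_maps_pspan[where f = "\<lambda>b. free_grpalg (bvec g) \<odot> free_grpalg b - free_grpalg (bvec g * b)"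
          and S = UNIV, OF _ subspace_I])
      (auto intro!: lin_intros_mult lin_fm_right lin_free_grpalg simp: mult_single free_grpalg_bvec relator_grp)
qed (auto intro!: lin_intros_mult lin_fm_left lin_free_grpalg)

lemma nf_of_grpalg: "nf (of_grpalg a) = free_grpalg a"
proof (rule lin_eqI[where f = "\<lambda>a. nf (of_grpalg a)"])
  have "exp_word 0 = []" by (simp add: exp_word_def)
  thus "nf (of_grpalg (bvec g)) = free_grpalg (bvec g)" for g
    by (simp add: of_grp_def nf_bvec nf_word_def free_grpalg_bvec free_grp_def)
qed (intro lin_nf lin_of_grpalg lin_free_grpalg lin_id)+

lemma nf_of_vec_star_of_grp: "nf (of_vec v \<star> of_grp h) = free_vec v \<odot> free_grp h"
proof (rule lin_vec_eqI[where F = "\<lambda>v. nf (of_vec v \<star> of_grp h)"])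
  fix i assume i: "i < length vs"
  have "mset [i] = mset (exp_word (single i 1))"
    using mset_exp_word_eqI[of "[i]"] i by simp
  hence "exp_word (single i 1) = [i]" by (metis mset_single_iff mset.simps)
  thus "nf (of_vec (vs ! i) \<star> of_grp h) = free_vec (vs ! i) \<odot> free_grp h"
    using i by (simp add: of_vec_star_of_grp sym_vec_vs nf_bvec nf_word_def free_vec_vs free_grp_def del: One_nat_def)
qed (intro lin_nf lin_star_left lin_of_vec lin_fm_left lin_free_vec)+

lemma nf_vec_grp_sum: "vec_grp_sum f = nf (\<Sum>h\<in>UNIV. of_vec (f h) \<star> of_grp h)"
  by (simp add: vec_grp_sum_def nf_simps nf_of_vec_star_of_grp)

lemma PBW_imp_grpalg_eq:
  assumes "PBW lam kap" "free_grpalg a \<in> I"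
  shows "a = 0"
proof -
  have "of_grpalg a = 0"
    using PBW_imp_nf_indep[OF assms(1), of 0] assms(2) of_grpalg_homog
    by (auto simp: nf_indep_def filt_ideal_0 nf_of_grpalg)
  thus ?thesis using of_grpalg_inject[of a 0] by (simp add: of_grpalg_def)
qed

text \<open>Modulo I + F_0 the group algebra part disappears, so independence in degree 1 gives f =
  0. What remains is a group algebra element in I, which independence in degree 0 kills.\<close>

lemma PBW_imp_vec_grpalg_eq:
  assumes "PBW lam kap" "vec_grp_sum f + free_grpalg a \<in> I"
  shows "f h = 0" "a = 0"
proof -
  let ?x = "\<Sum>h\<in>UNIV. of_vec (f h) \<star> of_grp h"
  have "?x \<in> skew_homog 1"
    using star_homog[OF of_vec_homog of_grp_homog]
    by (intro pm.subspace_sum[OF subspace_skew_homog]) simp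
  moreover have "vec_grp_sum f = (vec_grp_sum f + free_grpalg a) - free_grpalg a" by simp
  hence "nf ?x \<in> filt_ideal 1"
    using filt_ideal_closed(3)[OF I_filt_ideal[OF assms(2)] lt_filt_ideal[OF free_grpalg_lt[of a]]]
    by (simp add: nf_vec_grp_sum)
  ultimately have "?x = 0" using PBW_imp_nf_indep[OF assms(1), of 1] by (auto simp: nf_indep_def)
  hence "?x = (\<Sum>h\<in>UNIV. of_vec 0 \<star> of_grp h)"
    by (simp add: of_vec_simps star_left)
  hence f: "f = (\<lambda>_. 0)" unfolding sum_of_vec_of_grp_eq_iff .
  thus "f h = 0" by simp
  have "vec_grp_sum f = 0" unfolding f by (simp add: vec_grp_sum_def free_vec_simps fm_left)
  thus "a = 0" using assms PBW_imp_grpalg_eq by simp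
qed

lemmas fm_distrib = fm_left(1,4,5) fm_right(1,4,5) fm_assoc

lemma PBW_imp_cond_mult:
  assumes "PBW lam kap"
  shows mult_cond
  unfolding mult_cond_def
proof (intro allI)
  fix g h v
  let ?d = "\<lambda>g v. free_grp g \<odot> free_vec v - free_vec (act g v) \<odot> free_grp g - free_grpalg (lam (bvec g) v)"
  let ?c = "free_grp g \<odot> free_grp h - free_grp (g + h)"
  have d: "?d g v \<in> I" for g v by (rule relator_grp_vec)
  have c: "?c \<in> I" by (rule relator_grp)
  \<comment> \<open>The relators used along the two reductions of ghv, with signs. All words with a
    vector cancel, leaving the free forms of lam(gh, v) - g lam(h, v) - lam(g, hv) h.\<close>
  have 1: "free_grp g \<odot> ?d h v + ?d g (act h v) \<odot> free_grp h - ?c \<odot> free_vec v - ?d (g + h) v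
      + free_vec (act (g + h) v) \<odot> ?c \<in> I"
    by (intro I_closed(2,3) I_left[OF c] I_left[OF d] I_right[OF c] I_right[OF d] c d free_vec_space free_grp_space)
  have 2: "free_grp g \<odot> free_grpalg (lam (bvec h) v) - free_grpalg (bvec g * lam (bvec h) v)
      + (free_grpalg (lam (bvec g) (act h v)) \<odot> free_grp h - free_grpalg (lam (bvec g) (act h v) * bvec h)) \<in> I"
    using I_closed(2)[OF free_grpalg_mult[of "bvec g" "lam (bvec h) v"]
        free_grpalg_mult[of "lam (bvec g) (act h v)" "bvec h"]]
    by (simp add: free_grpalg_bvec)
  have "free_grpalg (lam (bvec (g + h)) v - (lam (bvec g) (act h v) * bvec h + bvec g * lam (bvec h) v)) \<in> I"
    using I_closed(2)[OF 1 2]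
    by (simp only: fm_distrib act_mult free_grpalg_simps)
      (simp add: algebra_simps)
  from PBW_imp_grpalg_eq[OF assms this]
  show "lam (bvec (g + h)) v = lam (bvec g) (act h v) * bvec h + bvec g * lam (bvec h) v" by simp
qed

lemma PBW_imp_cond_kap_lam:
  assumes "PBW lam kap"
  shows kap_cond and lam_cond
proof -
  have "bvec g * kap u v - kap (act g u) (act g v) * bvec g
      = lam (lam (bvec g) u) v - lam (lam (bvec g) v) u \<and>
    scale (lookup (lam (bvec g) v) h) (act h u - act g u)
      = scale (lookup (lam (bvec g) u) h) (act h v - act g v)" for g h u v
  proof -
    let ?d = "\<lambda>v. free_grp g \<odot> free_vec v - free_vec (act g v) \<odot> free_grp g - free_grpalg (lam (bvec g) v)"
    let ?c = "\<lambda>u v. free_vec u \<odot> free_vec v - free_vec v \<odot> free_vec u - free_grpalg (kap u v)"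
    let ?l = "\<lambda>v h. lookup (lam (bvec g) v) h"
    let ?S = "\<lambda>a v. free_grpalg a \<odot> free_vec v
      - (vec_grp_sum (\<lambda>h. scale (lookup a h) (act h v)) + free_grpalg (lam a v))"
    have d: "?d v \<in> I" for v by (rule relator_grp_vec)
    have c: "?c u v \<in> I" for u v by (rule relator_vec)
    \<comment> \<open>The relators along the two reductions of g(uv - vu). Words with two vectors
      cancel; the rest consists of products of group algebra elements and terms with one vector, to
      be put into normal order.\<close>
    have 1: "free_grp g \<odot> ?c u v - (?d u \<odot> free_vec v + free_vec (act g u) \<odot> ?d v)
        + (?d v \<odot> free_vec u + free_vec (act g v) \<odot> ?d u) - ?c (act g u) (act g v) \<odot> free_grp g \<in> I"
      by (intro I_closed(2,3) I_left[OF c] I_left[OF d] I_right[OF c] I_right[OF d] c d free_vec_space free_grp_space)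
    have 2: "(free_grp g \<odot> free_grpalg (kap u v) - free_grpalg (bvec g * kap u v))
        - (free_grpalg (kap (act g u) (act g v)) \<odot> free_grp g - free_grpalg (kap (act g u) (act g v) * bvec g)) \<in> I"
      using I_closed(3)[OF free_grpalg_mult[of "bvec g" "kap u v"]
          free_grpalg_mult[of "kap (act g u) (act g v)" "bvec g"]]
      by (simp add: free_grpalg_bvec)
    have 3: "?S (lam (bvec g) v) u - ?S (lam (bvec g) u) v \<in> I"
      by (intro I_closed(2,3) free_grpalg_vec)
    have "vec_grp_sum (\<lambda>h. (scale (?l u h) (act h v) - scale (?l u h) (act g v))
          - (scale (?l v h) (act h u) - scale (?l v h) (act g u)))
        + free_grpalg (lam (lam (bvec g) u) v - lam (lam (bvec g) v) u
          - (bvec g * kap u v - kap (act g u) (act g v) * bvec g)) \<in> I"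
      using I_closed(2)[OF I_closed(2)[OF 1 2] 3]
      by (simp only: fm_distrib free_vec_grpalg free_grpalg_simps vec_grp_sum_diff)
        (simp add: algebra_simps)
    note * = PBW_imp_vec_grpalg_eq[OF assms this]
    show ?thesis using *(2) *(1)[of h] by (simp add: scale_right_diff_distrib)
  qed
  thus kap_cond and lam_cond by (simp_all add: kap_cond_def lam_cond_def)
qed

lemma PBW_imp_cond_jac:
  assumes "PBW lam kap"
  shows jac_vec_cond and jac_grp_cond
proof -
  have "scale (lookup (kap u v) h) (act h w - w)
      + scale (lookup (kap v w) h) (act h u - u)
      + scale (lookup (kap w u) h) (act h v - v) = 0 \<and>
    lam (kap u v) w + lam (kap v w) u + lam (kap w u) v = 0" for h u v w
  proof -
    let ?c = "\<lambda>u v. free_vec u \<odot> free_vec v - free_vec v \<odot> free_vec u - free_grpalg (kap u v)"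
    let ?S = "\<lambda>a v. free_grpalg a \<odot> free_vec v
      - (vec_grp_sum (\<lambda>h. scale (lookup a h) (act h v)) + free_grpalg (lam a v))"
    let ?k = "\<lambda>u v h. lookup (kap u v) h"
    have c: "?c u v \<in> I" for u v by (rule relator_vec)
    \<comment> \<open>The cubic words cancel as in the Jacobi identity for commutators, leaving the
      cyclic sum of the commutators of \<open>kap\<close> with the third vector.\<close>
    have 1: "(free_vec w \<odot> ?c u v - ?c u v \<odot> free_vec w) + (free_vec u \<odot> ?c v w - ?c v w \<odot> free_vec u)
        + (free_vec v \<odot> ?c w u - ?c w u \<odot> free_vec v) \<in> I"
      by (intro I_closed(2,3) I_left[OF c] I_right[OF c] free_vec_space)
    have 2: "?S (kap u v) w + ?S (kap v w) u + ?S (kap w u) v \<in> I"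
      by (intro I_closed(2,3) free_grpalg_vec)
    have "vec_grp_sum (\<lambda>h. (scale (?k u v h) (act h w) - scale (?k u v h) w)
          + (scale (?k v w h) (act h u) - scale (?k v w h) u) + (scale (?k w u h) (act h v) - scale (?k w u h) v))
        + free_grpalg (lam (kap u v) w + lam (kap v w) u + lam (kap w u) v) \<in> I"
      using I_closed(3)[OF 1 2]
      by (simp only: fm_distrib free_vec_grpalg free_grpalg_simps vec_grp_sum_diff
          vec_grp_sum_add)
        (simp add: algebra_simps)
    note * = PBW_imp_vec_grpalg_eq[OF assms this]
    show ?thesis using *(1)[of h] *(2) by (simp add: scale_right_diff_distrib)
  qed
  thus jac_vec_cond and jac_grp_cond by (simp_all add: jac_vec_cond_def jac_grp_cond_def)
qed

lemma PBW_iff_cond: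
  "PBW lam kap \<longleftrightarrow> (mult_cond \<and> lam_cond) \<and> (kap_cond \<and> jac_vec_cond) \<and> jac_grp_cond"
proof
  assume P: "PBW lam kap"
  show "(mult_cond \<and> lam_cond) \<and> (kap_cond \<and> jac_vec_cond) \<and> jac_grp_cond"
    by (intro conjI PBW_imp_cond_mult[OF P] PBW_imp_cond_kap_lam[OF P] PBW_imp_cond_jac[OF P])
next
  assume c: "(mult_cond \<and> lam_cond) \<and> (kap_cond \<and> jac_vec_cond) \<and> jac_grp_cond"
  interpret pbw_cond scale vs act lam kap by unfold_locales (use c in simp_all)
  show "PBW lam kap" by (rule PBW_if_cond)
qed

end

section \<open>The exterior powers in coordinates\<close>

context skew_setup
begin

text \<open>The coordinate matrix of basis vectors has entries 0 and 1. A term of a minor survives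
  only if the permutation matches two strictly increasing lists entry by entry, which forces equal
  lists and the identity permutation.\<close>

lemma wedge_vs:
  assumes "js \<in> wedge_idx (length js)"
  shows "wedge (map ((!) vs) js) = bvec js"
proof -
  let ?n = "length js"
  have js: "sorted_wrt (<) js" "set js \<subseteq> {..<length vs}" using assms by (auto simp: wedge_idx_def)
  have dist: "distinct xs" if "sorted_wrt (<) xs" for xs :: "nat list"
    using that strict_sorted_iff by blast
  have minor: "(\<Sum>\<pi> | \<pi> permutes {..<?n}. of_int (sign \<pi>) *
      (\<Prod>a<?n. coord (map ((!) vs) js ! a) (js' ! \<pi> a))) = (if js' = js then 1 else (0 :: 'k))"
    if js': "js' \<in> wedge_idx ?n" for js'
  proof -
    have j': "sorted_wrt (<) js'" "set js' \<subseteq> {..<length vs}" "length js' = ?n"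
      using js' by (auto simp: wedge_idx_def)
    have entry: "of_int (sign \<pi>) * (\<Prod>a<?n. coord (map ((!) vs) js ! a) (js' ! \<pi> a))
        = (if js' = js \<and> \<pi> = id then 1 else (0 :: 'k))" if \<pi>: "\<pi> permutes {..<?n}" for \<pi>
    proof (cases "\<forall>a<?n. js ! a = js' ! \<pi> a")
      case True
      have "set js \<subseteq> set js'"
      proof
        fix x assume "x \<in> set js"
        then obtain a where "a < ?n" "x = js ! a" by (auto simp: in_set_conv_nth)
        thus "x \<in> set js'" using True \<pi> j'(3) permutes_in_image[OF \<pi>, of a] by auto
      qed
      moreover have "card (set js) = card (set js')"
        using dist js j' by (simp add: distinct_card)
      ultimately have "set js = set js'" by (simp add: card_subset_eq)
      hence eq: "js' = js"
        using js(1) j'(1) by (simp add: strict_sorted_equal)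
      have "\<pi> a = a" for a
      proof (cases "a < ?n")
        case a: True
        have "\<pi> a < ?n" using permutes_in_image[OF \<pi>, of a] a by simp
        moreover have "js ! a = js ! \<pi> a" using True a by (simp add: eq)
        ultimately show ?thesis using nth_eq_iff_index_eq[OF dist[OF js(1)] a] by simp
      qed (use \<pi> in \<open>simp add: permutes_def\<close>)
      hence id: "\<pi> = id" by auto
      have "js ! a < length vs" if "a < ?n" for a using js(2) that nth_mem by blast
      thus ?thesis using eq id by (simp add: coord_vs)
    next
      case False
      then obtain a where a: "a < ?n" "js ! a \<noteq> js' ! \<pi> a" by blast
      have "\<pi> a < ?n" using permutes_in_image[OF \<pi>, of a] a(1) by simp
      hence "js ! a < length vs" "js' ! \<pi> a < length vs"
        using js(2) j'(2,3) a(1) nth_mem by (metis lessThan_iff subsetD)+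
      hence "coord (map ((!) vs) js ! a) (js' ! \<pi> a) = 0" using a by (simp add: coord_vs)
      hence "(\<Prod>a<?n. coord (map ((!) vs) js ! a) (js' ! \<pi> a)) = 0"
        using a(1) by (intro prod_zero) auto
      thus ?thesis using a by auto
    qed
    have "(\<Sum>\<pi> | \<pi> permutes {..<?n}. of_int (sign \<pi>) *
        (\<Prod>a<?n. coord (map ((!) vs) js ! a) (js' ! \<pi> a)))
      = (\<Sum>\<pi> | \<pi> permutes {..<?n}. if js' = js \<and> \<pi> = id then 1 else (0 :: 'k))"
      by (intro sum.cong[OF refl] entry) simp
    also have "\<dots> = (if js' = js then 1 else 0)"
      by (cases "js' = js") (simp_all add: sum.delta[of _ id] finite_permutations permutes_id)
    finally show ?thesis .
  qed
  have fin: "finite (wedge_idx ?n)"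
    by (rule finite_subset[of _ "{js. set js \<subseteq> {..<length vs} \<and> length js = ?n}"])
      (auto simp: wedge_idx_def finite_lists_length_eq)
  have "wedge (map ((!) vs) js) = (\<Sum>js'\<in>wedge_idx ?n. if js' = js then bvec js else 0)"
    unfolding wedge_def length_map by (intro sum.cong[OF refl]) (simp only: minor, simp)
  thus ?thesis using assms fin by simp
qed

lemma wedge_pspan: "wedge us \<in> pspan (wedge_idx (length us))"
  unfolding wedge_def by (intro pspan_sum single_in_pspan)

lemma wedge_Nil [simp]: "wedge [] = bvec []"
  using wedge_vs[of "[]"] by (simp add: wedge_idx_def)

text \<open>Cochains are given on basis vectors, whereas the differentials evaluate them at vectors
  such as gv. Linearity of \<open>wedge\<close> in each argument carries the formulas over.\<close>

lemma lin_wedge1: "lin scale (\<lambda>v. wedge [v])"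
proof -
  have "wedge [v] = (\<Sum>js\<in>wedge_idx 1. single js (coord v (js ! 0)))" for v
    by (simp add: wedge_def lessThan_Suc)
  thus ?thesis by (simp only:)
    (intro lin_sum vector_space_scale lin_single, simp_all add: coord_add coord_scale)
qed

lemma wedge_two:
  "wedge [v, w] = (\<Sum>js\<in>wedge_idx 2. single js
     (coord v (js ! 0) * coord w (js ! 1) - coord v (js ! 1) * coord w (js ! 0)))"
proof -
  have two: "{..<2} = {0, 1::nat}" by auto
  have "{\<pi>. \<pi> permutes {0, 1::nat}} = {id, transpose 0 1}"
    by (auto simp: permutes_doubleton_iff)
  moreover have "transpose 0 1 \<noteq> (id :: nat \<Rightarrow> nat)" by (metis id_apply transpose_apply_first zero_neq_one)
  ultimately have "(\<Sum>\<pi> | \<pi> permutes {0, 1::nat}. f \<pi>) = f id + f (transpose 0 1)" for f :: "_ \<Rightarrow> 'k"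
    by simp
  thus ?thesis
    by (simp add: wedge_def numeral_2_eq_2[symmetric] two sign_swap_id del: One_nat_def)
qed

lemma lin_wedge2_left: "lin scale (\<lambda>v. wedge [v, w])"
  and lin_wedge2_right: "lin scale (\<lambda>w. wedge [v, w])"
  unfolding wedge_two
  by (intro lin_sum vector_space_scale lin_single; simp add: coord_add coord_scale algebra_simps)+

lemma wedge_self: "wedge [v, v] = 0"
  by (simp add: wedge_two mult.commute)

lemma wedge_anti: "wedge [w, v] = - wedge [v, w]"
  unfolding wedge_two by (simp add: sum_negf[symmetric] single_uminus[symmetric] mult.commute)

subsection \<open>Cochains on the resolution\<close>

lemma lin_res_tens1:
  "lin s F \<Longrightarrow> lin s (\<lambda>x. res_tens (F x) gs w b)"
  unfolding res_tens_def by (rule lin_lext)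

lemma lin_res_tens2:
  assumes "lin s F"
  shows "lin s (\<lambda>x. res_tens a gs (F x) b)"
  unfolding res_tens_def by (intro lin_lext2 lin_lext assms linearD(1)[OF assms])

lemma lin_res_tens3:
  assumes "lin s F"
  shows "lin s (\<lambda>x. res_tens a gs w (F x))"
  unfolding res_tens_def by (intro lin_lext2 lin_lext assms linearD(1)[OF assms])

lemma res_tens_bvec [simp]: "res_tens (bvec p) gs (bvec js) (bvec q) = bvec (p, gs, js, q)"
  by (simp add: res_tens_def)

lemma lin_res_act:
  "lin s F \<Longrightarrow> lin s (\<lambda>x. res_act a (F x) b)"
  unfolding res_act_def by (rule lin_lext)

lemma res_tens_eqI:
  assumes "\<And>gs w b. lin pscale (\<lambda>a. F (a :: ('g, 'k) skew_alg) gs w b)"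
    and "\<And>gs a b. lin pscale (\<lambda>w. F a gs (w :: nat list \<Rightarrow>\<^sub>0 'k) b)"
    and "\<And>gs w a. lin pscale (\<lambda>b. F a gs w (b :: ('g, 'k) skew_alg))"
    and "\<And>gs w b. lin pscale (\<lambda>a. H (a :: ('g, 'k) skew_alg) gs w b)"
    and "\<And>gs a b. lin pscale (\<lambda>w. H a gs (w :: nat list \<Rightarrow>\<^sub>0 'k) b)"
    and "\<And>gs w a. lin pscale (\<lambda>b. H a gs w (b :: ('g, 'k) skew_alg))"
    and eq: "\<And>p js q. F (bvec p) gs (bvec js) (bvec q) = H (bvec p) gs (bvec js) (bvec q)"
  shows "F a gs w b = H a gs w b"
proof -
  have 1: "F (bvec p) gs (bvec js) b = H (bvec p) gs (bvec js) b" for p js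
    by (rule lin_eqI[where f = "\<lambda>b. F (bvec p) gs (bvec js) b", OF assms(3,6) eq])
  have 2: "F (bvec p) gs w b = H (bvec p) gs w b" for p
    by (rule lin_eqI[where f = "\<lambda>w. F (bvec p) gs w b", OF assms(2,5) 1])
  show ?thesis by (rule lin_eqI[where f = "\<lambda>a. F a gs w b", OF assms(1,4) 2])
qed

lemma res_act_tens: "res_act a (res_tens a' gs w b') b = res_tens (a \<star> a') gs w (b' \<star> b)"
proof (rule res_tens_eqI[where F = "\<lambda>a' gs w b'. res_act a (res_tens a' gs w b') b"])
  show "res_act a (res_tens (bvec p) gs (bvec js) (bvec q)) b
      = res_tens (a \<star> bvec p) gs (bvec js) (bvec q \<star> b)" for p js q
    by (simp add: res_act_def)
qed (intro lin_res_act lin_res_tens1 lin_res_tens2 lin_res_tens3 lin_star_left lin_star_right lin_id)+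

lemma lin_cochain:
  "lin s F \<Longrightarrow> lin s (\<lambda>x. cochain f (F x))"
  unfolding cochain_def by (rule lin_lext)

lemmas cochain_simps = linearD(2-7)[OF lin_cochain[OF lin_id]]

lemma cochain_res_tens:
  "cochain f (res_tens a gs w b) = a \<star> lext (\<lambda>js. f gs (map ((!) vs) js)) w \<star> b"
  by (rule res_tens_eqI[where F = "\<lambda>a gs w b. cochain f (res_tens a gs w b)"])
    (auto intro!: lin_cochain lin_res_tens1 lin_res_tens2 lin_res_tens3 lin_star_left lin_star_right
      lin_lext lin_id simp: cochain_def)

lemma cochain_res_act: "cochain f (res_act a x b) = a \<star> cochain f x \<star> b"
proof (rule lin_eqI[where f = "\<lambda>x. cochain f (res_act a x b)"])
  fix t :: "'g mon \<times> 'g list \<times> nat list \<times> 'g mon"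
  obtain p gs js q where t: "t = (p, gs, js, q)" by (cases t)
  show "cochain f (res_act a (bvec t) b) = a \<star> cochain f (bvec t) \<star> b"
    by (simp add: t res_act_tens cochain_res_tens star_assoc flip: res_tens_bvec)
qed (intro lin_cochain lin_res_act lin_star_left lin_star_right lin_id)+

text \<open>A coarse carrier without conditions on degree or wedge indices. It suffices for cochain
  values to lie in A and avoids tracking indices through the differentials.\<close>

definition res_all :: "('g, 'k) res set" where
  "res_all = pspan {(p, gs, js, q). p \<in> mons \<and> q \<in> mons}"

lemma subspace_res_all: "pm.subspace res_all"
  by (simp add: res_all_def subspace_pspan)

lemma res_space_all: "res_space n \<subseteq> res_all"
  unfolding res_space_def res_all_def by (rule pspan_mono) (auto simp: res_basis_def)

lemma res_tens_all:
  assumes "a \<in> skew_space" "b \<in> skew_space"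
  shows "res_tens a gs w b \<in> res_all"
  unfolding res_tens_def
proof (rule lext_mem[OF subspace_res_all _ assms(1)[unfolded skew_space_def]],
    rule lext_mem[OF subspace_res_all, of UNIV],
    rule lext_mem[OF subspace_res_all _ assms(2)[unfolded skew_space_def]])
  fix p q :: "'g mon" and js assume "p \<in> mons" "q \<in> mons"
  thus "bvec (p, gs, js, q) \<in> res_all" by (simp add: res_all_def)
qed simp

lemma cochain_skew_space:
  assumes "\<And>gs us. f gs us \<in> skew_space" "x \<in> res_all"
  shows "cochain f x \<in> skew_space"
  unfolding cochain_def using assms
  by (intro lext_mem[OF subspace_skew_space _ assms(2)[unfolded res_all_def]])
    (auto intro!: star_skew_space)

lemmas res_all_closed = pm.subspace_0[OF subspace_res_all] pm.subspace_add[OF subspace_res_all]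
  pm.subspace_diff[OF subspace_res_all] pm.subspace_scale[OF subspace_res_all]
  pm.subspace_sum[OF subspace_res_all]

lemma res_gen_all: "res_gen gs us \<in> res_all"
  unfolding res_gen_def by (intro res_tens_all skew_space_mem)

lemma res_dh_all: "res_dh gs us \<in> res_all"
  unfolding res_dh_def by (auto intro!: res_all_closed res_tens_all res_gen_all)

lemma res_dv_all: "res_dv gs us \<in> res_all"
  unfolding res_dv_def by (intro res_all_closed res_tens_all skew_space_mem)

text \<open>The differential is bimodule-linear and given on generators, so the composite is again
  of the form \<open>cochain\<close> and its equations can be tested on generators.\<close>

lemma dstar_cochain: "dstar (cochain f) = cochain (\<lambda>gs us. cochain f (res_dh gs us + res_dv gs us))"
proof
  fix x
  show "dstar (cochain f) x = cochain (\<lambda>gs us. cochain f (res_dh gs us + res_dv gs us)) x"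
    unfolding dstar_def o_def res_diff_def
    by (rule lin_eqI[where f = "\<lambda>x. cochain f (lext _ x)"])
      (auto intro!: lin_cochain lin_lext lin_id simp: cochain_res_act,
        auto simp: cochain_def split: prod.splits)
qed

lemma bvec_zero_star: "a \<in> skew_space \<Longrightarrow> bvec (0, 0) \<star> a \<star> bvec (0, 0) = a"
  by (simp add: one_skew_def[symmetric])

lemma cochain_bvec: "cochain f (bvec (p, gs, js, q)) = bvec p \<star> f gs (map ((!) vs) js) \<star> bvec q"
  by (simp add: cochain_def)

text \<open>A value on a generator is recovered at the basis element whose outer factors are 1.
  Values must lie in A for this, since 1 is a left unit only there.\<close>

lemma cochain_eq_iff:
  assumes "\<And>gs js. js \<in> wedge_idx (length js) \<Longrightarrow> length gs + length js = n \<Longrightarrow>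
      E gs (map ((!) vs) js) \<in> skew_space \<and> E' gs (map ((!) vs) js) \<in> skew_space"
  shows "(\<forall>x\<in>res_space n. cochain E x = cochain E' x) \<longleftrightarrow>
    (\<forall>gs js. js \<in> wedge_idx (length js) \<longrightarrow> length gs + length js = n \<longrightarrow>
      E gs (map ((!) vs) js) = E' gs (map ((!) vs) js))" (is "?L \<longleftrightarrow> ?R")
proof
  assume L: ?L
  show ?R
  proof (intro allI impI)
    fix gs :: "'g list" and js assume js: "js \<in> wedge_idx (length js)" "length gs + length js = n"
    hence "bvec ((0, 0), gs, js, (0, 0)) \<in> res_space n"
      by (simp add: res_space_def res_basis_def mons_def)
    with L have "cochain E (bvec ((0, 0), gs, js, (0, 0))) = cochain E' (bvec ((0, 0), gs, js, (0, 0)))"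
      by blast
    thus "E gs (map ((!) vs) js) = E' gs (map ((!) vs) js)"
      using assms[OF js] by (simp add: cochain_bvec bvec_zero_star)
  qed
next
  assume R: ?R
  show ?L
  proof
    fix x assume x: "x \<in> res_space n"
    show "cochain E x = cochain E' x"
    proof (rule lin_eq_on_pspan[OF _ _ _ x[unfolded res_space_def]])
      fix t :: "'g mon \<times> 'g list \<times> nat list \<times> 'g mon" assume "t \<in> res_basis n"
      thus "cochain E (bvec t) = cochain E' (bvec t)"
        using R by (auto simp: res_basis_def cochain_bvec)
    qed (intro lin_cochain lin_id)+
  qed
qed

end

context pbw_data
begin

lemma lam_res_tens: "lam_cochain lam (res_tens a [g] (wedge [v]) b) = a \<star> of_grpalg (lam (bvec g) v) \<star> b"
  unfolding lam_cochain_def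
proof (rule lin_vec_eqI[where F = "\<lambda>v. cochain _ (res_tens a [g] (wedge [v]) b)"])
  fix i assume i: "i < length vs"
  have "wedge [vs ! i] = bvec [i]" using wedge_vs[of "[i]"] i by (simp add: wedge_idx_def)
  thus "cochain (\<lambda>gs us. case (gs, us) of ([g], [v]) \<Rightarrow> of_grpalg (lam (bvec g) v) | _ \<Rightarrow> 0)
      (res_tens a [g] (wedge [vs ! i]) b) = a \<star> of_grpalg (lam (bvec g) (vs ! i)) \<star> b"
    by (simp add: cochain_res_tens)
qed (intro lin_cochain lin_res_tens2 lin_wedge1 lin_star_left lin_star_right lin_of_grpalg lam_linear2)+

lemma cochain_zero:
  assumes "\<And>js. length js = length us \<Longrightarrow> f gs (map ((!) vs) js) = 0"
  shows "cochain f (res_tens a gs (wedge us) b) = 0"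
proof -
  have "lext (\<lambda>js. f gs (map ((!) vs) js)) (wedge us) \<in> {0}"
    by (rule lext_mem[OF _ _ wedge_pspan]) (auto simp: wedge_idx_def assms)
  thus ?thesis by (simp add: cochain_res_tens star_left star_right)
qed

lemma lam_res_tens_zero:
  assumes "length gs \<noteq> 1 \<or> length us \<noteq> 1"
  shows "lam_cochain lam (res_tens a gs (wedge us) b) = 0"
  unfolding lam_cochain_def using assms by (intro cochain_zero) (auto split: list.splits)

text \<open>The cochain uses \<open>kap\<close> at increasing pairs of basis vectors. Equal and
  decreasing pairs follow because \<open>wedge\<close> and \<open>kap\<close> both alternate,
  arbitrary vectors by bilinearity.\<close>

lemma kap_res_tens: "kap_cochain kap (res_tens a [] (wedge [v, w]) b) = a \<star> of_grpalg (kap v w) \<star> b"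
  unfolding kap_cochain_def
proof (rule lin_vec_eqI[where F = "\<lambda>v. cochain _ (res_tens a [] (wedge [v, w]) b)"],
    goal_cases)
  case (3 i)
  let ?f = "\<lambda>gs us. case (gs, us) of ([], [v, w]) \<Rightarrow> of_grpalg (kap v w) | _ \<Rightarrow> 0"
  show ?case
  proof (rule lin_vec_eqI[where F = "\<lambda>w. cochain ?f (res_tens a [] (wedge [vs ! i, w]) b)"], goal_cases)
    case (3 j)
    have lt: "cochain ?f (res_tens a [] (wedge [vs ! i, vs ! j]) b) = a \<star> of_grpalg (kap (vs ! i) (vs ! j)) \<star> b"
      if "i < j" "j < length vs" for i j
      using wedge_vs[of "[i, j]"] that by (simp add: wedge_idx_def cochain_res_tens)
    show ?case
    proof (cases i j rule: linorder_cases)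
      case less
      thus ?thesis using lt 3 by simp
    next
      case equal
      thus ?thesis
        by (simp add: wedge_self cochain_res_tens star_left star_right of_grpalg_simps)
    next
      case greater
      hence "cochain ?f (res_tens a [] (- wedge [vs ! j, vs ! i]) b) = - (a \<star> of_grpalg (kap (vs ! j) (vs ! i)) \<star> b)"
        using lt[of j i] \<open>i < length vs\<close> by (simp add: linearD[OF lin_res_tens2[OF lin_id]] cochain_simps)
      thus ?thesis
        by (simp add: wedge_anti[of "vs ! i"] kap_anti[of "vs ! i"] star_left star_right
            of_grpalg_simps)
    qed
  qed (intro lin_cochain lin_res_tens2 lin_wedge2_right lin_star_left lin_star_right lin_of_grpalg kap_linear2)+
qed (intro lin_cochain lin_res_tens2 lin_wedge2_left lin_star_left lin_star_right lin_of_grpalg kap_linear1)+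

lemma kap_res_tens_zero:
  assumes "gs \<noteq> [] \<or> length us \<noteq> 2"
  shows "kap_cochain kap (res_tens a gs (wedge us) b) = 0"
  unfolding kap_cochain_def using assms by (intro cochain_zero) (auto split: list.splits)

lemma lin_lam_cochain:
  "lin s F \<Longrightarrow> lin s (\<lambda>x. lam_cochain lam (F x))"
  unfolding lam_cochain_def by (rule lin_cochain)

lemma lin_kap_cochain:
  "lin s F \<Longrightarrow> lin s (\<lambda>x. kap_cochain kap (F x))"
  unfolding kap_cochain_def by (rule lin_cochain)

lemmas lam_cochain_simps = linearD(2-7)[OF lin_lam_cochain[OF lin_id]]
lemmas kap_cochain_simps = linearD(2-7)[OF lin_kap_cochain[OF lin_id]]

lemma lam_cochain_space: "x \<in> res_all \<Longrightarrow> lam_cochain lam x \<in> skew_space"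
  unfolding lam_cochain_def
  by (rule cochain_skew_space) (auto split: list.splits simp: pm.subspace_0[OF subspace_skew_space])

lemma kap_cochain_space: "x \<in> res_all \<Longrightarrow> kap_cochain kap x \<in> skew_space"
  unfolding kap_cochain_def
  by (rule cochain_skew_space) (auto split: list.splits simp: pm.subspace_0[OF subspace_skew_space])

definition d_lam :: "'g list \<Rightarrow> 'v list \<Rightarrow> ('g, 'k) skew_alg" where
  "d_lam gs us = lam_cochain lam (res_dh gs us + res_dv gs us)"

definition d_kap :: "'g list \<Rightarrow> 'v list \<Rightarrow> ('g, 'k) skew_alg" where
  "d_kap gs us = kap_cochain kap (res_dh gs us + res_dv gs us)"

lemma d_lam_space: "d_lam gs us \<in> skew_space"
  unfolding d_lam_def by (intro lam_cochain_space res_all_closed res_dh_all res_dv_all)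

lemma d_kap_space: "d_kap gs us \<in> skew_space"
  unfolding d_kap_def by (intro kap_cochain_space res_all_closed res_dh_all res_dv_all)

lemma dstar_lam: "dstar (lam_cochain lam) = cochain d_lam"
  unfolding lam_cochain_def dstar_cochain d_lam_def[abs_def] ..

lemma dstar_kap: "dstar (kap_cochain kap) = cochain d_kap"
  unfolding kap_cochain_def dstar_cochain d_kap_def[abs_def] ..

lemmas d_simps = res_dh_def res_dv_def res_gen_def lam_cochain_simps kap_cochain_simps
  lam_res_tens kap_res_tens lam_res_tens_zero kap_res_tens_zero

text \<open>As \<open>lam\<close> is supported on X_{1,1}, it sees the horizontal differential of
  X_{2,1} and the vertical one of X_{1,2}. Likewise \<open>kap\<close>, supported on X_{0,2}, sees
  the horizontal one of X_{1,2} and the vertical one of X_{0,3}.\<close>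

lemma d_lam_mult:
  "d_lam [g, h] [v] = of_grpalg (bvec g * lam (bvec h) v - lam (bvec (g + h)) v
    + lam (bvec g) (act h v) * bvec h)"
  by (simp add: d_lam_def d_simps of_grpalg_mult of_grpalg_simps del: wedge_Nil)

lemma d_lam_vec:
  "d_lam [g] [v, w] = (of_grpalg (lam (bvec g) w) \<star> of_vec v - of_vec (act g v) \<star> of_grpalg (lam (bvec g) w))
    - (of_grpalg (lam (bvec g) v) \<star> of_vec w - of_vec (act g w) \<star> of_grpalg (lam (bvec g) v))"
  by (simp add: d_lam_def d_simps algebra_simps numeral_2_eq_2)

lemma d_lam_zero: "d_lam [] [u, v, w] = 0" "d_lam [g, h, l] [] = 0"
  by (simp_all add: d_lam_def d_simps del: wedge_Nil)

lemma d_kap_grp: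
  "d_kap [g] [v, w] = of_grpalg (bvec g * kap v w - kap (act g v) (act g w) * bvec g)"
  by (simp add: d_kap_def d_simps of_grpalg_mult of_grpalg_simps)

lemma d_kap_vec:
  "d_kap [] [u, v, w] = of_vec u \<star> of_grpalg (kap v w) - of_grpalg (kap v w) \<star> of_vec u
    - (of_vec v \<star> of_grpalg (kap u w) - of_grpalg (kap u w) \<star> of_vec v)
    + (of_vec w \<star> of_grpalg (kap u v) - of_grpalg (kap u v) \<star> of_vec w)"
  by (simp add: d_kap_def d_simps act_one algebra_simps numeral_3_eq_3)

lemma d_kap_zero: "d_kap [g, h] [v] = 0" "d_kap [g, h, l] [] = 0"
  by (simp_all add: d_kap_def d_simps del: wedge_Nil)

end

section \<open>From increasing tuples of basis vectors to all vectors\<close>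

context skew_setup
begin

text \<open>Generators of X_3 carry increasing tuples of basis vectors, while the identities are
  about all vectors. Vanishing on the diagonal is assumed, since in characteristic 2 antisymmetry
  would not imply it.\<close>

lemma alternating_two_zero:
  assumes lin: "\<And>w. lin scale (\<lambda>v. B v w)" "\<And>v. lin scale (B v)"
    and alt: "\<And>v. B v v = 0"
    and z: "\<And>i j. i < j \<Longrightarrow> j < length vs \<Longrightarrow> B (vs ! i) (vs ! j) = 0"
  shows "B v w = 0"
proof -
  have anti: "B w v = - B v w" for v w
    using alt[of "v + w"] alt[of v] alt[of w]
    by (simp add: linearD(2)[OF lin(1)] linearD(2)[OF lin(2)] eq_neg_iff_add_eq_0 add.commute)
  have "B (vs ! i) (vs ! j) = 0" if "i < length vs" "j < length vs" for i j
    using that z[of i j] z[of j i] anti[of "vs ! i" "vs ! j"] alt by (cases i j rule: linorder_cases) auto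
  thus ?thesis
    by (simp add: lin_vec_expand[OF lin(1), of v] lin_vec_expand[OF lin(2), of _ w])
qed

lemma alternating_three_zero:
  assumes lin: "\<And>v w. lin scale (\<lambda>u. T u v w)"
      "\<And>u w. lin scale (\<lambda>v. T u v w)" "\<And>u v. lin scale (T u v)"
    and alt: "\<And>u w. T u u w = 0" "\<And>u v. T u v v = 0" "\<And>u v. T u v u = 0"
    and z: "\<And>i j k. i < j \<Longrightarrow> j < k \<Longrightarrow> k < length vs \<Longrightarrow> T (vs ! i) (vs ! j) (vs ! k) = 0"
  shows "T u v w = 0"
proof -
  have a12: "T v u w = - T u v w" for u v w
  proof -
    have "T (u + v) (u + v) w = T u v w + T v u w"
      unfolding linearD(2)[OF lin(1)] linearD(2)[OF lin(2)] by (simp add: alt)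
    thus ?thesis by (simp add: alt eq_neg_iff_add_eq_0 add.commute)
  qed
  have a23: "T u w v = - T u v w" for u v w
  proof -
    have "T u (v + w) (v + w) = T u v w + T u w v"
      unfolding linearD(2)[OF lin(2)] linearD(2)[OF lin(3)] by (simp add: alt)
    thus ?thesis by (simp add: alt eq_neg_iff_add_eq_0 add.commute)
  qed
  have "T (vs ! i) (vs ! j) (vs ! k) = 0" if b: "i < length vs" "j < length vs" "k < length vs" for i j k
  proof -
    have lt: "T (vs ! i) (vs ! j) (vs ! k) = 0"
      if "i < j" "i < length vs" "j < length vs" "k < length vs" for i j k
    proof (cases j k rule: linorder_cases)
      case greater
      have "T (vs ! i) (vs ! j) (vs ! k) = - T (vs ! i) (vs ! k) (vs ! j)" by (rule a23)
      moreover have "T (vs ! i) (vs ! k) (vs ! j) = - T (vs ! k) (vs ! i) (vs ! j)" by (rule a12)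
      ultimately show ?thesis
        using greater that z[of i k j] z[of k i j] alt(3) by (cases i k rule: linorder_cases) auto
    qed (use that z alt(2) in auto)
    show ?thesis
      using b lt[of i j k] lt[of j i k] a12[of "vs ! i" "vs ! j" "vs ! k"] alt(1)
      by (cases i j rule: linorder_cases) auto
  qed
  thus ?thesis
    by (simp add: lin_vec_expand[OF lin(1), of u] lin_vec_expand[OF lin(2), of _ v]
        lin_vec_expand[OF lin(3), of _ _ w])
qed

lemma wedge_idx_eqs:
  "[] \<in> wedge_idx 0" "[i] \<in> wedge_idx (Suc 0) \<longleftrightarrow> i < length vs"
  "[i, j] \<in> wedge_idx (Suc (Suc 0)) \<longleftrightarrow> i < j \<and> j < length vs"
  "[i, j, k] \<in> wedge_idx (Suc (Suc (Suc 0))) \<longleftrightarrow> i < j \<and> j < k \<and> k < length vs"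
  by (auto simp: wedge_idx_def)

text \<open>The four bidegrees (3,0), (2,1), (1,2) and (0,3) of X_3.\<close>

lemma all_idx_three:
  "(\<forall>gs js. js \<in> wedge_idx (length js) \<longrightarrow> length gs + length js = 3 \<longrightarrow> P gs (map ((!) vs) js)) \<longleftrightarrow>
    (\<forall>g h l. P [g, h, l] []) \<and>
    (\<forall>g h i. i < length vs \<longrightarrow> P [g, h] [vs ! i]) \<and>
    (\<forall>g i j. i < j \<longrightarrow> j < length vs \<longrightarrow> P [g] [vs ! i, vs ! j]) \<and>
    (\<forall>i j k. i < j \<longrightarrow> j < k \<longrightarrow> k < length vs \<longrightarrow> P [] [vs ! i, vs ! j, vs ! k])"
  (is "?L \<longleftrightarrow> ?R")
proof
  assume L: ?L
  show ?R
    using L[rule_format, of "[]" "[_, _, _]"] L[rule_format, of "[_, _]" "[_]"]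
      L[rule_format, of "[_]" "[_, _]"] L[rule_format, of "[_, _, _]" "[]"]
    by (simp add: wedge_idx_eqs)
next
  assume R: ?R
  show ?L
  proof (intro allI impI)
    fix gs :: "'a list" and js assume js: "js \<in> wedge_idx (length js)" "length gs + length js = 3"
    have "length js = 0 \<and> length gs = 3 \<or> length js = 1 \<and> length gs = 2 \<or> length js = 2 \<and> length gs = 1
      \<or> length js = 3 \<and> length gs = 0" using js(2) by linarith
    thus "P gs (map ((!) vs) js)"
      using js(1) R by (auto simp: numeral_3_eq_3 numeral_2_eq_2 length_Suc_conv wedge_idx_eqs)
  qed
qed

subsection \<open>Elements of the bar resolution\<close>

lemma lin_tens_hd: "lin s F \<Longrightarrow> lin s (\<lambda>x. tens (F x # as))"
  by (simp add: lin_lext)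

lemma lin_tens_tl:
  assumes "lin s (\<lambda>x. tens (G x))"
  shows "lin s (\<lambda>x. tens (a # G x))"
  using assms linearD(1)[OF assms] by (simp add: lin_lext lin_lext2)

lemma tens_bvecs [simp]: "tens (map bvec ps) = bvec ps"
  by (induction ps) simp_all

lemma tens_pspan:
  "set as \<subseteq> skew_space \<Longrightarrow> tens as \<in> pspan {ps. length ps = length as \<and> set ps \<subseteq> mons}"
proof (induction as)
  case (Cons a as)
  have "a \<in> pspan mons" using Cons.prems by (simp add: skew_space_def)
  show ?case
    unfolding tens.simps
  proof (rule lext_mem[OF subspace_pspan _ \<open>a \<in> pspan mons\<close>], rule lext_mem[OF subspace_pspan _ Cons.IH])
    fix p ps assume "p \<in> mons" "ps \<in> {ps. length ps = length as \<and> set ps \<subseteq> mons}"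
    thus "bvec (p # ps) \<in> pspan {ps. length ps = length (a # as) \<and> set ps \<subseteq> mons}" by simp
  qed (use Cons.prems in simp)
qed simp

lemma tens_bar_space: "length as = n + 2 \<Longrightarrow> set as \<subseteq> skew_space \<Longrightarrow> tens as \<in> bar_space n"
  using tens_pspan[of as] by (simp add: bar_space_def)

lemma bar_cochain3_act:
  assumes "y \<in> bar_space 3"
  shows "bar_cochain3 f (bar_act a y b) = a \<star> bar_cochain3 f y \<star> b"
proof -
  have t: "bar_cochain3 f (tens [x, bvec p1, bvec p2, bvec p3, y]) = x \<star> f (bvec p1) (bvec p2) (bvec p3) \<star> y"
    for x y p1 p2 p3
  proof (rule lin_eqI[where f = "\<lambda>x. bar_cochain3 f (tens [x, _, _, _, _])"])
    fix p
    show "bar_cochain3 f (tens [bvec p, bvec p1, bvec p2, bvec p3, y])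
        = bvec p \<star> f (bvec p1) (bvec p2) (bvec p3) \<star> y"
    proof (rule lin_eqI[where f = "\<lambda>y. bar_cochain3 f (tens [_, _, _, _, y])"])
      fix q
      show "bar_cochain3 f (tens [bvec p, bvec p1, bvec p2, bvec p3, bvec q])
          = bvec p \<star> f (bvec p1) (bvec p2) (bvec p3) \<star> bvec q"
        by (simp add: bar_cochain3_def)
    qed (unfold bar_cochain3_def, (intro lin_lext lin_tens_tl lin_tens_hd lin_star_right lin_id)+)
  qed (unfold bar_cochain3_def, (intro lin_lext lin_tens_hd lin_star_left lin_id)+)
  show ?thesis
  proof (rule lin_eq_on_pspan[where f = "\<lambda>y. bar_cochain3 f (bar_act a y b)", OF _ _ _ assms[unfolded bar_space_def]])
    fix ps :: "'g mon list" assume "ps \<in> {ps. length ps = 3 + 2 \<and> set ps \<subseteq> mons}"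
    then obtain p0 p1 p2 p3 p4 where ps: "ps = [p0, p1, p2, p3, p4]"
      by (auto simp: length_Suc_conv numeral_eq_Suc)
    have "bar_act a (bvec ps) b = tens [a \<star> bvec p0, bvec p1, bvec p2, bvec p3, bvec p4 \<star> b]"
      by (simp add: bar_act_def ps)
    moreover have "bar_cochain3 f (bvec ps) = bvec p0 \<star> f (bvec p1) (bvec p2) (bvec p3) \<star> bvec p4"
      by (simp add: bar_cochain3_def ps)
    ultimately show "bar_cochain3 f (bar_act a (bvec ps) b) = a \<star> bar_cochain3 f (bvec ps) \<star> b"
      by (simp only: t star_assoc)
  qed (unfold bar_cochain3_def bar_act_def, (intro lin_lext lin_star_left lin_star_right lin_id)+)
qed

lemma bar_cochain3_tens:
  assumes "\<And>b c. lin pscale (\<lambda>a. f a b c)"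
    "\<And>a c. lin pscale (\<lambda>b. f a b c)"
    "\<And>a b. lin pscale (f a b)"
  shows "bar_cochain3 f (tens [one_skew, a, b, c, one_skew]) = one_skew \<star> f a b c \<star> one_skew"
proof -
  note lins = lin_lext lin_tens_tl lin_tens_hd lin_star_left lin_star_right lin_id assms
  have 1: "bar_cochain3 f (tens [one_skew, bvec p, bvec q, bvec r, one_skew])
      = one_skew \<star> f (bvec p) (bvec q) (bvec r) \<star> one_skew" for p q r
    by (simp add: bar_cochain3_def one_skew_def)
  have 2: "bar_cochain3 f (tens [one_skew, bvec p, bvec q, c, one_skew])
      = one_skew \<star> f (bvec p) (bvec q) c \<star> one_skew" for p q
    by (rule lin_eqI[where f = "\<lambda>c. bar_cochain3 f (tens [_, _, _, c, _])", OF _ _ 1])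
      (unfold bar_cochain3_def, (intro lins)+)
  have 3: "bar_cochain3 f (tens [one_skew, bvec p, b, c, one_skew])
      = one_skew \<star> f (bvec p) b c \<star> one_skew" for p
    by (rule lin_eqI[where f = "\<lambda>b. bar_cochain3 f (tens [_, _, b, _, _])", OF _ _ 2])
      (unfold bar_cochain3_def, (intro lins)+)
  show ?thesis
    by (rule lin_eqI[where f = "\<lambda>a. bar_cochain3 f (tens [_, a, _, _, _])", OF _ _ 3])
      (unfold bar_cochain3_def, (intro lins)+)
qed

lemma lin_bar_cochain3:
  "lin s F \<Longrightarrow> lin s (\<lambda>x. bar_cochain3 f (F x))"
  unfolding bar_cochain3_def by (rule lin_lext)

lemmas bar_cochain3_simps = linearD(2-7)[OF lin_bar_cochain3[OF lin_id]]

lemma bar_cochain3_cong: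
  assumes "y \<in> bar_space 3"
    and "\<And>p q r. p \<in> mons \<Longrightarrow> q \<in> mons \<Longrightarrow> r \<in> mons \<Longrightarrow>
      f (bvec p) (bvec q) (bvec r) = f' (bvec p) (bvec q) (bvec r)"
  shows "bar_cochain3 f y = bar_cochain3 f' y"
proof (rule lin_eq_on_pspan[OF _ _ _ assms(1)[unfolded bar_space_def]])
  fix ps :: "'g mon list" assume "ps \<in> {ps. length ps = 3 + 2 \<and> set ps \<subseteq> mons}"
  then obtain p0 p1 p2 p3 p4 where ps: "ps = [p0, p1, p2, p3, p4]" "set ps \<subseteq> mons"
    by (auto simp: length_Suc_conv numeral_eq_Suc)
  thus "bar_cochain3 f (bvec ps) = bar_cochain3 f' (bvec ps)" using assms(2) by (simp add: bar_cochain3_def)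
qed (intro lin_bar_cochain3 lin_id)+

lemma bar_cochain3_space:
  assumes "y \<in> bar_space 3"
    and "\<And>p q r. p \<in> mons \<Longrightarrow> q \<in> mons \<Longrightarrow> r \<in> mons \<Longrightarrow> f (bvec p) (bvec q) (bvec r) \<in> skew_space"
  shows "bar_cochain3 f y \<in> skew_space"
  unfolding bar_cochain3_def
proof (rule lext_mem[OF subspace_skew_space _ assms(1)[unfolded bar_space_def]])
  fix ps :: "'g mon list" assume "ps \<in> {ps. length ps = 3 + 2 \<and> set ps \<subseteq> mons}"
  hence "ps ! i \<in> mons" if "i < 5" for i using that nth_mem[of i ps] by auto
  thus "bvec (ps ! 0) \<star> f (bvec (ps ! 1)) (bvec (ps ! 2)) (bvec (ps ! 3)) \<star> bvec (ps ! 4) \<in> skew_space"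
    by (intro star_skew_space assms(2)) simp_all
qed

text \<open>Chain maps are given as additive and bimodule-linear; acting by a multiple of 1 on the
  left turns this into compatibility with scalars.\<close>

lemma res_act_scale:
  assumes "x \<in> res_space n"
  shows "res_act (pscale c one_skew) x one_skew = pscale c x"
proof (rule lin_eq_on_pspan[where f = "\<lambda>x. res_act _ x _", OF _ _ _ assms[unfolded res_space_def]])
  fix t :: "'g mon \<times> 'g list \<times> nat list \<times> 'g mon" assume "t \<in> res_basis n"
  then obtain p gs js q where t: "t = (p, gs, js, q)" "p \<in> mons" "q \<in> mons" by (auto simp: res_basis_def)
  show "res_act (pscale c one_skew) (bvec t) one_skew = pscale c (bvec t)"
    using t linearD(3)[OF lin_res_tens1[OF lin_id, of gs "bvec js" "bvec q"], of c "bvec p"]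
    by (simp add: res_act_tens star_left flip: res_tens_bvec)
qed (intro lin_res_act lin_pscale lin_id)+

lemma bar_act_scale:
  assumes "y \<in> bar_space n"
  shows "bar_act (pscale c one_skew) y one_skew = pscale c y"
proof (rule lin_eq_on_pspan[where f = "\<lambda>y. bar_act _ y _", OF _ _ _ assms[unfolded bar_space_def]])
  fix ps :: "'g mon list" assume ps: "ps \<in> {ps. length ps = n + 2 \<and> set ps \<subseteq> mons}"
  define p qs where "p = hd ps" and "qs = tl ps"
  have p: "ps = p # qs" "qs \<noteq> []" "p \<in> mons"
    using ps unfolding p_def qs_def by (cases ps; cases "tl ps"; force)+
  have "map bvec (butlast qs) @ [bvec (last qs)] = (map bvec qs :: ('g, 'k) skew_alg list)"
    using p(2) by (metis append_butlast_last_id list.simps(8,9) map_append)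
  moreover have "tens (pscale c (bvec p) # map bvec qs) = pscale c (bvec (p # qs))"
    using linearD(3)[OF lin_tens_hd[OF lin_id], of c "bvec p" "map bvec qs"] tens_bvecs[of "p # qs"]
    by simp
  ultimately show "bar_act (pscale c one_skew) (bvec ps) one_skew = pscale c (bvec ps)"
    using p by (simp add: bar_act_def star_left del: tens.simps)
qed (unfold bar_act_def, (intro lin_lext lin_pscale lin_id)+)

lemma gerst_bracket_circ:
  "gerst_bracket \<mu> \<nu> a b c = gerst_circ \<mu> \<nu> a b c + gerst_circ \<nu> \<mu> a b c"
  by (simp add: gerst_bracket_def gerst_circ_def)

lemma bracket_circ: "bracket \<phi> \<psi> \<alpha> \<beta> x = circ \<phi> \<psi> \<alpha> \<beta> x + circ \<phi> \<psi> \<beta> \<alpha> x"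
  by (simp add: bracket_def circ_def bar_cochain3_def gerst_bracket_circ lext_def star_left star_right
      pm.scale_right_distrib sum.distrib)

subsection \<open>Circle products on generators\<close>

text \<open>What the circle products of the cochains for \<open>\<lambda>\<close> and \<open>\<kappa>\<close> depend on.\<close>

definition low_degree ::
  "(('g, 'k) skew_alg \<Rightarrow> ('g, 'k) skew_alg \<Rightarrow> ('g, 'k) skew_alg) \<Rightarrow>
   (('g \<Rightarrow>\<^sub>0 'k) \<Rightarrow> 'v \<Rightarrow> ('g \<Rightarrow>\<^sub>0 'k)) \<Rightarrow> ('v \<Rightarrow> 'v \<Rightarrow> ('g \<Rightarrow>\<^sub>0 'k)) \<Rightarrow> bool" where
  "low_degree \<mu> l c \<longleftrightarrow>
    (\<forall>b. lin pscale (\<lambda>a. \<mu> a b)) \<and>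
    (\<forall>a. lin pscale (\<mu> a)) \<and>
    (\<forall>v. lin pscale (\<lambda>x. l x v)) \<and>
    (\<forall>g h. \<mu> (of_grp g) (of_grp h) = 0) \<and>
    (\<forall>v g. \<mu> (of_vec v) (of_grp g) = 0) \<and>
    (\<forall>g v. \<mu> (of_grp g) (of_vec v) = of_grpalg (l (bvec g) v)) \<and>
    (\<forall>v w. \<mu> (of_vec v) (of_vec w) - \<mu> (of_vec w) (of_vec v) = of_grpalg (c v w))"

context
  fixes \<mu> \<nu> l c l' c'
  assumes \<mu>: "low_degree \<mu> l c" and \<nu>: "low_degree \<nu> l' c'"
begin

lemma lin_\<mu>: "lin s F \<Longrightarrow> lin s (\<lambda>x. \<mu> (F x) b)"
    "lin s F \<Longrightarrow> lin s (\<lambda>x. \<mu> a (F x))"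
    "lin s F' \<Longrightarrow> lin s (\<lambda>x. l (F' x) v)"
  and lin_\<nu>: "lin s F \<Longrightarrow> lin s (\<lambda>x. \<nu> (F x) b)"
    "lin s F \<Longrightarrow> lin s (\<lambda>x. \<nu> a (F x))"
proof -
  note lins = \<mu>[unfolded low_degree_def] \<nu>[unfolded low_degree_def]
  show "lin s F \<Longrightarrow> lin s (\<lambda>x. \<mu> (F x) b)"
    by (erule lin_comp[rotated, where L = "\<lambda>x. \<mu> x b"]) (simp add: lins)
  show "lin s F \<Longrightarrow> lin s (\<lambda>x. \<mu> a (F x))"
    by (erule lin_comp[rotated, where L = "\<mu> a"]) (simp add: lins)
  show "lin s F' \<Longrightarrow> lin s (\<lambda>x. l (F' x) v)"
    by (erule lin_comp[rotated, where L = "\<lambda>x. l x v"]) (simp add: lins)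
  show "lin s F \<Longrightarrow> lin s (\<lambda>x. \<nu> (F x) b)"
    by (erule lin_comp[rotated, where L = "\<lambda>x. \<nu> x b"]) (simp add: lins)
  show "lin s F \<Longrightarrow> lin s (\<lambda>x. \<nu> a (F x))"
    by (erule lin_comp[rotated, where L = "\<nu> a"]) (simp add: lins)
qed

lemma \<mu>_values:
  "\<mu> (of_grp g) (of_grp h) = 0" "\<mu> (of_vec v) (of_grp g) = 0"
  "\<mu> (of_grp g) (of_vec v) = of_grpalg (l (bvec g) v)"
  "\<nu> (of_grp g) (of_grp h) = 0" "\<nu> (of_vec v) (of_grp g) = 0"
  "\<nu> (of_grp g) (of_vec v) = of_grpalg (l' (bvec g) v)"
  "\<nu> (of_vec v) (of_vec w) - \<nu> (of_vec w) (of_vec v) = of_grpalg (c' v w)"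
  using \<mu> \<nu> unfolding low_degree_def by blast+

lemma \<mu>_grpalg:
  "\<mu> (of_grpalg a) (of_grp h) = 0" "\<mu> (of_grp h) (of_grpalg a) = 0" "\<mu> (of_vec v) (of_grpalg a) = 0"
  "\<mu> (of_grpalg a) (of_vec v) = of_grpalg (l a v)"
proof -
  show "\<mu> (of_grpalg a) (of_grp h) = 0"
    by (rule lin_eqI[where f = "\<lambda>a. \<mu> (of_grpalg a) (of_grp h)"])
      (auto intro!: lin_\<mu> lin_of_grpalg lin_intros_mult simp: \<mu>_values)
  show "\<mu> (of_grp h) (of_grpalg a) = 0"
    by (rule lin_eqI[where f = "\<lambda>a. \<mu> (of_grp h) (of_grpalg a)"])
      (auto intro!: lin_\<mu> lin_of_grpalg lin_intros_mult simp: \<mu>_values)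
  show "\<mu> (of_vec v) (of_grpalg a) = 0"
    by (rule lin_eqI[where f = "\<lambda>a. \<mu> (of_vec v) (of_grpalg a)"])
      (auto intro!: lin_\<mu> lin_of_grpalg lin_intros_mult simp: \<mu>_values)
  show "\<mu> (of_grpalg a) (of_vec v) = of_grpalg (l a v)"
    by (rule lin_eqI[where f = "\<lambda>a. \<mu> (of_grpalg a) (of_vec v)"])
      (auto intro!: lin_\<mu> lin_of_grpalg lin_intros_mult simp: \<mu>_values)
qed

lemmas \<mu>_simps = linearD(2-7)[OF lin_\<mu>(1)[OF lin_id]] linearD(2-7)[OF lin_\<mu>(2)[OF lin_id]]

lemma bar_cochain3_circ:
  "bar_cochain3 (gerst_circ \<mu> \<nu>) (tens [one_skew, a, b, d, one_skew])
    = one_skew \<star> gerst_circ \<mu> \<nu> a b d \<star> one_skew"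
  by (rule bar_cochain3_tens) (unfold gerst_circ_def, (intro lin_intros_mult lin_\<mu> lin_\<nu>)+)

lemma circ_grp_grp_grp:
  "gerst_circ \<mu> \<nu> (of_grp g) (of_grp h) (of_grp j) = 0"
  by (simp add: gerst_circ_def \<mu>_values \<mu>_simps)

lemma circ_grp_grp_vec:
  "gerst_circ \<mu> \<nu> (of_grp g) (of_grp h) (of_vec v) = 0"
  "gerst_circ \<mu> \<nu> (of_grp g) (of_vec v) (of_grp h) = 0"
  "gerst_circ \<mu> \<nu> (of_vec v) (of_grp g) (of_grp h) = 0"
  by (simp_all add: gerst_circ_def \<mu>_values \<mu>_grpalg \<mu>_simps)

text \<open>Of \<open>\<nu>\<close> on two vectors only the commutator is known. It lies in kG, on
  which \<open>\<mu>\<close> vanishes against group elements from either side, so the terms with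
  \<open>\<nu>\<close> of two vectors cancel in pairs. The vectors \<open>v'\<close> and
  \<open>w'\<close> stand for gv and gw.\<close>

lemma circ_grp_vec_vec:
  "gerst_circ \<mu> \<nu> (of_grp g) (of_vec v) (of_vec w) - gerst_circ \<mu> \<nu> (of_grp g) (of_vec w) (of_vec v)
    + gerst_circ \<mu> \<nu> (of_vec v') (of_vec w') (of_grp g) - gerst_circ \<mu> \<nu> (of_vec w') (of_vec v') (of_grp g)
    - gerst_circ \<mu> \<nu> (of_vec v') (of_grp g) (of_vec w) + gerst_circ \<mu> \<nu> (of_vec w') (of_grp g) (of_vec v)
    = of_grpalg (l (l' (bvec g) v) w - l (l' (bvec g) w) v)"
proof -
  have "\<mu> (of_grp g) (\<nu> (of_vec v) (of_vec w) - \<nu> (of_vec w) (of_vec v)) = 0"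
    by (simp add: \<mu>_values(7) \<mu>_grpalg)
  hence "\<mu> (of_grp g) (\<nu> (of_vec v) (of_vec w)) = \<mu> (of_grp g) (\<nu> (of_vec w) (of_vec v))"
    unfolding \<mu>_simps(10) by simp
  moreover have "\<mu> (\<nu> (of_vec v') (of_vec w') - \<nu> (of_vec w') (of_vec v')) (of_grp g) = 0"
    by (simp add: \<mu>_values(7) \<mu>_grpalg)
  hence "\<mu> (\<nu> (of_vec v') (of_vec w')) (of_grp g) = \<mu> (\<nu> (of_vec w') (of_vec v')) (of_grp g)"
    unfolding \<mu>_simps(4) by simp
  ultimately show ?thesis
    by (simp add: gerst_circ_def \<mu>_values \<mu>_grpalg \<mu>_simps(3,9) of_grpalg_simps(4))
qed

text \<open>Again only commutators of \<open>\<nu>\<close> matter: with a vector on the left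
  \<open>\<mu>\<close> kills them, and with a vector on the right it turns them into values of
  \<open>l\<close>.\<close>

lemma circ_vec_vec_vec:
  "gerst_circ \<mu> \<nu> (of_vec u) (of_vec v) (of_vec w) + gerst_circ \<mu> \<nu> (of_vec v) (of_vec w) (of_vec u)
    + gerst_circ \<mu> \<nu> (of_vec w) (of_vec u) (of_vec v) - gerst_circ \<mu> \<nu> (of_vec v) (of_vec u) (of_vec w)
    - gerst_circ \<mu> \<nu> (of_vec u) (of_vec w) (of_vec v) - gerst_circ \<mu> \<nu> (of_vec w) (of_vec v) (of_vec u)
    = of_grpalg (l (c' u v) w + l (c' v w) u + l (c' w u) v)"
proof -
  have A: "\<mu> (of_vec u) (\<nu> (of_vec v) (of_vec w)) = \<mu> (of_vec u) (\<nu> (of_vec w) (of_vec v))" for u v w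
  proof -
    have "\<mu> (of_vec u) (\<nu> (of_vec v) (of_vec w) - \<nu> (of_vec w) (of_vec v)) = 0"
      by (simp add: \<mu>_values(7) \<mu>_grpalg)
    thus ?thesis unfolding \<mu>_simps(10) by simp
  qed
  have B: "\<mu> (\<nu> (of_vec u) (of_vec v)) (of_vec w)
      = \<mu> (\<nu> (of_vec v) (of_vec u)) (of_vec w) + of_grpalg (l (c' u v) w)" for u v w
  proof -
    have "\<mu> (\<nu> (of_vec u) (of_vec v) - \<nu> (of_vec v) (of_vec u)) (of_vec w) = of_grpalg (l (c' u v) w)"
      by (simp add: \<mu>_values(7) \<mu>_grpalg)
    thus ?thesis unfolding \<mu>_simps(4) by (simp add: diff_eq_eq add.commute)
  qed
  show ?thesis
    unfolding gerst_circ_def A[of u v w] A[of v w u] A[of w u v] B[of u v w] B[of v w u] B[of w u v]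
    by (simp add: of_grpalg_simps(1))
qed

end

lemma sum_permutes_three:
  fixes f :: "nat \<Rightarrow> nat \<Rightarrow> nat \<Rightarrow> ('x \<Rightarrow>\<^sub>0 'k)"
  shows "(\<Sum>\<sigma> | \<sigma> permutes {..<3}. pscale (of_int (sign \<sigma>)) (f (\<sigma> 0) (\<sigma> 1) (\<sigma> 2)))
    = f 0 1 2 + f 1 2 0 + f 2 0 1 - f 1 0 2 - f 0 2 1 - f 2 1 0"
proof -
  have three: "{..<3::nat} = insert 2 {0, 1}" by auto
  have two: "{\<pi>. \<pi> permutes {0, 1::nat}} = {id, transpose 0 1}"
    by (auto simp: permutes_doubleton_iff)
  have ne: "transpose 0 1 \<noteq> (id :: nat \<Rightarrow> nat)" by (metis id_apply transpose_apply_first zero_neq_one)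
  have perm: "permutation (transpose a b :: nat \<Rightarrow> nat)" for a b by (rule permutation_swap_id)
  show ?thesis
    unfolding three
    by (subst sum_over_permutations_insert)
      (simp_all add: two ne ne[symmetric] sign_compose[OF perm perm] sign_swap_id transpose_def algebra_simps del: One_nat_def)
qed

end

section \<open>The cochain conditions as identities for the parameters\<close>

locale chain_maps = pbw_data scale vs act lam kap
  for scale :: "'k::field \<Rightarrow> 'v::ab_group_add \<Rightarrow> 'v" and vs :: "'v list"
    and act :: "'g::{group_add, finite} \<Rightarrow> 'v \<Rightarrow> 'v"
    and lam :: "('g \<Rightarrow>\<^sub>0 'k) \<Rightarrow> 'v \<Rightarrow> ('g \<Rightarrow>\<^sub>0 'k)"
    and kap :: "'v \<Rightarrow> 'v \<Rightarrow> ('g \<Rightarrow>\<^sub>0 'k)" +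
  fixes \<phi> :: "nat \<Rightarrow> ('g, 'k) res \<Rightarrow> ('g, 'k) bar"
    and \<psi> :: "nat \<Rightarrow> ('g, 'k) bar \<Rightarrow> ('g, 'k) res"
  assumes chain_maps: "degree_zero_chain_maps \<phi> \<psi>"
    and prescribed: "prescribed_values \<phi> \<psi>"
begin

lemma phi_bar_space: "x \<in> res_space n \<Longrightarrow> \<phi> n x \<in> bar_space n"
  using chain_maps by (simp add: degree_zero_chain_maps_def)

lemma phi_add: "x \<in> res_space n \<Longrightarrow> y \<in> res_space n \<Longrightarrow> \<phi> n (x + y) = \<phi> n x + \<phi> n y"
  using chain_maps by (simp add: degree_zero_chain_maps_def)

lemma phi_act: "x \<in> res_space n \<Longrightarrow> a \<in> skew_space \<Longrightarrow> b \<in> skew_space \<Longrightarrow>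
    \<phi> n (res_act a x b) = bar_act a (\<phi> n x) b"
  using chain_maps by (simp add: degree_zero_chain_maps_def)

lemma psi_res_space: "y \<in> bar_space n \<Longrightarrow> \<psi> n y \<in> res_space n"
  using chain_maps by (simp add: degree_zero_chain_maps_def)

lemma psi_add: "x \<in> bar_space n \<Longrightarrow> y \<in> bar_space n \<Longrightarrow> \<psi> n (x + y) = \<psi> n x + \<psi> n y"
  using chain_maps by (simp add: degree_zero_chain_maps_def)

lemma psi_act: "y \<in> bar_space n \<Longrightarrow> a \<in> skew_space \<Longrightarrow> b \<in> skew_space \<Longrightarrow>
    \<psi> n (bar_act a y b) = res_act a (\<psi> n y) b"
  using chain_maps by (simp add: degree_zero_chain_maps_def)

lemma psi_diff: "y \<in> bar_space (Suc n) \<Longrightarrow> \<psi> n (bar_diff y) = res_diff (\<psi> (Suc n) y)"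
  using chain_maps by (simp add: degree_zero_chain_maps_def)

lemma psi_homog: "y \<in> bar_homog n d \<Longrightarrow> \<psi> n y \<in> res_homog n d"
  using chain_maps by (simp add: degree_zero_chain_maps_def)

lemma psi_values:
  "\<psi> 2 (tens [one_skew, of_grp g, of_grp h, one_skew]) = res_gen [g, h] []"
  "\<psi> 2 (tens [one_skew, of_grp g, of_vec v, one_skew] -
    tens [one_skew, of_vec (act g v), of_grp g, one_skew]) = res_gen [g] [v]"
  "g \<noteq> 0 \<Longrightarrow> \<psi> 2 (tens [one_skew, of_vec v, of_grp g, one_skew]) = 0"
  "\<psi> 2 (tens [one_skew, of_vec v, of_vec w, one_skew] -
    tens [one_skew, of_vec w, of_vec v, one_skew]) = res_gen [] [v, w]"
  by (use prescribed[unfolded prescribed_values_def] in simp)+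

lemma phi_values:
  "\<phi> 3 (res_gen [g, h, l] []) = tens [one_skew, of_grp g, of_grp h, of_grp l, one_skew]"
  "\<phi> 3 (res_gen [g, h] [v]) =
        tens [one_skew, of_grp g, of_grp h, of_vec v, one_skew] -
        tens [one_skew, of_grp g, of_vec (act h v), of_grp h, one_skew] +
        tens [one_skew, of_vec (act (g + h) v), of_grp g, of_grp h, one_skew]"
  "\<phi> 3 (res_gen [g] [v, w]) =
        tens [one_skew, of_grp g, of_vec v, of_vec w, one_skew] -
        tens [one_skew, of_grp g, of_vec w, of_vec v, one_skew] +
        tens [one_skew, of_vec (act g v), of_vec (act g w), of_grp g, one_skew] -
        tens [one_skew, of_vec (act g w), of_vec (act g v), of_grp g, one_skew] -
        tens [one_skew, of_vec (act g v), of_grp g, of_vec w, one_skew] +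
        tens [one_skew, of_vec (act g w), of_grp g, of_vec v, one_skew]"
  "\<phi> 3 (res_gen [] [u 0, u 1, u 2]) =
        (\<Sum>\<sigma> | \<sigma> permutes {..<3::nat}. pscale (of_int (sign \<sigma>))
           (tens [one_skew, of_vec (u (\<sigma> 0)), of_vec (u (\<sigma> 1)), of_vec (u (\<sigma> 2)), one_skew]))"
  by (use prescribed[unfolded prescribed_values_def] in simp)+

lemma pscale_one_space [simp]: "pscale c one_skew \<in> skew_space"
  by (intro pm.subspace_scale[OF subspace_skew_space]) simp

lemma phi_scale: "x \<in> res_space n \<Longrightarrow> \<phi> n (pscale c x) = pscale c (\<phi> n x)"
  using phi_act[of x n "pscale c one_skew" one_skew] res_act_scale[of x n c]
    bar_act_scale[OF phi_bar_space, of x n c] by simp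

lemma psi_scale: "y \<in> bar_space n \<Longrightarrow> \<psi> n (pscale c y) = pscale c (\<psi> n y)"
  using psi_act[of y n "pscale c one_skew" one_skew] bar_act_scale[of y n c]
    res_act_scale[OF psi_res_space, of y n c] by simp

text \<open>Only the values of \<open>\<psi> 2\<close> on \<open>bar_space 2\<close> matter; this extension is linear everywhere.\<close>

definition psi2 :: "('g, 'k) bar \<Rightarrow> ('g, 'k) res" where
  "psi2 = lext (\<lambda>ps. \<psi> 2 (bvec ps))"

lemma psi2_eq:
  assumes "y \<in> bar_space 2"
  shows "psi2 y = \<psi> 2 y"
proof -
  have b: "bar_space 2 = pspan {ps. length ps = 4 \<and> set ps \<subseteq> mons}" by (simp add: bar_space_def)
  show ?thesis
    unfolding psi2_def
    by (rule linear_on_pspan_eq_lext[where f = "\<psi> 2", OF _ _ assms[unfolded b], folded b, symmetric])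
      (simp_all add: psi_add psi_scale)
qed

text \<open>The pullback along \<open>\<psi> 2\<close>, made bilinear on the whole type by means of
  \<open>psi2\<close>; on A it agrees with \<open>pull_psi\<close>.\<close>

definition bil :: "('g list \<Rightarrow> 'v list \<Rightarrow> ('g, 'k) skew_alg) \<Rightarrow>
    ('g, 'k) skew_alg \<Rightarrow> ('g, 'k) skew_alg \<Rightarrow> ('g, 'k) skew_alg" where
  "bil f a b = cochain f (psi2 (tens [one_skew, a, b, one_skew]))"

lemma tens4_bar_space [simp]:
  "a \<in> skew_space \<Longrightarrow> b \<in> skew_space \<Longrightarrow> tens [one_skew, a, b, one_skew] \<in> bar_space 2"
  by (rule tens_bar_space) auto

lemma pull_psi_eq: "a \<in> skew_space \<Longrightarrow> b \<in> skew_space \<Longrightarrow> pull_psi \<psi> (cochain f) a b = bil f a b"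
  by (simp add: pull_psi_def bil_def psi2_eq del: tens.simps)

lemma lin_bil1: "lin s F \<Longrightarrow> lin s (\<lambda>x. bil f (F x) b)"
  and lin_bil2: "lin s F \<Longrightarrow> lin s (\<lambda>x. bil f a (F x))"
  unfolding bil_def psi2_def by (intro lin_cochain lin_lext lin_tens_tl lin_tens_hd; assumption)+

lemma bil_space:
  assumes "\<And>gs us. f gs us \<in> skew_space" "a \<in> skew_space" "b \<in> skew_space"
  shows "bil f a b \<in> skew_space"
  unfolding bil_def using assms res_space_all[of 2] psi_res_space[of _ 2]
  by (intro cochain_skew_space) (auto simp: psi2_eq simp del: tens.simps)

lemma bil_values:
  "bil f (of_grp g) (of_grp h) = cochain f (res_gen [g, h] [])"
  "bil f (of_grp g) (of_vec v) - bil f (of_vec (act g v)) (of_grp g) = cochain f (res_gen [g] [v])"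
  "g \<noteq> 0 \<Longrightarrow> bil f (of_vec v) (of_grp g) = 0"
  "bil f (of_vec v) (of_vec w) - bil f (of_vec w) (of_vec v) = cochain f (res_gen [] [v, w])"
proof -
  have diff: "x \<in> bar_space 2 \<Longrightarrow> y \<in> bar_space 2 \<Longrightarrow> x - y \<in> bar_space 2" for x y
    unfolding bar_space_def by (rule pspan_diff)
  have d: "bil f a b - bil f a' b'
      = cochain f (\<psi> 2 (tens [one_skew, a, b, one_skew] - tens [one_skew, a', b', one_skew]))"
    if "a \<in> skew_space" "b \<in> skew_space" "a' \<in> skew_space" "b' \<in> skew_space" for a b a' b'
    using that by (simp add: bil_def diff psi2_eq[symmetric] cochain_simps(4)[symmetric] del: tens.simps)
      (simp add: psi2_def lext_diff del: tens.simps)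
  show "bil f (of_grp g) (of_grp h) = cochain f (res_gen [g, h] [])"
    by (simp add: bil_def psi2_eq psi_values del: tens.simps)
  show "g \<noteq> 0 \<Longrightarrow> bil f (of_vec v) (of_grp g) = 0"
    by (simp add: bil_def psi2_eq psi_values cochain_simps del: tens.simps)
  show "bil f (of_grp g) (of_vec v) - bil f (of_vec (act g v)) (of_grp g) = cochain f (res_gen [g] [v])"
    "bil f (of_vec v) (of_vec w) - bil f (of_vec w) (of_vec v) = cochain f (res_gen [] [v, w])"
    by (simp_all add: d psi_values del: tens.simps)
qed

definition lamf :: "'g list \<Rightarrow> 'v list \<Rightarrow> ('g, 'k) skew_alg" where
  "lamf = (\<lambda>gs us. case (gs, us) of ([g], [v]) \<Rightarrow> of_grpalg (lam (bvec g) v) | _ \<Rightarrow> 0)"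

definition kapf :: "'g list \<Rightarrow> 'v list \<Rightarrow> ('g, 'k) skew_alg" where
  "kapf = (\<lambda>gs us. case (gs, us) of ([], [v, w]) \<Rightarrow> of_grpalg (kap v w) | _ \<Rightarrow> 0)"

lemma lam_cochain_lamf: "lam_cochain lam = cochain lamf"
  by (simp add: lam_cochain_def lamf_def)

lemma kap_cochain_kapf: "kap_cochain kap = cochain kapf"
  by (simp add: kap_cochain_def kapf_def)

lemma lamf_space: "lamf gs us \<in> skew_space"
  by (auto simp: lamf_def pm.subspace_0[OF subspace_skew_space] split: list.splits)

lemma kapf_space: "kapf gs us \<in> skew_space"
  by (auto simp: kapf_def pm.subspace_0[OF subspace_skew_space] split: list.splits)

text \<open>
  \<open>\<psi>\<^sub>2(1 \<otimes> v \<otimes> 1\<^sub>G \<otimes> 1)\<close> is not prescribed, but differs from \<open>v \<psi>\<^sub>2(1 \<otimes> 1\<^sub>G \<otimes> 1\<^sub>G \<otimes> 1)\<close> by a boundary.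
\<close>

lemma bil_lam_vec_one:
  assumes d: "\<And>x. x \<in> res_space 3 \<Longrightarrow> dstar (lam_cochain lam) x = 0"
  shows "bil lamf (of_vec v) (of_grp 0) = 0"
proof (rule lin_vec_eqI[where F = "\<lambda>v. bil lamf (of_vec v) (of_grp 0)"])
  fix i assume i: "i < length vs"
  let ?e = "(single i 1, 0) :: 'g mon" and ?o = "(0, 0) :: 'g mon"
  let ?x = "bvec [?o, ?e, ?o, ?o, ?o] :: ('g, 'k) bar"
  have m: "?e \<in> mons" "?o \<in> mons" using i by (auto simp: mons_def)
  have one: "bvec ?o = one_skew" by (simp add: one_skew_def)
  have bo: "bvec ?o \<star> bvec p = bvec p" if "p \<in> mons" for p using that by (simp add: one)
  have ob: "bvec p \<star> bvec ?o = bvec p" for p by (simp add: one)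
  have x: "?x \<in> bar_space 3" using m by (simp add: bar_space_def)
  have b1: "bvec [?e, ?o, ?o, ?o] \<in> bar_space 2" "bvec [?o, ?e, ?o, ?o] \<in> bar_space 2"
    "bvec [?o, ?o, ?o, ?o] \<in> bar_space 2" using m by (simp_all add: bar_space_def)
  have e: "of_vec (vs ! i) = bvec ?e" using i by (simp add: of_vec_def sym_vec_vs del: One_nat_def)
  \<comment> \<open>The last three of the four terms are equal up to sign, with signs -, +, -, so
    one of them survives.\<close>
  have "bar_diff ?x = bvec [?e, ?o, ?o, ?o] - bvec [?o, ?e, ?o, ?o]"
    using m by (simp add: bar_diff_def lessThan_Suc numeral_eq_Suc bo ob tens_bvecs[of "[_, _, _, _]", simplified]
          single_uminus del: One_nat_def)
  hence "\<psi> 2 (bvec [?e, ?o, ?o, ?o] - bvec [?o, ?e, ?o, ?o]) = res_diff (\<psi> 3 ?x)"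
    using psi_diff[of ?x 2] x by simp
  moreover have "\<psi> 2 (bvec [?e, ?o, ?o, ?o] - bvec [?o, ?e, ?o, ?o])
      = psi2 (bvec [?e, ?o, ?o, ?o]) - psi2 (bvec [?o, ?e, ?o, ?o])"
    using b1 psi2_eq[of "bvec [?e, ?o, ?o, ?o] - bvec [?o, ?e, ?o, ?o]"]
    by (simp add: bar_space_def pspan_diff psi2_def lext_diff)
  moreover have "lam_cochain lam (res_diff (\<psi> 3 ?x)) = 0"
    using d[OF psi_res_space[OF x]] by (simp add: dstar_def)
  ultimately have "lam_cochain lam (psi2 (bvec [?e, ?o, ?o, ?o]) - psi2 (bvec [?o, ?e, ?o, ?o])) = 0"
    by simp
  hence "lam_cochain lam (psi2 (bvec [?o, ?e, ?o, ?o])) = lam_cochain lam (psi2 (bvec [?e, ?o, ?o, ?o]))"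
    unfolding lam_cochain_simps(4) by simp
  also have "bvec [?e, ?o, ?o, ?o] = bar_act (bvec ?e) (bvec [?o, ?o, ?o, ?o]) (bvec ?o)"
    using m by (simp add: bar_act_def bo ob)
  also have "lam_cochain lam (psi2 \<dots>) = bvec ?e \<star> lam_cochain lam (\<psi> 2 (bvec [?o, ?o, ?o, ?o])) \<star> bvec ?o"
    using b1 m psi2_eq[OF b1(1)] \<open>bvec [?e, ?o, ?o, ?o] = _\<close>
    by (simp add: psi_act lam_cochain_lamf cochain_res_act)
  also have "\<psi> 2 (bvec [?o, ?o, ?o, ?o]) = res_gen [0, 0] []"
    using psi_values(1)[of 0 0] by (simp add: of_grp_def one_skew_def)
  also have "lam_cochain lam (res_gen [0, 0] []) = 0"
    unfolding res_gen_def by (rule lam_res_tens_zero) simp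
  finally show "bil lamf (of_vec (vs ! i)) (of_grp 0) = 0"
    by (simp add: bil_def e of_grp_def one_skew_def star_left star_right lam_cochain_lamf)
qed (intro lin_bil1 lin_of_vec lin_zero vector_space_scale)+

text \<open>The cocycle condition supplies the value at v \<otimes> 1_G that \<open>\<psi>\<close>
  leaves open; this ties the evaluation of brackets to the condition on \<open>lam\<close>.\<close>

lemma low_degree_lam:
  assumes d: "\<And>x. x \<in> res_space 3 \<Longrightarrow> dstar (lam_cochain lam) x = 0"
  shows "low_degree (bil lamf) lam (\<lambda>_ _. 0)"
proof -
  have vg: "bil lamf (of_vec v) (of_grp g) = 0" for v g
    using bil_lam_vec_one[OF d] bil_values(3)[of g lamf] by (cases "g = 0") auto
  have "bil lamf (of_grp g) (of_vec v) = of_grpalg (lam (bvec g) v)" for g v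
    using bil_values(2)[of lamf g v] lam_res_tens[of one_skew g v one_skew]
    by (simp add: vg res_gen_def lam_cochain_lamf)
  moreover have "cochain lamf (res_gen [g, h] []) = 0" "cochain lamf (res_gen [] [v, w]) = 0" for g h v w
    using lam_res_tens_zero[of "[g, h]" "[]" one_skew one_skew] lam_res_tens_zero[of "[]" "[v, w]" one_skew one_skew]
    unfolding res_gen_def lam_cochain_lamf by simp_all
  ultimately show ?thesis
    unfolding low_degree_def using vg lam_linear1 lin_bil1[OF lin_id] lin_bil2[OF lin_id] bil_values(1,4)
    by (simp add: of_grpalg_simps)
qed

text \<open>A degree argument that includes g = 1: the element has degree 1 and
  \<open>\<psi>\<close> preserves degree, whereas X_{0,2}, where \<open>kap\<close> lives, has no
  elements of degree 1 other than 0.\<close>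

lemma bil_kap_vec_grp: "bil kapf (of_vec v) (of_grp g) = 0"
proof (rule lin_vec_eqI[where F = "\<lambda>v. bil kapf (of_vec v) (of_grp g)"])
  fix i assume i: "i < length vs"
  let ?e = "(single i 1, 0) :: 'g mon" and ?o = "(0, 0) :: 'g mon"
  let ?y = "bvec [?o, ?e, (0, g), ?o] :: ('g, 'k) bar"
  have y: "?y \<in> bar_homog 2 1" "?y \<in> bar_space 2"
    using i by (simp_all add: bar_homog_def bar_space_def mons_def mon_deg_def)
  have "kap_cochain kap x \<in> {0}" if "x \<in> res_homog 2 1" for x
  proof (rule lin_maps_pspan[where f = "kap_cochain kap", OF _ _ _ that[unfolded res_homog_def]])
    fix t :: "'g mon \<times> 'g list \<times> nat list \<times> 'g mon"
    assume "t \<in> {(p, gs, js, q). (p, gs, js, q) \<in> res_basis 2 \<and> mon_deg p + length js + mon_deg q = 1}"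
    then obtain p gs js q where t: "t = (p, gs, js, q)" "length js \<le> 1" by auto
    thus "kap_cochain kap (bvec t) \<in> {0}"
      by (auto simp: kap_cochain_kapf kapf_def cochain_bvec star_left star_right split: list.split)
  qed (intro lin_kap_cochain lin_id | simp)+
  hence "kap_cochain kap (\<psi> 2 ?y) = 0" using psi_homog[OF y(1)] by blast
  moreover have "of_vec (vs ! i) = bvec ?e" using i by (simp add: of_vec_def sym_vec_vs del: One_nat_def)
  ultimately show "bil kapf (of_vec (vs ! i)) (of_grp g) = 0"
    using y(2) by (simp add: bil_def of_grp_def one_skew_def psi2_eq kap_cochain_kapf)
qed (intro lin_bil1 lin_of_vec lin_zero vector_space_scale)+

lemma low_degree_kap: "low_degree (bil kapf) (\<lambda>_ _. 0) kap"
proof -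
  have "cochain kapf (res_gen [g] [v]) = 0" "cochain kapf (res_gen [g, h] []) = 0" for g h v
    using kap_res_tens_zero[of "[g]" "[v]" one_skew one_skew] kap_res_tens_zero[of "[g, h]" "[]" one_skew one_skew]
    unfolding res_gen_def kap_cochain_kapf by simp_all
  moreover have "cochain kapf (res_gen [] [v, w]) = of_grpalg (kap v w)" for v w
    using kap_res_tens[of one_skew v w one_skew] unfolding res_gen_def kap_cochain_kapf by simp
  ultimately show ?thesis
    unfolding low_degree_def using bil_kap_vec_grp lin_bil1[OF lin_id] lin_bil2[OF lin_id]
      bil_values(1,4)[of kapf] bil_values(2)[of kapf]
    by (simp add: of_grpalg_simps lin_zero pm.vector_space_axioms)
qed

definition circ_val :: "('g list \<Rightarrow> 'v list \<Rightarrow> ('g, 'k) skew_alg) \<Rightarrow> ('g list \<Rightarrow> 'v list \<Rightarrow> ('g, 'k) skew_alg) \<Rightarrow>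
    'g list \<Rightarrow> 'v list \<Rightarrow> ('g, 'k) skew_alg" where
  "circ_val f f' gs us = bar_cochain3 (gerst_circ (bil f) (bil f')) (\<phi> 3 (res_gen gs us))"

lemma res_gen_bvec:
  "js \<in> wedge_idx (length js) \<Longrightarrow> res_gen gs (map ((!) vs) js) = bvec ((0, 0), gs, js, (0, 0))"
  by (simp add: res_gen_def wedge_vs one_skew_def)

text \<open>Since \<open>\<phi> 3\<close> is linear on its carrier and compatible with the bimodule
  structures, the composite is determined by its values on generators.\<close>

lemma circ_eq_cochain:
  assumes f: "\<And>gs us. f gs us \<in> skew_space" and f': "\<And>gs us. f' gs us \<in> skew_space"
    and x: "x \<in> res_space 3"
  shows "circ \<phi> \<psi> (cochain f) (cochain f') x = cochain (circ_val f f') x"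
proof -
  let ?F = "\<lambda>x. bar_cochain3 (gerst_circ (bil f) (bil f')) (\<phi> 3 x)"
  have "circ \<phi> \<psi> (cochain f) (cochain f') x = ?F x"
    unfolding circ_def o_def
    by (rule bar_cochain3_cong[OF phi_bar_space[OF x]])
      (simp add: gerst_circ_def pull_psi_eq bil_space f f')
  also have "?F x = lext (\<lambda>t. ?F (bvec t)) x"
    by (rule linear_on_pspan_eq_lext[where S = "res_basis 3" and f = ?F, folded res_space_def])
      (simp_all add: x phi_add phi_scale bar_cochain3_simps)
  also have "\<dots> = cochain (circ_val f f') x"
  proof (rule lin_eq_on_pspan[OF linear_lext _ _ x[unfolded res_space_def]])
    fix t :: "'g mon \<times> 'g list \<times> nat list \<times> 'g mon" assume "t \<in> res_basis 3"
    then obtain p gs js q where t: "t = (p, gs, js, q)" "p \<in> mons" "q \<in> mons"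
      "js \<in> wedge_idx (length js)" "length gs + length js = 3" by (auto simp: res_basis_def)
    let ?g = "res_gen gs (map ((!) vs) js)"
    have g: "?g \<in> res_space 3" using t(4,5) by (simp add: res_gen_bvec res_space_def res_basis_def mons_def)
    have "bvec t = res_act (bvec p) ?g (bvec q)"
      using t by (simp add: res_gen_def wedge_vs res_act_tens)
    hence "?F (bvec t) = bvec p \<star> ?F ?g \<star> bvec q"
      using t g by (simp add: phi_act bar_cochain3_act phi_bar_space)
    thus "lext (\<lambda>t. ?F (bvec t)) (bvec t) = cochain (circ_val f f') (bvec t)"
      by (simp add: t cochain_bvec circ_val_def)
  qed (intro lin_cochain lin_id)
  finally show ?thesis .
qed

lemma circ_val_space:
  assumes "\<And>gs us. f gs us \<in> skew_space" "\<And>gs us. f' gs us \<in> skew_space"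
    and "js \<in> wedge_idx (length js)" "length gs + length js = 3"
  shows "circ_val f f' gs (map ((!) vs) js) \<in> skew_space"
  unfolding circ_val_def
proof (rule bar_cochain3_space)
  show "\<phi> 3 (res_gen gs (map ((!) vs) js)) \<in> bar_space 3"
    using assms(3,4) by (intro phi_bar_space) (simp add: res_gen_bvec res_space_def res_basis_def mons_def)
  show "gerst_circ (bil f) (bil f') (bvec p) (bvec q) (bvec r) \<in> skew_space"
    if "p \<in> mons" "q \<in> mons" "r \<in> mons" for p q r
    using that assms(1,2) unfolding gerst_circ_def
    by (intro pm.subspace_diff[OF subspace_skew_space] bil_space) simp_all
qed

lemma circ_val:
  assumes l: "low_degree (bil f) l c" and l': "low_degree (bil f') l' c'"
  shows "circ_val f f' [g, h, j] [] = 0"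
    and "circ_val f f' [g, h] [v] = 0"
    and "circ_val f f' [g] [v, w] = of_grpalg (l (l' (bvec g) v) w - l (l' (bvec g) w) v)"
    and "circ_val f f' [] [u, v, w] = of_grpalg (l (c' u v) w + l (c' v w) u + l (c' w u) v)"
proof -
  note b = bar_cochain3_simps(1,4) bar_cochain3_circ[OF l l']
  show "circ_val f f' [g, h, j] [] = 0"
    by (simp add: circ_val_def phi_values b circ_grp_grp_grp[OF l l'] star_left star_right del: tens.simps)
  show "circ_val f f' [g, h] [v] = 0"
    by (simp add: circ_val_def phi_values b circ_grp_grp_vec[OF l l'] star_left star_right del: tens.simps)
  show "circ_val f f' [g] [v, w] = of_grpalg (l (l' (bvec g) v) w - l (l' (bvec g) w) v)"
    unfolding circ_val_def phi_values b star_right(1,4)[symmetric] star_left(1,4)[symmetric]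
      circ_grp_vec_vec[OF l l'] by simp
  \<comment> \<open>The prescribed value takes its three vectors as a function of the position; list
    access provides one.\<close>
  let ?u = "\<lambda>n. [u, v, w] ! n"
  have "\<phi> 3 (res_gen [] [u, v, w]) = \<phi> 3 (res_gen [] [?u 0, ?u 1, ?u 2])" by simp
  also have "\<dots> = tens [one_skew, of_vec u, of_vec v, of_vec w, one_skew]
      + tens [one_skew, of_vec v, of_vec w, of_vec u, one_skew]
      + tens [one_skew, of_vec w, of_vec u, of_vec v, one_skew]
      - tens [one_skew, of_vec v, of_vec u, of_vec w, one_skew]
      - tens [one_skew, of_vec u, of_vec w, of_vec v, one_skew]
      - tens [one_skew, of_vec w, of_vec v, of_vec u, one_skew]"
    unfolding phi_values
    by (subst sum_permutes_three[where f = "\<lambda>a b c. tens [one_skew, of_vec (?u a), of_vec (?u b), of_vec (?u c), one_skew]"])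
      (simp del: tens.simps)
  finally have p: "\<phi> 3 (res_gen [] [u, v, w]) = \<dots>" .
  show "circ_val f f' [] [u, v, w] = of_grpalg (l (c' u v) w + l (c' v w) u + l (c' w u) v)"
    unfolding circ_val_def p b star_right(1,4)[symmetric] star_left(1,4)[symmetric]
      circ_vec_vec_vec[OF l l'] by simp
qed

lemma cochain_zero_iff:
  assumes "\<And>gs js. js \<in> wedge_idx (length js) \<Longrightarrow> length gs + length js = n \<Longrightarrow>
      E gs (map ((!) vs) js) \<in> skew_space"
  shows "(\<forall>x\<in>res_space n. cochain E x = 0) \<longleftrightarrow>
    (\<forall>gs js. js \<in> wedge_idx (length js) \<longrightarrow> length gs + length js = n \<longrightarrow> E gs (map ((!) vs) js) = 0)"
proof -
  have "cochain (\<lambda>_ _. 0) x = 0" for x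
    by (rule lin_eqI[where f = "cochain (\<lambda>_ _. 0)"])
      (auto intro!: lin_cochain lin_zero lin_id pm.vector_space_axioms simp: cochain_bvec star_left star_right
        split: prod.splits elim!: prod_cases4)
  thus ?thesis
    using cochain_eq_iff[of n E "\<lambda>_ _. 0"] assms pm.subspace_0[OF subspace_skew_space] by simp
qed

text \<open>Bidegree (2,1) gives \<open>mult_cond\<close>, and bidegree (1,2), compared in V for
  each group element, gives \<open>lam_cond\<close>. The other two bidegrees vanish
  identically.\<close>

lemma dstar_lam_iff:
  "(\<forall>x\<in>res_space 3. dstar (lam_cochain lam) x = 0) \<longleftrightarrow> mult_cond \<and> lam_cond"
proof -
  have 0: "of_grpalg 0 = 0" by (simp add: of_grpalg_def)
  have 1: "d_lam [g, h] [v] = 0 \<longleftrightarrow>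
      lam (bvec (g + h)) v = lam (bvec g) (act h v) * bvec h + bvec g * lam (bvec h) v" for g h v
  proof -
    have "d_lam [g, h] [v] = 0 \<longleftrightarrow>
        bvec g * lam (bvec h) v - lam (bvec (g + h)) v + lam (bvec g) (act h v) * bvec h = 0"
      unfolding d_lam_mult 0[symmetric] of_grpalg_inject ..
    thus ?thesis by (auto simp: algebra_simps)
  qed
  have 2: "d_lam [g] [u, v] = 0 \<longleftrightarrow>
      (\<forall>h. scale (lookup (lam (bvec g) v) h) (act h u - act g u)
        = scale (lookup (lam (bvec g) u) h) (act h v - act g v))" for g u v
    unfolding d_lam_vec right_minus_eq of_grpalg_star_of_vec of_vec_star_of_grpalg
    by (simp add: sum_subtractf[symmetric] star_left(4)[symmetric] of_vec_simps(4)[symmetric]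
        scale_right_diff_distrib[symmetric] sum_of_vec_of_grp_eq_iff fun_eq_iff)
  have lin: "lin scale (\<lambda>v. d_lam [g] [v, w])"
    "lin scale (\<lambda>w. d_lam [g] [v, w])" for g v w
    unfolding d_lam_vec
    by (intro lin_intros_mult lin_star_left lin_star_right lin_of_vec lin_act lin_of_grpalg lam_linear2)+
  have "(\<forall>x\<in>res_space 3. dstar (lam_cochain lam) x = 0) \<longleftrightarrow>
      (\<forall>g h i. i < length vs \<longrightarrow> d_lam [g, h] [vs ! i] = 0) \<and>
      (\<forall>g i j. i < j \<longrightarrow> j < length vs \<longrightarrow> d_lam [g] [vs ! i, vs ! j] = 0)"
    unfolding dstar_lam by (subst cochain_zero_iff) (simp_all add: d_lam_space all_idx_three[of "\<lambda>gs us. d_lam gs us = 0"] d_lam_zero)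
  also have "(\<forall>g h i. i < length vs \<longrightarrow> d_lam [g, h] [vs ! i] = 0) \<longleftrightarrow> (\<forall>g h v. d_lam [g, h] [v] = 0)"
  proof (intro iffI allI impI)
    fix g h v assume z: "\<forall>g h i. i < length vs \<longrightarrow> d_lam [g, h] [vs ! i] = 0"
    show "d_lam [g, h] [v] = 0"
    proof (rule lin_vec_eqI[where F = "\<lambda>v. d_lam [g, h] [v]" and H = "\<lambda>_. 0"])
      show "lin scale (\<lambda>v. d_lam [g, h] [v])"
        unfolding d_lam_mult
        by (rule lin_of_grpalg lin_add lin_diff lin_mult_left lin_mult_right lam_linear2
            lin_act[OF lam_linear2])+
      show "lin scale (\<lambda>_. 0 :: ('g, 'k) skew_alg)"
        by (rule lin_zero[OF vector_space_scale])
    qed (use z in blast)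
  qed blast
  also have "(\<forall>g i j. i < j \<longrightarrow> j < length vs \<longrightarrow> d_lam [g] [vs ! i, vs ! j] = 0)
      \<longleftrightarrow> (\<forall>g v w. d_lam [g] [v, w] = 0)"
    using alternating_two_zero[where B = "\<lambda>v w. d_lam [_] [v, w]", OF lin] by (auto simp: d_lam_vec)
  finally show ?thesis unfolding 1 2 mult_cond_def lam_cond_def by blast
qed

text \<open>Bidegree (1,2) gives \<open>kap_cond\<close>. In bidegree (0,3) the circle product
  vanishes, as \<open>lam\<close> does on X_{0,2}, so the coboundary of \<open>kap\<close> must
  vanish there, which is \<open>jac_vec_cond\<close>.\<close>

lemma circ_lam_lam_iff:
  assumes D: "\<forall>x\<in>res_space 3. dstar (lam_cochain lam) x = 0"
  shows "(\<forall>x\<in>res_space 3.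
    circ \<phi> \<psi> (lam_cochain lam) (lam_cochain lam) x = dstar (kap_cochain kap) x) \<longleftrightarrow> kap_cond \<and> jac_vec_cond"
proof -
  have L: "low_degree (bil lamf) lam (\<lambda>_ _. 0)" using D by (intro low_degree_lam) auto
  note c = circ_val[OF L L]
  have 0: "of_grpalg 0 = 0" by (simp add: of_grpalg_def)
  let ?B = "\<lambda>g u v. lam (lam (bvec g) u) v - lam (lam (bvec g) v) u
      - (bvec g * kap u v - kap (act g u) (act g v) * bvec g)"
  let ?T = "\<lambda>u v w. d_kap [] [u, v, w]"
  have B: "circ_val lamf lamf [g] [u, v] = d_kap [g] [u, v] \<longleftrightarrow> ?B g u v = 0" for g u v
    unfolding c d_kap_grp of_grpalg_inject by simp
  have T: "circ_val lamf lamf [] [u, v, w] = d_kap [] [u, v, w] \<longleftrightarrow> ?T u v w = 0" for u v w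
  proof -
    have "circ_val lamf lamf [] [u, v, w] = 0" unfolding c by (simp add: lam_simps 0)
    thus ?thesis by auto
  qed
  have TT: "?T u v w = 0 \<longleftrightarrow> (\<forall>h. scale (lookup (kap u v) h) (act h w - w)
      + scale (lookup (kap v w) h) (act h u - u)
      + scale (lookup (kap w u) h) (act h v - v) = 0)" (is "_ \<longleftrightarrow> (\<forall>h. ?f h = 0)") for u v w
  proof -
    have "?T u v w = - (\<Sum>h\<in>UNIV. of_vec (?f h) \<star> of_grp h)"
      unfolding d_kap_vec kap_anti[of u w] of_grpalg_star_of_vec of_vec_star_of_grpalg
      by (simp add: of_vec_simps star_left scale_right_diff_distrib sum.distrib sum_subtractf
          sum_negf algebra_simps)
    moreover have "(\<Sum>h\<in>UNIV. of_vec (?f h) \<star> of_grp h) = 0 \<longleftrightarrow> ?f = (\<lambda>_. 0)"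
      using sum_of_vec_of_grp_eq_iff[of ?f "\<lambda>_. 0"] by (simp add: of_vec_simps star_left)
    ultimately show ?thesis by (simp add: fun_eq_iff)
  qed
  have "(\<forall>x\<in>res_space 3. circ \<phi> \<psi> (lam_cochain lam) (lam_cochain lam) x = dstar (kap_cochain kap) x) \<longleftrightarrow>
      (\<forall>x\<in>res_space 3. cochain (circ_val lamf lamf) x = cochain d_kap x)"
    by (simp add: lam_cochain_lamf dstar_kap circ_eq_cochain lamf_space)
  also have "\<dots> \<longleftrightarrow> (\<forall>g i j. i < j \<longrightarrow> j < length vs \<longrightarrow> ?B g (vs ! i) (vs ! j) = 0) \<and>
      (\<forall>i j k. i < j \<longrightarrow> j < k \<longrightarrow> k < length vs \<longrightarrow> ?T (vs ! i) (vs ! j) (vs ! k) = 0)"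
    unfolding B[symmetric] T[symmetric]
    by (subst cochain_eq_iff)
      (simp_all add: circ_val_space lamf_space d_kap_space c(1,2) d_kap_zero
        all_idx_three[of "\<lambda>gs us. circ_val lamf lamf gs us = d_kap gs us"])
  also have "(\<forall>g i j. i < j \<longrightarrow> j < length vs \<longrightarrow> ?B g (vs ! i) (vs ! j) = 0) \<longleftrightarrow> (\<forall>g u v. ?B g u v = 0)"
  proof (intro iffI allI)
    fix g u v assume z: "\<forall>g i j. i < j \<longrightarrow> j < length vs \<longrightarrow> ?B g (vs ! i) (vs ! j) = 0"
    show "?B g u v = 0"
    proof (rule alternating_two_zero[where B = "?B g"])
      show "lin scale (\<lambda>u. ?B g u v)" for v
        by (intro lin_intros_mult lin_lam1 lam_linear2 kap_linear1 lin_act[where F = "\<lambda>u. kap u _"])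
      show "lin scale (\<lambda>v. ?B g u v)" for u
        by (intro lin_intros_mult lin_lam1 lam_linear2 kap_linear2 lin_act[where F = "\<lambda>v. kap _ v"])
    qed (use z in auto)
  qed blast
  also have "(\<forall>i j k. i < j \<longrightarrow> j < k \<longrightarrow> k < length vs \<longrightarrow> ?T (vs ! i) (vs ! j) (vs ! k) = 0)
      \<longleftrightarrow> (\<forall>u v w. ?T u v w = 0)"
  proof (intro iffI allI)
    fix u v w assume z: "\<forall>i j k. i < j \<longrightarrow> j < k \<longrightarrow> k < length vs \<longrightarrow> ?T (vs ! i) (vs ! j) (vs ! k) = 0"
    show "?T u v w = 0"
    proof (rule alternating_three_zero[where T = ?T])
      note lins = lin_intros_mult lin_star_left lin_star_right lin_of_vec lin_of_grpalg kap_linear1 kap_linear2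
      show "lin scale (\<lambda>u. ?T u v w)" for v w unfolding d_kap_vec by (intro lins)
      show "lin scale (\<lambda>v. ?T u v w)" for u w unfolding d_kap_vec by (intro lins)
      show "lin scale (\<lambda>w. ?T u v w)" for u v unfolding d_kap_vec by (intro lins)
      show "?T u v u = 0" for u v
        using kap_anti[of v u] by (simp add: d_kap_vec 0 of_grpalg_simps star_left star_right)
    qed (use z in \<open>auto simp: d_kap_vec 0 star_left star_right\<close>)
  qed blast
  finally show ?thesis unfolding TT kap_cond_def jac_vec_cond_def by auto
qed

text \<open>The circle product with \<open>kap\<close> outside vanishes on generators, as
  \<open>kap\<close> gives 0 on a group element and a vector. The other one lives in bidegree (0,3),
  where it is the cyclic sum of \<open>jac_grp_cond\<close>.\<close>

lemma circ_lam_kap_iff: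
  assumes D: "\<forall>x\<in>res_space 3. dstar (lam_cochain lam) x = 0"
  shows "(\<forall>x\<in>res_space 3. bracket \<phi> \<psi> (lam_cochain lam) (kap_cochain kap) x = 0)
    \<longleftrightarrow> jac_grp_cond"
proof -
  have L: "low_degree (bil lamf) lam (\<lambda>_ _. 0)" using D by (intro low_degree_lam) auto
  note c = circ_val[OF L low_degree_kap] and c' = circ_val[OF low_degree_kap L]
  have 0: "of_grpalg 0 = 0" by (simp add: of_grpalg_def)
  let ?T = "\<lambda>u v w. lam (kap u v) w + lam (kap v w) u + lam (kap w u) v"
  have T: "circ_val lamf kapf [] [u, v, w] = 0 \<longleftrightarrow> ?T u v w = 0" for u v w
    unfolding c using of_grpalg_inject[of _ 0] by (simp add: 0)
  have "circ \<phi> \<psi> (kap_cochain kap) (lam_cochain lam) x = 0" if "x \<in> res_space 3" for x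
  proof -
    have "\<forall>x\<in>res_space 3. cochain (circ_val kapf lamf) x = 0"
      by (subst cochain_zero_iff)
        (simp_all add: circ_val_space lamf_space kapf_space c' 0
          all_idx_three[of "\<lambda>gs us. circ_val kapf lamf gs us = 0"])
    thus ?thesis using that by (simp add: lam_cochain_lamf kap_cochain_kapf circ_eq_cochain lamf_space kapf_space)
  qed
  hence "(\<forall>x\<in>res_space 3. bracket \<phi> \<psi> (lam_cochain lam) (kap_cochain kap) x = 0) \<longleftrightarrow>
      (\<forall>x\<in>res_space 3. cochain (circ_val lamf kapf) x = 0)"
    by (simp add: bracket_circ lam_cochain_lamf kap_cochain_kapf circ_eq_cochain lamf_space kapf_space)
  also have "\<dots> \<longleftrightarrow> (\<forall>i j k. i < j \<longrightarrow> j < k \<longrightarrow> k < length vs \<longrightarrow> ?T (vs ! i) (vs ! j) (vs ! k) = 0)"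
    unfolding T[symmetric]
    by (subst cochain_zero_iff)
      (simp_all add: circ_val_space lamf_space kapf_space c(1-3) 0 lam_simps
        all_idx_three[of "\<lambda>gs us. circ_val lamf kapf gs us = 0"])
  also have "\<dots> \<longleftrightarrow> (\<forall>u v w. ?T u v w = 0)"
  proof (intro iffI allI)
    fix u v w assume z: "\<forall>i j k. i < j \<longrightarrow> j < k \<longrightarrow> k < length vs \<longrightarrow> ?T (vs ! i) (vs ! j) (vs ! k) = 0"
    show "?T u v w = 0"
    proof (rule alternating_three_zero[where T = ?T])
      note lins = lin_add lin_lam1 lam_linear2 kap_linear1 kap_linear2
      show "lin scale (\<lambda>u. ?T u v w)" for v w by (intro lins)
      show "lin scale (\<lambda>v. ?T u v w)" for u w by (intro lins)
      show "lin scale (\<lambda>w. ?T u v w)" for u v by (intro lins)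
      show "?T u u w = 0" for u w using kap_anti[of u w] by (simp add: lam_simps)
      show "?T u v v = 0" for u v using kap_anti[of u v] by (simp add: lam_simps)
      show "?T u v u = 0" for u v using kap_anti[of u v] by (simp add: lam_simps)
    qed (use z in auto)
  qed blast
  finally show ?thesis by (simp add: jac_grp_cond_def)
qed

lemma bracket_self: "bracket \<phi> \<psi> \<alpha> \<alpha> x = pscale 2 (circ \<phi> \<psi> \<alpha> \<alpha> x)"
  using pm.scale_left_distrib[of 1 1 "circ \<phi> \<psi> \<alpha> \<alpha> x"] by (simp add: bracket_circ)

text \<open>Outside characteristic 2 the factor 2 can be cancelled; in characteristic 2 the circle
  product condition is the second conjunct and implies the first.\<close>

lemma bracket_lam_lam_iff:
  "(\<forall>x\<in>res_space 3. bracket \<phi> \<psi> \<alpha> \<alpha> x = pscale 2 (\<beta> x)) \<and>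
    (CHAR('k) = 2 \<longrightarrow> (\<forall>x\<in>res_space 3. circ \<phi> \<psi> \<alpha> \<alpha> x = \<beta> x)) \<longleftrightarrow>
    (\<forall>x\<in>res_space 3. circ \<phi> \<psi> \<alpha> \<alpha> x = \<beta> x)"
proof (cases "CHAR('k) = 2")
  case False
  have "(2 :: 'k) \<noteq> 0"
  proof
    assume "(2 :: 'k) = 0"
    hence "of_nat 2 = (0 :: 'k)" by simp
    hence "CHAR('k) dvd 2" by (simp only: of_nat_eq_0_iff_char_dvd)
    hence "CHAR('k) \<le> 2" "CHAR('k) \<noteq> 0"
      by (simp_all add: dvd_imp_le) (metis dvd_0_left_iff neq0_conv zero_neq_numeral)
    moreover have "CHAR('k) \<noteq> 1" by simp
    ultimately show False using False by linarith
  qed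
  thus ?thesis using False by (simp add: bracket_self)
qed (auto simp: bracket_self)

text \<open>The brackets can be evaluated only under the first condition. If that fails, both sides
  are false, as it is equivalent to two of the five identities.\<close>

theorem PBW_iff_cochains:
  "PBW lam kap \<longleftrightarrow>
     (\<forall>x\<in>res_space 3. dstar (lam_cochain lam) x = 0) \<and>
     (\<forall>x\<in>res_space 3. bracket \<phi> \<psi> (lam_cochain lam) (lam_cochain lam) x
        = pscale 2 (dstar (kap_cochain kap) x)) \<and>
     (CHAR('k) = 2 \<longrightarrow>
       (\<forall>x\<in>res_space 3. circ \<phi> \<psi> (lam_cochain lam) (lam_cochain lam) x = dstar (kap_cochain kap) x)) \<and>
     (\<forall>x\<in>res_space 3. bracket \<phi> \<psi> (lam_cochain lam) (kap_cochain kap) x = 0)"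
proof (cases "\<forall>x\<in>res_space 3. dstar (lam_cochain lam) x = 0")
  case True
  have split: "(B \<and> P \<longleftrightarrow> C) \<Longrightarrow> (D \<and> C \<and> L) \<longleftrightarrow> (D \<and> B \<and> P \<and> L)" for B P C D L
    by blast
  show ?thesis
    unfolding PBW_iff_cond dstar_lam_iff[symmetric] circ_lam_lam_iff[OF True, symmetric]
      circ_lam_kap_iff[OF True, symmetric]
    by (rule split[OF bracket_lam_lam_iff])
next
  case False
  show ?thesis
    unfolding PBW_iff_cond dstar_lam_iff[symmetric] by (simp only: False simp_thms)
qed

end

theorem theorem8p3:
  fixes scale :: "'k::field \<Rightarrow> 'v::ab_group_add \<Rightarrow> 'v"
    and vs :: "'v list"
    and act :: "'g::{group_add, finite} \<Rightarrow> 'v \<Rightarrow> 'v"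
    and lam :: "('g \<Rightarrow>\<^sub>0 'k) \<Rightarrow> 'v \<Rightarrow> ('g \<Rightarrow>\<^sub>0 'k)"
    and kap :: "'v \<Rightarrow> 'v \<Rightarrow> ('g \<Rightarrow>\<^sub>0 'k)"
    and \<phi> :: "nat \<Rightarrow> ('g, 'k) res \<Rightarrow> ('g, 'k) bar"
    and \<psi> :: "nat \<Rightarrow> ('g, 'k) bar \<Rightarrow> ('g, 'k) res"
  assumes "skew_setup scale vs act"
    and "\<forall>v. Vector_Spaces.linear pscale pscale (\<lambda>x. lam x v)"
    and "\<forall>x. Vector_Spaces.linear scale pscale (lam x)"
    and "\<forall>w. Vector_Spaces.linear scale pscale (\<lambda>v. kap v w)"
    and "\<forall>v. Vector_Spaces.linear scale pscale (kap v)"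
    and "\<forall>v. kap v v = 0"
    and "skew_setup.degree_zero_chain_maps scale vs act \<phi> \<psi>"
    and "skew_setup.prescribed_values scale vs act \<phi> \<psi>"
  shows "skew_setup.PBW scale vs act lam kap \<longleftrightarrow>
     (\<forall>x\<in>skew_setup.res_space vs 3.
        skew_setup.dstar scale vs act (skew_setup.lam_cochain scale vs act lam) x = 0) \<and>
     (\<forall>x\<in>skew_setup.res_space vs 3.
        skew_setup.bracket scale vs act \<phi> \<psi>
          (skew_setup.lam_cochain scale vs act lam) (skew_setup.lam_cochain scale vs act lam) x =
        pscale 2 (skew_setup.dstar scale vs act (skew_setup.kap_cochain scale vs act kap) x)) \<and>
     (CHAR('k) = 2 \<longrightarrow>
       (\<forall>x\<in>skew_setup.res_space vs 3.
          skew_setup.circ scale vs act \<phi> \<psi>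
            (skew_setup.lam_cochain scale vs act lam) (skew_setup.lam_cochain scale vs act lam) x =
          skew_setup.dstar scale vs act (skew_setup.kap_cochain scale vs act kap) x)) \<and>
     (\<forall>x\<in>skew_setup.res_space vs 3.
        skew_setup.bracket scale vs act \<phi> \<psi>
          (skew_setup.lam_cochain scale vs act lam) (skew_setup.kap_cochain scale vs act kap) x = 0)"
proof -
  interpret chain_maps scale vs act lam kap \<phi> \<psi>
    using assms by (simp add: chain_maps_def chain_maps_axioms_def pbw_data_def pbw_data_axioms_def)
  show ?thesis by (rule PBW_iff_cochains)
qed

end
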